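(* Consider a multi-layer stochastic block model (SBM) with $n$ nodes, $L$ layers and a fixed number $K$ of communities, with sparsity parameter $\rho$ and sampling probability $p\in(0,1]$, as described in the context. Suppose (Balanced communities) there are constants $c,C>0$ with $cn/K\le n_k\le Cn/K$ for every $k\in[K]$, where $n_k$ is the number of nodes in community $k$; and (Eigen-gap and full rank) $\sum_{l=1}^L B_{l,0}^2$ has full rank $K$ with $\sigma_{\min}\big(\sum_{l=1}^L B_{l,0}^2\big)\ge cL$, where $\sigma_{\min}$ denotes the minimum eigenvalue. Let $\widehat\Theta$ be the output of the RSC algorithm with power parameter $q\asymp \log n$. Then: (i) If $\frac{\log(L+n)}{pnL^{1/2}}\lesssim \rho\lesssim \frac{1}{pn}$, then with probability larger than $1-O((L+n)^{-c_1})-2e^{-c_2K}$ for some positive constants $c_1,c_2$, $$\mathcal L(\Theta,\widehat\Theta)\lesssim \max\Big\{\frac{\log^2(L+n)}{p^3Ln^2\rho^2},\ \frac{1}{n^2}\Big\}.$$ (ii) If $\rho\gtrsim \frac{\log(L+n)}{pn}$, then with probability larger than $1-O((L+n)^{-c_3})-2e^{-c_4K}$ for some positive constants $c_3,c_4$, $$\mathcal L(\Theta,\widehat\Theta)\lesssim \max\Big\{\frac{\log(L+n)}{pLn\rho},\ \frac{1}{n^2}\Big\}.$$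
   Context: Multi-layer SBM: each node $i\in[n]$ has a community label $g_i\in[K]$; $\Theta\in\{0,1\}^{n\times K}$ is the membership matrix with $\Theta_{ik}=1$ iff $g_i=k$. For each layer $l\in[L]$ there is a symmetric block probability matrix $B_l=\rho B_{l,0}\in[0,1]^{K\times K}$, where $B_{l,0}$ has nonnegative entries bounded by an absolute constant. The adjacency matrices $A_l\in\{0,1\}^{n\times n}$ are symmetric, independent across layers, with $A_{l,ii}=0$ and $A_{l,ij}$, $i<j$, independent $\mathrm{Bernoulli}(B_{l,g_ig_j})$, $A_{l,ji}=A_{l,ij}$. Write $P_l=\Theta B_l\Theta^T$. RSC algorithm (inputs $\{A_l\}$, $K$, $p$, $q$): (1) Random sampling: for each $l$ and each pair $i<j$, independently, the pair is selected with probability $p$; set $\tilde A_{l,ij}=A_{l,ij}/p$ if selected and $0$ otherwise, $\tilde A_{l,ji}=\tilde A_{l,ij}$, $\tilde A_{l,ii}=0$. (2) Bias correction: let $\tilde d_{l,i}=\#\{j:\tilde A_{l,ij}=1/p\}$, $\tilde D_l=\mathrm{diag}(\tilde d_{l,1},\dots,\tilde d_{l,n})$, and $\bar M=\frac1L\sum_{l=1}^L\big(\frac{\tilde A_l^2}{n}-\frac{\tilde D_l}{np^2}\big)$. (3) Randomized block Krylov eigen-decomposition: draw an $n\times K$ matrix $\Omega$ with i.i.d. standard Gaussian entries; form $G=[\bar M\Omega,\bar M^3\Omega,\dots,\bar M^{2q+1}\Omega]$; let $Q\in\mathbb R^{n\times(q+1)K}$ be the orthonormal factor of the QR decomposition $G=QR$;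 let $U_K$ be the top $K$ eigenvectors of $C=Q^T\bar MQ$ and set $\hat U=QU_K$. (4) Solve $k$-means with $K$ clusters on the rows of $\hat U$; the resulting clustering is encoded as the estimated membership matrix $\widehat\Theta\in\{0,1\}^{n\times K}$. Misclassification rate: $\mathcal L(\Theta,\widehat\Theta)=\min_{\Psi}\frac1n\|\widehat\Theta\Psi-\Theta\|_0$, minimum over $K\times K$ permutation matrices $\Psi$, where $\|\cdot\|_0$ counts nonzero entries. $K$ is fixed; $f\lesssim g$ means $f\le cg$ for a constant $c>0$ not depending on $n,L,p,\rho$; $f\asymp g$ means $f\lesssim g$ and $g\lesssim f$. Probabilities are over the network, the sampling, and $\Omega$. *)

theory Defs
  imports "HOL-Probability.Probability" "HOL-Combinatorics.Permutations"
begin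

text \<open>Matrices are represented as functions nat => nat => real together with explicit
dimensions; only entries inside the stated index ranges are ever used.\<close>

type_synonym rmat = "nat \<Rightarrow> nat \<Rightarrow> real"

definition mmult :: "nat \<Rightarrow> rmat \<Rightarrow> rmat \<Rightarrow> rmat" where
  "mmult m X Y = (\<lambda>i j. \<Sum>k<m. X i k * Y k j)"

definition mtrans :: "rmat \<Rightarrow> rmat" where
  "mtrans X = (\<lambda>i j. X j i)"

definition mid :: rmat where
  "mid = (\<lambda>i j. if i = j then 1 else 0)"

fun mpow :: "nat \<Rightarrow> rmat \<Rightarrow> nat \<Rightarrow> rmat" where
  "mpow n M 0 = mid"
| "mpow n M (Suc k) = mmult n M (mpow n M k)"

definition is_eigenvalue :: "nat \<Rightarrow> rmat \<Rightarrow> real \<Rightarrow> bool" where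
  "is_eigenvalue d M lam \<longleftrightarrow>
     (\<exists>v::nat \<Rightarrow> real. (\<exists>i<d. v i \<noteq> 0) \<and> (\<forall>i<d. (\<Sum>j<d. M i j * v j) = lam * v i))"

definition full_rank :: "nat \<Rightarrow> rmat \<Rightarrow> bool" where
  "full_rank d M \<longleftrightarrow>
     (\<forall>v::nat \<Rightarrow> real. (\<forall>i<d. (\<Sum>j<d. M i j * v j) = 0) \<longrightarrow> (\<forall>i<d. v i = 0))"

definition membership :: "(nat \<Rightarrow> nat) \<Rightarrow> rmat" where
  "membership g = (\<lambda>i k. if g i = k then 1 else 0)"

definition comm_size :: "nat \<Rightarrow> (nat \<Rightarrow> nat) \<Rightarrow> nat \<Rightarrow> nat" where
  "comm_size n g k = card {i. i < n \<and> g i = k}"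

definition pair_set :: "nat \<Rightarrow> nat \<Rightarrow> (nat \<times> nat \<times> nat) set" where
  "pair_set L n = {(l,i,j). l < L \<and> i < j \<and> j < n}"

text \<open>B l k k' is the (k,k') entry of B_l = rho B_{l,0}.\<close>
definition network_measure ::
  "nat \<Rightarrow> nat \<Rightarrow> (nat \<Rightarrow> nat) \<Rightarrow> (nat \<Rightarrow> nat \<Rightarrow> nat \<Rightarrow> real) \<Rightarrow> (nat \<times> nat \<times> nat \<Rightarrow> bool) measure" where
  "network_measure L n g B =
     PiM (pair_set L n) (\<lambda>(l,i,j). measure_pmf (bernoulli_pmf (B l (g i) (g j))))"

definition sampling_measure :: "nat \<Rightarrow> nat \<Rightarrow> real \<Rightarrow> (nat \<times> nat \<times> nat \<Rightarrow> bool) measure" where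
  "sampling_measure L n p = PiM (pair_set L n) (\<lambda>_. measure_pmf (bernoulli_pmf p))"

definition gaussian_measure :: "nat \<Rightarrow> nat \<Rightarrow> (nat \<times> nat \<Rightarrow> real) measure" where
  "gaussian_measure n K = PiM ({..<n} \<times> {..<K}) (\<lambda>_. density lborel std_normal_density)"

definition rsc_space ::
  "nat \<Rightarrow> nat \<Rightarrow> nat \<Rightarrow> (nat \<Rightarrow> nat) \<Rightarrow> (nat \<Rightarrow> nat \<Rightarrow> nat \<Rightarrow> real) \<Rightarrow> real \<Rightarrow>
   (((nat \<times> nat \<times> nat \<Rightarrow> bool) \<times> (nat \<times> nat \<times> nat \<Rightarrow> bool)) \<times> (nat \<times> nat \<Rightarrow> real)) measure" where
  "rsc_space L n K g B p =
     (network_measure L n g B \<Otimes>\<^sub>M sampling_measure L n p) \<Otimes>\<^sub>M gaussian_measure n K"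

definition sym_entry :: "(nat \<times> nat \<times> nat \<Rightarrow> bool) \<Rightarrow> nat \<Rightarrow> nat \<Rightarrow> nat \<Rightarrow> bool" where
  "sym_entry X l i j = (if i < j then X (l,i,j) else if j < i then X (l,j,i) else False)"

definition sampled_adj ::
  "real \<Rightarrow> (nat \<times> nat \<times> nat \<Rightarrow> bool) \<Rightarrow> (nat \<times> nat \<times> nat \<Rightarrow> bool) \<Rightarrow> nat \<Rightarrow> rmat" where
  "sampled_adj p A S l = (\<lambda>i j. (if sym_entry A l i j then 1 else 0) * (if sym_entry S l i j then 1 / p else 0))"

definition sampled_deg ::
  "nat \<Rightarrow> real \<Rightarrow> (nat \<times> nat \<times> nat \<Rightarrow> bool) \<Rightarrow> (nat \<times> nat \<times> nat \<Rightarrow> bool) \<Rightarrow> nat \<Rightarrow> nat \<Rightarrow> nat" where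
  "sampled_deg n p A S l i = card {j. j < n \<and> sampled_adj p A S l i j = 1 / p}"

definition Mbar ::
  "nat \<Rightarrow> nat \<Rightarrow> real \<Rightarrow> (nat \<times> nat \<times> nat \<Rightarrow> bool) \<Rightarrow> (nat \<times> nat \<times> nat \<Rightarrow> bool) \<Rightarrow> rmat" where
  "Mbar L n p A S = (\<lambda>i j. (1 / real L) * (\<Sum>l<L.
      mmult n (sampled_adj p A S l) (sampled_adj p A S l) i j / real n
      - (if i = j then real (sampled_deg n p A S l i) / (real n * p ^ 2) else 0)))"

text \<open>G = [M Om, M^3 Om, ..., M^(2q+1) Om], an n x (q+1)K matrix; column s*K+k of G is
column k of M^(2s+1) Om.\<close>
definition krylov_G :: "nat \<Rightarrow> nat \<Rightarrow> nat \<Rightarrow> rmat \<Rightarrow> rmat \<Rightarrow> rmat" where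
  "krylov_G n K q M Om = (\<lambda>i t. if t < (q + 1) * K
       then mmult n (mpow n M (2 * (t div K) + 1)) Om i (t mod K) else 0)"

definition orthonormal_cols :: "nat \<Rightarrow> nat \<Rightarrow> rmat \<Rightarrow> bool" where
  "orthonormal_cols n m Q \<longleftrightarrow>
     (\<forall>a<m. \<forall>b<m. (\<Sum>i<n. Q i a * Q i b) = (if a = b then 1 else 0))"

definition is_QR_factor :: "nat \<Rightarrow> nat \<Rightarrow> rmat \<Rightarrow> rmat \<Rightarrow> bool" where
  "is_QR_factor n m G Q \<longleftrightarrow> orthonormal_cols n m Q \<and>
     (\<exists>R::rmat. (\<forall>a<m. \<forall>b<m. b < a \<longrightarrow> R a b = 0) \<and>
                 (\<forall>i<n. \<forall>t<m. G i t = (\<Sum>a<m. Q i a * R a t)))"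

text \<open>U (m x K) consists of orthonormal eigenvectors of C (m x m) for its K largest
eigenvalues: every eigenvector orthogonal to the columns of U has eigenvalue at most
each of the eigenvalues belonging to U.\<close>
definition top_eigvecs :: "nat \<Rightarrow> nat \<Rightarrow> rmat \<Rightarrow> rmat \<Rightarrow> bool" where
  "top_eigvecs m K C U \<longleftrightarrow> orthonormal_cols m K U \<and>
     (\<exists>lam::nat \<Rightarrow> real.
        (\<forall>k<K. \<forall>a<m. (\<Sum>b<m. C a b * U b k) = lam k * U a k) \<and>
        (\<forall>(w::nat \<Rightarrow> real) mu. (\<exists>a<m. w a \<noteq> 0) \<and> (\<forall>a<m. (\<Sum>b<m. C a b * w b) = mu * w a)
            \<and> (\<forall>k<K. (\<Sum>a<m. w a * U a k) = 0) \<longrightarrow> (\<forall>k<K. mu \<le> lam k)))"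

definition kmeans_cost :: "nat \<Rightarrow> nat \<Rightarrow> rmat \<Rightarrow> (nat \<Rightarrow> nat) \<Rightarrow> rmat \<Rightarrow> real" where
  "kmeans_cost n K U h z = (\<Sum>i<n. \<Sum>k<K. (U i k - z (h i) k) ^ 2)"

definition kmeans_opt :: "nat \<Rightarrow> nat \<Rightarrow> rmat \<Rightarrow> (nat \<Rightarrow> nat) \<Rightarrow> bool" where
  "kmeans_opt n K U h \<longleftrightarrow> (\<forall>i<n. h i < K) \<and>
     (\<exists>z. \<forall>h' z'. (\<forall>i<n. h' i < K) \<longrightarrow> kmeans_cost n K U h z \<le> kmeans_cost n K U h' z')"

text \<open>All possible outputs (cluster labelings) of RSC with inputs (A, S, Om):
any valid QR factor, any valid choice of top-K eigenvectors, any k-means solution.\<close>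
definition rsc_outputs ::
  "nat \<Rightarrow> nat \<Rightarrow> nat \<Rightarrow> nat \<Rightarrow> real \<Rightarrow> (nat \<times> nat \<times> nat \<Rightarrow> bool) \<Rightarrow>
   (nat \<times> nat \<times> nat \<Rightarrow> bool) \<Rightarrow> (nat \<times> nat \<Rightarrow> real) \<Rightarrow> (nat \<Rightarrow> nat) set" where
  "rsc_outputs L n K q p A S W = {h. \<exists>Q U.
     is_QR_factor n ((q + 1) * K) (krylov_G n K q (Mbar L n p A S) (\<lambda>i k. W (i, k))) Q \<and>
     top_eigvecs ((q + 1) * K) K (mmult n (mtrans Q) (mmult n (Mbar L n p A S) Q)) U \<and>
     kmeans_opt n K (mmult ((q + 1) * K) Q U) h}"

definition perm_matrix :: "(nat \<Rightarrow> nat) \<Rightarrow> rmat" where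
  "perm_matrix \<sigma> = (\<lambda>j k. if \<sigma> j = k then 1 else 0)"

definition misclass_rate :: "nat \<Rightarrow> nat \<Rightarrow> rmat \<Rightarrow> rmat \<Rightarrow> real" where
  "misclass_rate n K Th Thh = Min ((\<lambda>\<sigma>. real (card {(i,k). i < n \<and> k < K \<and>
        mmult K Thh (perm_matrix \<sigma>) i k \<noteq> Th i k}) / real n) ` {\<sigma>. \<sigma> permutes {..<K}})"

definition sbm_model :: "nat \<Rightarrow> nat \<Rightarrow> nat \<Rightarrow> (nat \<Rightarrow> nat) \<Rightarrow> (nat \<Rightarrow> nat \<Rightarrow> nat \<Rightarrow> real) \<Rightarrow> real \<Rightarrow> real \<Rightarrow> bool" where
  "sbm_model K n L g B0 b \<rho> \<longleftrightarrow> n \<ge> 1 \<and> L \<ge> 1 \<and> \<rho> > 0 \<and> (\<forall>i<n. g i < K) \<and>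
     (\<forall>l<L. \<forall>k<K. \<forall>k'<K. B0 l k k' = B0 l k' k \<and> 0 \<le> B0 l k k' \<and> B0 l k k' \<le> b
                          \<and> \<rho> * B0 l k k' \<le> 1)"

definition balanced :: "nat \<Rightarrow> nat \<Rightarrow> (nat \<Rightarrow> nat) \<Rightarrow> real \<Rightarrow> real \<Rightarrow> bool" where
  "balanced K n g c C \<longleftrightarrow>
     (\<forall>k<K. c * real n / real K \<le> real (comm_size n g k) \<and> real (comm_size n g k) \<le> C * real n / real K)"

definition sum_sq :: "nat \<Rightarrow> nat \<Rightarrow> (nat \<Rightarrow> nat \<Rightarrow> nat \<Rightarrow> real) \<Rightarrow> rmat" where
  "sum_sq K L B0 = (\<lambda>a b. \<Sum>l<L. mmult K (B0 l) (B0 l) a b)"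

definition eigen_gap :: "nat \<Rightarrow> nat \<Rightarrow> (nat \<Rightarrow> nat \<Rightarrow> nat \<Rightarrow> real) \<Rightarrow> real \<Rightarrow> bool" where
  "eigen_gap K L B0 c \<longleftrightarrow> full_rank K (sum_sq K L B0) \<and>
     (\<forall>lam. is_eigenvalue K (sum_sq K L B0) lam \<longrightarrow> lam \<ge> c * real L)"

end

theory Submission
  imports Defs
begin

text \<open>
  Up to the factor \<open>p\<^sup>2 L n\<close> the matrix \<open>Mbar\<close> is the off-diagonal part of the sum of the squares of
  independent Bernoulli graphs with edge probabilities \<open>p \<rho> B0\<close>. Writing each graph as its mean plus a
  centred matrix \<open>Y\<close>, the deviation from the population matrix consists of a linear and a quadratic
  polynomial in \<open>Y\<close> and of a diagonal-type bias of relative size \<open>1/n\<close>. Resampling one edge at a time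
  (exchangeable pairs) bounds the trace moments of order \<open>ln (L + n)\<close> of both polynomials by moments of
  row sums of their squared derivatives; these row sums are sums of independent nonnegative terms.

  The population matrix has rank \<open>K\<close>, is bounded below on the span of the community indicators, and the
  remaining eigenvalues of \<open>Mbar\<close> are smaller by a factor \<open>\<eta>\<close>. Hence \<open>2q + 1\<close> powers, with \<open>q\<close> of order
  \<open>ln n\<close>, compensate the polynomial ill-conditioning of the Gaussian test matrix on the leading eigenspace,
  and the Krylov space is within \<open>O(\<eta>)\<close> of the indicators. The Ritz vectors are then within \<open>O(\<eta>)\<close> of
  that span, and k-means misplaces a fraction \<open>O(\<eta>\<^sup>2)\<close> of the nodes. When \<open>\<eta>\<close> is not small the
  asserted bound exceeds the trivial one.
\<close>

text \<open>The quantity to control is the relative noise level \<open>et\<close>. Its square is of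
  order \<open>theta\<close> plus \<open>1 / n^2\<close>: \<open>theta\<close> stems from the edge
  noise, the second term from the diagonal that the bias correction deletes although the low-rank
  population matrix possesses one. These are the two terms of the asserted maximum, and the two
  density regimes amount to two upper bounds for \<open>theta\<close>. The entries of the squared
  adjacency matrices are dependent. What helps is the absence of loops: off the diagonal the
  quadratic noise is affine in every single edge, so that its derivative in an edge is free of that
  edge. The conditioning of the Gaussian test matrix is secured with probability
  \<open>1 - exp (- K)\<close>, a value independent of \<open>n\<close>; this accounts for the
  second error term in the probability. Network and sampling take finitely many values, so
  eigenvectors can be chosen outcome by outcome before the Gaussian event is formed, and no
  measurable choice is involved.\<close>

section \<open>Finite-dimensional vectors and the spectral theorem\<close>

text \<open>Finitely supported sequences: vectors of every dimension \<open>n\<close> live in one inner product type,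
  as the subspaces \<open>V n\<close> below.\<close>
typedef fvec = "{f::nat \<Rightarrow> real. finite {i. f i \<noteq> 0}}" morphisms crd Abs_fvec
  by (rule exI[of _ "\<lambda>_. 0"]) simp

setup_lifting type_definition_fvec

lemma fvec_eqI: "(\<And>i. crd x i = crd y i) \<Longrightarrow> x = y"
  by (metis crd_inject ext)

lemma finite_crd: "finite {i. crd x i \<noteq> 0}"
  using crd[of x] by simp

instantiation fvec :: real_vector
begin

lift_definition zero_fvec :: fvec is "\<lambda>_. 0" by simp
lift_definition plus_fvec :: "fvec \<Rightarrow> fvec \<Rightarrow> fvec" is "\<lambda>f g i. f i + g i"
proof -
  fix f g :: "nat \<Rightarrow> real" assume "finite {i. f i \<noteq> 0}" "finite {i. g i \<noteq> 0}"
  then have "finite ({i. f i \<noteq> 0} \<union> {i. g i \<noteq> 0})" by simp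
  then show "finite {i. f i + g i \<noteq> 0}" by (rule rev_finite_subset) auto
qed
lift_definition uminus_fvec :: "fvec \<Rightarrow> fvec" is "\<lambda>f i. - f i" by simp
lift_definition minus_fvec :: "fvec \<Rightarrow> fvec \<Rightarrow> fvec" is "\<lambda>f g i. f i - g i"
proof -
  fix f g :: "nat \<Rightarrow> real" assume "finite {i. f i \<noteq> 0}" "finite {i. g i \<noteq> 0}"
  then have "finite ({i. f i \<noteq> 0} \<union> {i. g i \<noteq> 0})" by simp
  then show "finite {i. f i - g i \<noteq> 0}" by (rule rev_finite_subset) auto
qed
lift_definition scaleR_fvec :: "real \<Rightarrow> fvec \<Rightarrow> fvec" is "\<lambda>c f i. c * f i"
proof -
  fix c :: real and f :: "nat \<Rightarrow> real" assume "finite {i. f i \<noteq> 0}"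
  then show "finite {i. c * f i \<noteq> 0}" by (rule rev_finite_subset) auto
qed

instance
  by standard (transfer, auto simp: fun_eq_iff algebra_simps)+

end

lemma crd_simps [simp]:
  "crd 0 i = 0" "crd (x + y) i = crd x i + crd y i" "crd (- x) i = - crd x i"
  "crd (x - y) i = crd x i - crd y i" "crd (c *\<^sub>R x) i = c * crd x i"
  by (transfer, simp)+

lemma crd_sum [simp]: "crd (sum f A) i = (\<Sum>a\<in>A. crd (f a) i)"
  by (induction A rule: infinite_finite_induct) auto

instantiation fvec :: real_inner
begin

definition inner_fvec :: "fvec \<Rightarrow> fvec \<Rightarrow> real" where
  "inner_fvec x y = (\<Sum>i\<in>{i. crd x i \<noteq> 0}. crd x i * crd y i)"
definition norm_fvec :: "fvec \<Rightarrow> real" where "norm_fvec x = sqrt (inner x x)"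
definition sgn_fvec :: "fvec \<Rightarrow> fvec" where "sgn_fvec x = x /\<^sub>R norm x"
definition dist_fvec :: "fvec \<Rightarrow> fvec \<Rightarrow> real" where "dist_fvec x y = norm (x - y)"
definition uniformity_fvec :: "(fvec \<times> fvec) filter" where
  "uniformity_fvec = (INF e\<in>{0 <..}. principal {(x, y). dist x y < e})"
definition open_fvec :: "fvec set \<Rightarrow> bool" where
  "open_fvec U = (\<forall>x\<in>U. eventually (\<lambda>(x', y). x' = x \<longrightarrow> y \<in> U) uniformity)"

lemma inner_fvec_superset:
  "finite A \<Longrightarrow> {i. crd x i \<noteq> 0} \<subseteq> A \<Longrightarrow> inner x y = (\<Sum>i\<in>A. crd x i * crd y i)"
  unfolding inner_fvec_def by (rule sum.mono_neutral_left) auto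

instance
proof
  fix x y z :: fvec and r :: real
  let ?S = "{i. crd x i \<noteq> 0} \<union> {i. crd y i \<noteq> 0} \<union> {i. crd z i \<noteq> 0}"
  have fin: "finite ?S" using finite_crd by auto
  have *: "inner u v = (\<Sum>i\<in>?S. crd u i * crd v i)" if "u \<in> {x, y, x + y, r *\<^sub>R x}" for u v
    by (rule inner_fvec_superset[OF fin]) (use that in auto)
  show "inner x y = inner y x" by (simp add: * mult.commute)
  show "inner (x + y) z = inner x z + inner y z"
    by (simp add: * algebra_simps sum.distrib)
  show "inner (r *\<^sub>R x) y = r * inner x y"
    by (simp add: * algebra_simps sum_distrib_left)
  show "0 \<le> inner x x" by (simp add: * sum_nonneg)
  show "(inner x x = 0) = (x = 0)"
  proof
    assume "inner x x = 0"
    then have "\<forall>i\<in>{i. crd x i \<noteq> 0}. crd x i * crd x i = 0"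
      unfolding inner_fvec_def using sum_nonneg_eq_0_iff[OF finite_crd[of x], of "\<lambda>i. crd x i * crd x i"] by auto
    then show "x = 0" by (intro fvec_eqI) auto
  qed (simp add: inner_fvec_def)
qed (simp_all add: norm_fvec_def sgn_fvec_def dist_fvec_def uniformity_fvec_def open_fvec_def)

end

definition V :: "nat \<Rightarrow> fvec set" where "V n = {x. \<forall>i\<ge>n. crd x i = 0}"

lift_definition mkv :: "nat \<Rightarrow> (nat \<Rightarrow> real) \<Rightarrow> fvec" is "\<lambda>n f i. if i < n then f i else 0"
  by (rule finite_subset[of _ "{..<_}"]) (auto split: if_splits)

lemma crd_mkv [simp]: "crd (mkv n f) i = (if i < n then f i else 0)"
  by transfer simp

lemma mkv_in_V [simp]: "mkv n f \<in> V n" by (simp add: V_def)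

lemma V_simps [simp]: "0 \<in> V n" "x \<in> V n \<Longrightarrow> y \<in> V n \<Longrightarrow> x + y \<in> V n"
  "x \<in> V n \<Longrightarrow> y \<in> V n \<Longrightarrow> x - y \<in> V n" "x \<in> V n \<Longrightarrow> c *\<^sub>R x \<in> V n" "x \<in> V n \<Longrightarrow> - x \<in> V n"
  by (auto simp: V_def)

lemma V_sum [simp]: "(\<And>a. a \<in> A \<Longrightarrow> f a \<in> V n) \<Longrightarrow> sum f A \<in> V n"
  by (auto simp: V_def)

lemma V_eqI: "x \<in> V n \<Longrightarrow> y \<in> V n \<Longrightarrow> (\<And>i. i < n \<Longrightarrow> crd x i = crd y i) \<Longrightarrow> x = y"
  unfolding V_def by (rule fvec_eqI) (metis (mono_tags, lifting) mem_Collect_eq not_less)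

lemma inner_V: "x \<in> V n \<Longrightarrow> inner x y = (\<Sum>i<n. crd x i * crd y i)"
  by (rule inner_fvec_superset) (auto simp: V_def not_le[symmetric])

lemma inner_V2: "y \<in> V n \<Longrightarrow> inner x y = (\<Sum>i<n. crd x i * crd y i)"
  by (subst inner_commute) (simp add: inner_V mult.commute)

lemma norm_V: "x \<in> V n \<Longrightarrow> (norm x)\<^sup>2 = (\<Sum>i<n. (crd x i)\<^sup>2)"
  by (subst power2_norm_eq_inner, subst inner_V) (auto simp: power2_eq_square)

definition bv :: "nat \<Rightarrow> fvec" where "bv i = mkv (Suc i) (\<lambda>j. if j = i then 1 else 0)"

lemma crd_bv [simp]: "crd (bv i) j = (if j = i then 1 else 0)"
  by (simp add: bv_def)

lemma inner_bv [simp]: "inner x (bv i) = crd x i" "inner (bv i) x = crd x i"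
proof -
  have "bv i \<in> V (Suc i)" by (simp add: bv_def)
  then show "inner x (bv i) = crd x i" by (simp add: inner_V2 if_distrib cong: if_cong)
  then show "inner (bv i) x = crd x i" by (simp add: inner_commute)
qed

lemma bv_in_V: "i < n \<Longrightarrow> bv i \<in> V n" by (simp add: V_def)

definition mv :: "nat \<Rightarrow> nat \<Rightarrow> rmat \<Rightarrow> fvec \<Rightarrow> fvec" where
  "mv n m A x = mkv n (\<lambda>i. \<Sum>j<m. A i j * crd x j)"

lemma mv_in_V [simp]: "mv n m A x \<in> V n" by (simp add: mv_def)

lemma crd_mv [simp]: "crd (mv n m A x) i = (if i < n then \<Sum>j<m. A i j * crd x j else 0)"
  by (simp add: mv_def)

lemma linear_mv: "linear (mv n m A)"
  by (rule linearI; rule fvec_eqI)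
     (auto simp: algebra_simps sum.distrib sum_distrib_left)

lemma mv_adj: "inner (mv n m A x) y = inner x (mv m n (mtrans A) y)"
proof -
  have "inner (mv n m A x) y = (\<Sum>i<n. \<Sum>j<m. A i j * crd x j * crd y i)"
    by (simp add: inner_V[OF mv_in_V] sum_distrib_right)
  also have "\<dots> = (\<Sum>j<m. \<Sum>i<n. A i j * crd x j * crd y i)" by (rule sum.swap)
  also have "\<dots> = inner x (mv m n (mtrans A) y)"
    by (simp add: inner_V2[OF mv_in_V] sum_distrib_left mtrans_def algebra_simps)
  finally show ?thesis .
qed

definition symm :: "nat \<Rightarrow> rmat \<Rightarrow> bool" where
  "symm n A \<longleftrightarrow> (\<forall>i<n. \<forall>j<n. A i j = A j i)"

lemma mv_cong: "(\<And>i j. i < n \<Longrightarrow> j < m \<Longrightarrow> A i j = B i j) \<Longrightarrow> mv n m A x = mv n m B x"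
  by (rule fvec_eqI) auto

lemma mv_symm: "symm n A \<Longrightarrow> inner (mv n n A x) y = inner x (mv n n A y)"
  by (subst mv_adj, rule arg_cong[where f = "inner x"], rule mv_cong) (auto simp: symm_def mtrans_def)

lemma mv_mmult: "mv n m (mmult k A B) x = mv n k A (mv k m B x)"
proof (rule V_eqI[of _ n])
  fix i assume i: "i < n"
  have "crd (mv n m (mmult k A B) x) i = (\<Sum>j<m. \<Sum>t<k. A i t * B t j * crd x j)"
    using i by (simp add: mmult_def sum_distrib_right)
  also have "\<dots> = (\<Sum>t<k. \<Sum>j<m. A i t * B t j * crd x j)" by (rule sum.swap)
  also have "\<dots> = crd (mv n k A (mv k m B x)) i"
    using i by (simp add: sum_distrib_left mult.assoc)
  finally show "crd (mv n m (mmult k A B) x) i = crd (mv n k A (mv k m B x)) i" .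
qed auto

lemma mv_mid: "x \<in> V n \<Longrightarrow> mv n n mid x = x"
  by (rule V_eqI[of _ n]) (auto simp: mid_def if_distrib[of "\<lambda>z. z * _"] cong: if_cong)

section \<open>Underdetermined linear systems and orthonormal families\<close>

lemma underdetermined_system:
  fixes A :: "'i \<Rightarrow> 'j \<Rightarrow> real"
  assumes "finite I" "finite J" "card I < card J"
  shows "\<exists>c. (\<exists>j\<in>J. c j \<noteq> 0) \<and> (\<forall>i\<in>I. (\<Sum>j\<in>J. A i j * c j) = 0)"
  using assms
proof (induction I arbitrary: J A rule: finite_induct)
  case empty
  then obtain j where "j \<in> J" by fastforce
  then show ?case by (intro exI[of _ "\<lambda>_. 1"]) auto
next
  case (insert i0 I)
  show ?case
  proof (cases "\<exists>j\<in>J. A i0 j \<noteq> 0")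
    case False
    obtain c where "\<exists>j\<in>J. c j \<noteq> 0" "\<forall>i\<in>I. (\<Sum>j\<in>J. A i j * c j) = 0"
      using insert.IH[of J A] insert.prems insert.hyps by auto
    then show ?thesis using False by (intro exI[of _ c]) auto
  next
    case True
    then obtain k where k: "k \<in> J" "A i0 k \<noteq> 0" by auto
    let ?J = "J - {k}"
    \<comment> \<open>Gaussian elimination: row \<open>i0\<close> is solved for the unknown
      \<open>k\<close>, which costs one equation and one unknown, so the strict inequality of
      cardinalities survives.\<close>
    let ?A = "\<lambda>i j. A i j - A i k * A i0 j / A i0 k"
    have "card I < card ?J" using insert.prems insert.hyps k by auto
    then obtain c where c: "\<exists>j\<in>?J. c j \<noteq> 0" "\<forall>i\<in>I. (\<Sum>j\<in>?J. ?A i j * c j) = 0"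
      using insert.IH[of ?J ?A] insert.prems by auto
    define d where "d = c(k := - (\<Sum>j\<in>?J. A i0 j * c j) / A i0 k)"
    have sum_d: "(\<Sum>j\<in>J. A i j * d j) = (\<Sum>j\<in>?J. A i j * c j) - A i k * (\<Sum>j\<in>?J. A i0 j * c j) / A i0 k" for i
    proof -
      have "(\<Sum>j\<in>J. A i j * d j) = A i k * d k + (\<Sum>j\<in>?J. A i j * d j)"
        using k insert.prems by (simp add: sum.remove)
      also have "(\<Sum>j\<in>?J. A i j * d j) = (\<Sum>j\<in>?J. A i j * c j)"
        by (rule sum.cong) (auto simp: d_def)
      finally show ?thesis by (simp add: d_def)
    qed
    have "(\<Sum>j\<in>J. A i j * d j) = 0" if "i \<in> insert i0 I" for i
    proof (cases "i = i0")
      case True then show ?thesis using k by (simp add: sum_d)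
    next
      case False
      then have "(\<Sum>j\<in>?J. ?A i j * c j) = 0" using c that by auto
      then show ?thesis unfolding sum_d
        by (simp add: algebra_simps sum_subtractf sum_distrib_left sum_divide_distrib)
    qed
    moreover have "\<exists>j\<in>J. d j \<noteq> 0" using c(1) by (auto simp: d_def)
    ultimately show ?thesis by blast
  qed
qed

definition orthonormal :: "nat \<Rightarrow> (nat \<Rightarrow> 'a::real_inner) \<Rightarrow> bool" where
  "orthonormal k u \<longleftrightarrow> (\<forall>i<k. \<forall>j<k. inner (u i) (u j) = (if i = j then 1 else 0))"

lemma orthonormal_inner_sum:
  assumes "orthonormal k u" "j < k"
  shows "inner (\<Sum>i<k. c i *\<^sub>R u i) (u j) = c j" "inner (u j) (\<Sum>i<k. c i *\<^sub>R u i) = c j"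
proof -
  have "inner (\<Sum>i<k. c i *\<^sub>R u i) (u j) = (\<Sum>i<k. c i * (if i = j then 1 else 0))"
    using assms by (auto simp: inner_sum_left orthonormal_def intro!: sum.cong)
  then show "inner (\<Sum>i<k. c i *\<^sub>R u i) (u j) = c j"
    using assms by (simp add: if_distrib cong: if_cong)
  then show "inner (u j) (\<Sum>i<k. c i *\<^sub>R u i) = c j" by (simp add: inner_commute)
qed

lemma orthonormal_norm_sum:
  assumes "orthonormal k u"
  shows "(norm (\<Sum>i<k. c i *\<^sub>R u i))\<^sup>2 = (\<Sum>i<k. (c i)\<^sup>2)"
  unfolding power2_norm_eq_inner
  by (subst inner_sum_right) (auto simp: orthonormal_inner_sum[OF assms] power2_eq_square intro!: sum.cong)

lemma orthonormal_norm: "orthonormal k u \<Longrightarrow> i < k \<Longrightarrow> norm (u i) = 1"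
  by (simp add: orthonormal_def norm_eq_sqrt_inner)

lemma orthonormal_residual:
  assumes "orthonormal k u" "j < k"
  shows "inner (x - (\<Sum>i<k. inner x (u i) *\<^sub>R u i)) (u j) = 0"
  by (simp add: inner_diff_left orthonormal_inner_sum[OF assms])

lemma orthonormal_pythagoras:
  assumes "orthonormal k u"
  shows "(norm x)\<^sup>2 = (\<Sum>i<k. (inner x (u i))\<^sup>2) + (norm (x - (\<Sum>i<k. inner x (u i) *\<^sub>R u i)))\<^sup>2"
proof -
  define p where "p = (\<Sum>i<k. inner x (u i) *\<^sub>R u i)"
  have "inner (x - p) p = (\<Sum>i<k. inner x (u i) * inner (x - p) (u i))"
    by (simp add: p_def inner_sum_right)
  also have "\<dots> = 0"
    by (rule sum.neutral) (auto simp: p_def orthonormal_residual[OF assms])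
  finally have 0: "inner (x - p) p = 0" .
  have "inner x x = inner (p + (x - p)) (p + (x - p))" by simp
  also have "\<dots> = inner p p + inner (x - p) (x - p)"
    unfolding inner_add_left inner_add_right using 0 by (simp add: inner_commute)
  finally have "(norm x)\<^sup>2 = (norm p)\<^sup>2 + (norm (x - p))\<^sup>2" by (simp only: power2_norm_eq_inner)
  then show ?thesis by (simp add: p_def orthonormal_norm_sum[OF assms])
qed

lemma bessel: "orthonormal k u \<Longrightarrow> (\<Sum>i<k. (inner x (u i))\<^sup>2) \<le> (norm x)\<^sup>2"
  by (drule orthonormal_pythagoras[where x = x]) simp

text \<open>All dimension arguments below are instances of this count: \<open>k\<close>
  orthogonality conditions cannot exhaust \<open>m > k\<close> coefficients. It yields completeness
  of orthonormal systems and both halves of the eigenvalue comparison for perturbed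
  matrices.\<close>

lemma exists_orthogonal_combination:
  fixes w f :: "nat \<Rightarrow> 'a::real_inner"
  assumes "k < m"
  shows "\<exists>c. (\<exists>j<m. c j \<noteq> 0) \<and> (\<forall>i<k. inner (f i) (\<Sum>j<m. c j *\<^sub>R w j) = 0)"
proof -
  obtain c where "\<exists>j\<in>{..<m}. c j \<noteq> 0" "\<forall>i\<in>{..<k}. (\<Sum>j<m. inner (f i) (w j) * c j) = 0"
    using underdetermined_system[of "{..<k}" "{..<m}" "\<lambda>i j. inner (f i) (w j)"] assms by auto
  then show ?thesis by (intro exI[of _ c]) (auto simp: inner_sum_right mult.commute)
qed

lemma orthonormal_bv: "orthonormal n bv"
  by (auto simp: orthonormal_def)

lemma exists_orthogonal_unit:
  assumes "k < n"
  shows "\<exists>x\<in>V n. norm x = 1 \<and> (\<forall>i<k. inner (u i) x = 0)"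
proof -
  obtain c where c: "\<exists>j<n. c j \<noteq> 0" "\<forall>i<k. inner (u i) (\<Sum>j<n. c j *\<^sub>R bv j) = 0"
    using exists_orthogonal_combination[OF assms] by blast
  define y where "y = (\<Sum>j<n. c j *\<^sub>R bv j)"
  have "(\<Sum>i<n. (c i)\<^sup>2) \<noteq> 0" using c(1) by (subst sum_nonneg_eq_0_iff) auto
  then have "norm y \<noteq> 0" using orthonormal_norm_sum[OF orthonormal_bv, of c n] by (auto simp: y_def)
  moreover have "y \<in> V n" unfolding y_def by (intro V_sum V_simps bv_in_V) auto
  ultimately show ?thesis
    using c(2) by (intro bexI[of _ "y /\<^sub>R norm y"]) (auto simp: y_def)
qed

text \<open>A nonzero residual \<open>r\<close> would extend \<open>u\<close> to
  \<open>n + 1\<close> orthogonal nonzero vectors of \<open>V n\<close>. A nontrivial combination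
  orthogonal to all \<open>n\<close> unit vectors is zero, and pairing it with \<open>r\<close> and
  with the \<open>u i\<close> annihilates its coefficients.\<close>

lemma orthonormal_expansion:
  assumes "orthonormal n u" "\<And>i. i < n \<Longrightarrow> u i \<in> V n" "x \<in> V n"
  shows "x = (\<Sum>i<n. inner x (u i) *\<^sub>R u i)"
proof (rule ccontr)
  define r where "r = x - (\<Sum>i<n. inner x (u i) *\<^sub>R u i)"
  assume "x \<noteq> (\<Sum>i<n. inner x (u i) *\<^sub>R u i)"
  then have r0: "r \<noteq> 0" by (simp add: r_def)
  have rV: "r \<in> V n" unfolding r_def by (intro V_sum V_simps assms) auto
  have ru: "inner r (u i) = 0" if "i < n" for i
    unfolding r_def by (rule orthonormal_residual[OF assms(1) that])
  define w where "w = u(n := r)"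
  obtain c where c: "\<exists>j<Suc n. c j \<noteq> 0" "\<forall>i<n. inner (bv i) (\<Sum>j<Suc n. c j *\<^sub>R w j) = 0"
    using exists_orthogonal_combination[of n "Suc n"] by blast
  have eq: "(\<Sum>j<Suc n. c j *\<^sub>R w j) = (\<Sum>j<n. c j *\<^sub>R u j) + c n *\<^sub>R r"
    by (simp add: w_def)
  have "(\<Sum>j<n. c j *\<^sub>R u j) + c n *\<^sub>R r = 0"
  proof (rule V_eqI[of _ n])
    show "(\<Sum>j<n. c j *\<^sub>R u j) + c n *\<^sub>R r \<in> V n" by (intro V_sum V_simps assms rV) auto
    show "crd ((\<Sum>j<n. c j *\<^sub>R u j) + c n *\<^sub>R r) i = crd 0 i" if "i < n" for i
      using c(2) that unfolding eq inner_bv by simp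
  qed simp
  then have z: "(\<Sum>j<n. c j *\<^sub>R u j) = - (c n *\<^sub>R r)" by (simp add: eq_neg_iff_add_eq_0)
  have "inner r (\<Sum>j<n. c j *\<^sub>R u j) = 0" by (simp add: inner_sum_right ru)
  with z r0 have cn: "c n = 0" by auto
  with z have "(\<Sum>i<n. (c i)\<^sup>2) = 0" using orthonormal_norm_sum[OF assms(1), of c] by simp
  then have "\<forall>i<n. c i = 0" by (subst (asm) sum_nonneg_eq_0_iff) auto
  with cn c(1) show False using less_Suc_eq by auto
qed

lemma parseval:
  assumes "orthonormal n u" "\<And>i. i < n \<Longrightarrow> u i \<in> V n" "x \<in> V n"
  shows "inner x y = (\<Sum>i<n. inner x (u i) * inner (u i) y)"
proof -
  have "inner x y = inner (\<Sum>i<n. inner x (u i) *\<^sub>R u i) y"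
    using orthonormal_expansion[OF assms] by (rule arg_cong)
  then show ?thesis by (simp add: inner_sum_left)
qed

lemma parseval_norm:
  assumes "orthonormal n u" "\<And>i. i < n \<Longrightarrow> u i \<in> V n" "x \<in> V n"
  shows "(norm x)\<^sup>2 = (\<Sum>i<n. (inner x (u i))\<^sup>2)"
  unfolding power2_norm_eq_inner
  using parseval[OF assms, of x] by (simp add: power2_eq_square inner_commute)

text \<open>The ambient type is infinite-dimensional, so closedness and boundedness do not suffice
  for compactness. The cube is instead built one coordinate at a time, as a continuous image of a
  product with an interval.\<close>

lemma compact_cube: "compact {x \<in> V n. \<forall>i<n. \<bar>crd x i\<bar> \<le> 1}"
proof (induction n)
  case 0
  have "{x \<in> V 0. \<forall>i<0. \<bar>crd x i\<bar> \<le> 1} = {0}" by (auto simp: V_def intro: fvec_eqI)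
  then show ?case by simp
next
  case (Suc n)
  let ?C = "{x \<in> V n. \<forall>i<n. \<bar>crd x i\<bar> \<le> 1}"
  have "{x \<in> V (Suc n). \<forall>i<Suc n. \<bar>crd x i\<bar> \<le> 1} = (\<lambda>(x, t). x + t *\<^sub>R bv n) ` (?C \<times> {-1..1})"
  proof (intro equalityI subsetI)
    fix x assume x: "x \<in> {x \<in> V (Suc n). \<forall>i<Suc n. \<bar>crd x i\<bar> \<le> 1}"
    have "\<bar>crd x n\<bar> \<le> 1" using x by blast
    moreover have "x - crd x n *\<^sub>R bv n \<in> ?C" using x by (auto simp: V_def Suc_le_eq)
    ultimately show "x \<in> (\<lambda>(x, t). x + t *\<^sub>R bv n) ` (?C \<times> {-1..1})"
      by (intro image_eqI[of _ _ "(x - crd x n *\<^sub>R bv n, crd x n)"]) auto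
  qed (auto simp: V_def abs_le_iff less_Suc_eq)
  also have "compact \<dots>"
    by (intro compact_continuous_image compact_Times Suc.IH compact_Icc)
       (auto simp: case_prod_unfold intro!: continuous_intros)
  finally show ?case .
qed

definition is_eig :: "nat \<Rightarrow> rmat \<Rightarrow> fvec \<Rightarrow> real \<Rightarrow> bool" where
  "is_eig n A x a \<longleftrightarrow> x \<in> V n \<and> mv n n A x = a *\<^sub>R x"

text \<open>The eigenvector is the maximiser of the quadratic form on the unit sphere of the complement.\<close>
lemma max_eigenvector:
  assumes sym: "symm n A" and k: "k < n" and eig: "\<And>i. i < k \<Longrightarrow> is_eig n A (u i) (a i)"
  shows "\<exists>x mu. norm x = 1 \<and> is_eig n A x mu \<and> (\<forall>i<k. inner (u i) x = 0) \<and>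
     (\<forall>y\<in>V n. (\<forall>i<k. inner (u i) y = 0) \<longrightarrow> inner y (mv n n A y) \<le> mu * (norm y)\<^sup>2)"
proof -
  define S where "S = {x \<in> V n. norm x = 1 \<and> (\<forall>i<k. inner (u i) x = 0)}"
  have "S = {x \<in> V n. \<forall>i<n. \<bar>crd x i\<bar> \<le> 1} \<inter> {x. norm x = 1} \<inter> (\<Inter>i\<in>{..<k}. {x. inner (u i) x = 0})"
  proof -
    have "\<bar>crd x i\<bar> \<le> 1" if "norm x = 1" for x i
    proof -
      have "\<bar>inner x (bv i)\<bar> \<le> norm x * norm (bv i)" by (rule Cauchy_Schwarz_ineq2)
      then show ?thesis using that by (simp add: norm_eq_sqrt_inner[of "bv i"])
    qed
    then show ?thesis by (auto simp: S_def)
  qed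
  also have "compact \<dots>"
    by (intro compact_Int_closed compact_cube closed_INT ballI closed_Collect_eq continuous_intros)
  finally have comp: "compact S" .
  have ne: "S \<noteq> {}" using exists_orthogonal_unit[OF k, of u] by (auto simp: S_def)
  have quad: "inner x (mv n n A x) = (\<Sum>i<n. inner x (bv i) * (\<Sum>j<n. A i j * inner x (bv j)))" for x
    by (subst inner_V2[of _ n]) auto
  have cont: "continuous_on S (\<lambda>x. inner x (mv n n A x))"
    unfolding quad by (intro continuous_intros)
  obtain x where x: "x \<in> S" and max: "\<And>y. y \<in> S \<Longrightarrow> inner y (mv n n A y) \<le> inner x (mv n n A x)"
    using continuous_attains_sup[OF comp ne cont] by blast
  define mu where "mu = inner x (mv n n A x)"
  interpret lin: linear "mv n n A" by (rule linear_mv)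
  have xV: "x \<in> V n" and nx: "norm x = 1" and xu: "\<And>i. i < k \<Longrightarrow> inner (u i) x = 0"
    using x by (auto simp: S_def)
  have bound: "inner y (mv n n A y) \<le> mu * (norm y)\<^sup>2"
    if y: "y \<in> V n" "\<And>i. i < k \<Longrightarrow> inner (u i) y = 0" for y
  proof (cases "y = 0")
    case False
    have "y /\<^sub>R norm y \<in> S" using y False by (auto simp: S_def)
    from max[OF this] have "inner y (mv n n A y) / (norm y)\<^sup>2 \<le> mu"
      by (simp add: mu_def lin.scaleR power2_eq_square divide_inverse mult.commute mult.left_commute)
    then show ?thesis using False by (simp add: divide_le_eq)
  qed (simp add: lin.zero)
  \<comment> \<open>First-order condition at the maximiser: moving from \<open>x\<close> to
    \<open>x + t y\<close> changes the excess of the form over \<open>mu\<close> times the squared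
    norm by \<open>2 t p + t^2 q\<close>, which is nonpositive for all \<open>t\<close> only if
    \<open>p = 0\<close>.\<close>
  have first: "inner y (mv n n A x) = mu * inner y x"
    if y: "y \<in> V n" "\<And>i. i < k \<Longrightarrow> inner (u i) y = 0" for y
  proof -
    define p where "p = inner y (mv n n A x) - mu * inner y x"
    define q where "q = inner y (mv n n A y) - mu * (norm y)\<^sup>2"
    have le: "2 * t * p + t\<^sup>2 * q \<le> 0" for t
    proof -
      have "inner (x + t *\<^sub>R y) (mv n n A (x + t *\<^sub>R y)) \<le> mu * (norm (x + t *\<^sub>R y))\<^sup>2"
        by (rule bound) (use xV xu y in \<open>auto simp: inner_add_right\<close>)
      moreover have "inner x (mv n n A y) = inner y (mv n n A x)"
        using mv_symm[OF sym, of x y] by (simp add: inner_commute)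
      moreover have "inner x x = 1" using nx by (simp add: norm_eq_sqrt_inner)
      ultimately show ?thesis
        unfolding power2_norm_eq_inner p_def q_def
        by (simp add: lin.add lin.scaleR inner_add_left inner_add_right
              mu_def[symmetric] inner_commute[of x y] power2_eq_square algebra_simps)
    qed
    have "p = 0"
    proof (rule ccontr)
      assume p: "p \<noteq> 0"
      \<comment> \<open>With this step length the quadratic term is at most \<open>t * p\<close> in
        size, half of the linear one.\<close>
      define t where "t = p / (1 + \<bar>q\<bar>)"
      have "t\<^sup>2 * (- q) \<le> t\<^sup>2 * (1 + \<bar>q\<bar>)" by (intro mult_left_mono) auto
      also have "\<dots> = t * p" by (simp add: t_def power2_eq_square)
      finally have "2 * t * p \<le> t * p" using le[of t] by linarith
      then have "t * p \<le> 0" by linarith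
      moreover have "t * p = p\<^sup>2 / (1 + \<bar>q\<bar>)" by (simp add: t_def power2_eq_square)
      moreover have "p\<^sup>2 / (1 + \<bar>q\<bar>) > 0" using p by (intro divide_pos_pos) auto
      ultimately show False by linarith
    qed
    then show ?thesis by (simp add: p_def)
  qed
  \<comment> \<open>The residual is orthogonal to the earlier eigenvectors, hence itself an
    admissible direction; testing the first-order condition with it shows that it vanishes.\<close>
  define r where "r = mv n n A x - mu *\<^sub>R x"
  have "inner (u i) r = 0" if "i < k" for i
  proof -
    have "inner (u i) (mv n n A x) = inner (mv n n A (u i)) x" by (simp add: mv_symm[OF sym])
    also have "\<dots> = 0" using eig[OF that] xu[OF that] by (simp add: is_eig_def)
    finally show ?thesis using xu[OF that] by (simp add: r_def inner_diff_right)
  qed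
  moreover have rV: "r \<in> V n" using xV by (simp add: r_def)
  ultimately have "inner r (mv n n A x) = mu * inner r x" by (intro first)
  then have "inner r r = 0" by (simp add: r_def inner_diff_right)
  then have "mv n n A x = mu *\<^sub>R x" by (simp add: r_def)
  then show ?thesis
    using xV nx xu bound by (intro exI[of _ x] exI[of _ mu]) (auto simp: is_eig_def)
qed

text \<open>The last clause takes the place of a sorting condition: it bounds the Rayleigh quotient
  on the complement of the first \<open>k\<close> vectors, from which both the decreasing order of
  the \<open>a k\<close> and the min-max comparison follow.\<close>

definition eigbasis :: "nat \<Rightarrow> rmat \<Rightarrow> (nat \<Rightarrow> fvec) \<Rightarrow> (nat \<Rightarrow> real) \<Rightarrow> bool" where
  "eigbasis n A u a \<longleftrightarrow> orthonormal n u \<and> (\<forall>i<n. is_eig n A (u i) (a i)) \<and>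
     (\<forall>k<n. \<forall>y\<in>V n. (\<forall>i<k. inner (u i) y = 0) \<longrightarrow> inner y (mv n n A y) \<le> a k * (norm y)\<^sup>2)"

theorem spectral_theorem:
  assumes sym: "symm n A"
  shows "\<exists>u a. eigbasis n A u a"
proof -
  have "\<exists>u a. orthonormal m u \<and> (\<forall>i<m. is_eig n A (u i) (a i)) \<and>
     (\<forall>k<m. \<forall>y\<in>V n. (\<forall>i<k. inner (u i) y = 0) \<longrightarrow> inner y (mv n n A y) \<le> a k * (norm y)\<^sup>2)"
    if "m \<le> n" for m
    using that
  proof (induction m)
    case 0 then show ?case by (auto simp: orthonormal_def)
  next
    case (Suc m)
    then obtain u a where IH: "orthonormal m u" "\<forall>i<m. is_eig n A (u i) (a i)"
     "\<forall>k<m. \<forall>y\<in>V n. (\<forall>i<k. inner (u i) y = 0) \<longrightarrow> inner y (mv n n A y) \<le> a k * (norm y)\<^sup>2"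
      by auto
    obtain x mu where x: "norm x = 1" "is_eig n A x mu" "\<forall>i<m. inner (u i) x = 0"
     "\<forall>y\<in>V n. (\<forall>i<m. inner (u i) y = 0) \<longrightarrow> inner y (mv n n A y) \<le> mu * (norm y)\<^sup>2"
      using max_eigenvector[OF sym, of m u a] Suc.prems IH(2) by auto
    have "inner x x = 1" using x(1) by (simp add: norm_eq_sqrt_inner)
    then show ?case using IH x
      by (intro exI[of _ "u(m := x)"] exI[of _ "a(m := mu)"])
         (auto simp: orthonormal_def less_Suc_eq inner_commute)
  qed
  then show ?thesis unfolding eigbasis_def by blast
qed

section \<open>Moments of matrix polynomials in Bernoulli variables\<close>

definition bern :: "'e set \<Rightarrow> ('e \<Rightarrow> real) \<Rightarrow> ('e \<Rightarrow> bool) pmf" where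
  "bern E pr = Pi_pmf E False (\<lambda>e. bernoulli_pmf (pr e))"

definition bexp :: "'e set \<Rightarrow> ('e \<Rightarrow> real) \<Rightarrow> (('e \<Rightarrow> bool) \<Rightarrow> real) \<Rightarrow> real" where
  "bexp E pr f = measure_pmf.expectation (bern E pr) f"

lemma finite_set_bern: "finite E \<Longrightarrow> finite (set_pmf (bern E pr))"
  unfolding bern_def
  by (rule finite_subset[OF set_Pi_pmf_subset']) (auto intro!: finite_PiE_dflt)

lemma integrable_bern: "finite E \<Longrightarrow> integrable (measure_pmf (bern E pr)) (f :: _ \<Rightarrow> real)"
  by (rule integrable_measure_pmf_finite[OF finite_set_bern])

lemma bexp_add: "finite E \<Longrightarrow> bexp E pr (\<lambda>w. f w + g w) = bexp E pr f + bexp E pr g"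
  unfolding bexp_def by (rule Bochner_Integration.integral_add) (auto simp: integrable_bern)

lemma bexp_cmult: "bexp E pr (\<lambda>w. c * f w) = c * bexp E pr f"
  unfolding bexp_def by simp

lemma bexp_const [simp]: "bexp E pr (\<lambda>w. c) = c"
  unfolding bexp_def by simp

lemma bexp_sum: "finite E \<Longrightarrow> bexp E pr (\<lambda>w. \<Sum>i\<in>I. f i w) = (\<Sum>i\<in>I. bexp E pr (f i))"
  unfolding bexp_def by (rule Bochner_Integration.integral_sum) (auto simp: integrable_bern)

lemma bexp_mono: "finite E \<Longrightarrow> (\<And>w. f w \<le> g w) \<Longrightarrow> bexp E pr f \<le> bexp E pr g"
  unfolding bexp_def by (rule integral_mono) (auto simp: integrable_bern)

lemma bexp_nonneg: "(\<And>w. 0 \<le> f w) \<Longrightarrow> 0 \<le> bexp E pr f"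
  unfolding bexp_def by (rule Bochner_Integration.integral_nonneg) auto

lemma bexp_empty: "bexp {} pr f = f (\<lambda>_. False)"
  by (simp add: bexp_def bern_def)

lemma bexp_insert:
  assumes "finite E" "e \<notin> E" "0 \<le> pr e" "pr e \<le> 1"
  shows "bexp (insert e E) pr f =
    pr e * bexp E pr (\<lambda>w. f (w(e := True))) + (1 - pr e) * bexp E pr (\<lambda>w. f (w(e := False)))"
proof -
  have "bern (insert e E) pr = bernoulli_pmf (pr e) \<bind> (\<lambda>y. map_pmf (\<lambda>w. w(e := y)) (bern E pr))"
    unfolding bern_def using assms by (simp add: Pi_pmf_insert' map_pmf_def)
  then have "bexp (insert e E) pr f = (\<Sum>y\<in>UNIV. pmf (bernoulli_pmf (pr e)) y *\<^sub>R
      measure_pmf.expectation (map_pmf (\<lambda>w. w(e := y)) (bern E pr)) f)"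
    unfolding bexp_def using assms(1)
    by (simp only:, intro pmf_expectation_bind) (auto simp: finite_set_bern)
  then show ?thesis using assms by (simp add: UNIV_bool bexp_def)
qed

definition prob_weights :: "'e set \<Rightarrow> ('e \<Rightarrow> real) \<Rightarrow> bool" where
  "prob_weights E pr \<longleftrightarrow> finite E \<and> (\<forall>e\<in>E. 0 \<le> pr e \<and> pr e \<le> 1)"

text \<open>Averages out one coordinate with the others held fixed. The exchangeable pair enters
  only through this identity, both values of the resampled coordinate being summed
  explicitly.\<close>

lemma bexp_resample:
  assumes "prob_weights E pr" "e \<in> E"
  shows "bexp E pr f = bexp E pr (\<lambda>w. pr e * f (w(e := True)) + (1 - pr e) * f (w(e := False)))"
proof -
  obtain E' where E': "E = insert e E'" "e \<notin> E'" using assms(2) by (metis mk_disjoint_insert)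
  have p: "finite E'" "0 \<le> pr e" "pr e \<le> 1" using assms E' by (auto simp: prob_weights_def)
  show ?thesis unfolding E'(1)
    by (subst (1 2) bexp_insert[of E' e pr, OF p(1) E'(2) p(2,3)])
       (simp only: fun_upd_upd bexp_add[OF p(1)] bexp_cmult, simp add: algebra_simps)
qed

definition depends_on :: "'e set \<Rightarrow> (('e \<Rightarrow> bool) \<Rightarrow> 'b) \<Rightarrow> bool" where
  "depends_on S f \<longleftrightarrow> (\<forall>w w'. (\<forall>e\<in>S. w e = w' e) \<longrightarrow> f w = f w')"

lemma depends_onD: "depends_on S f \<Longrightarrow> (\<And>e. e \<in> S \<Longrightarrow> w e = w' e) \<Longrightarrow> f w = f w'"
  unfolding depends_on_def by blast

text \<open>Induction over the coordinates: each one lies in \<open>S\<close> or in its complement,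
  so only one of the two factors changes when it is averaged out.\<close>

lemma bexp_indep:
  assumes "prob_weights E pr" "depends_on S f" "depends_on (- S) g"
  shows "bexp E pr (\<lambda>w. f w * g w) = bexp E pr f * bexp E pr g"
proof -
  have "finite E" using assms(1) by (simp add: prob_weights_def)
  then show ?thesis using assms
  proof (induction E arbitrary: f g rule: finite_induct)
    case empty then show ?case by (simp add: bexp_empty)
  next
    case (insert e E)
    have p: "0 \<le> pr e" "pr e \<le> 1" and pw: "prob_weights E pr"
      using insert.prems by (auto simp: prob_weights_def)
    note ins = bexp_insert[of E e pr, OF insert.hyps(1,2) p]
    have up: "depends_on S (\<lambda>w. f (w(e := b)))" "depends_on (- S) (\<lambda>w. g (w(e := b)))" for b
      using insert.prems(2,3) unfolding depends_on_def by auto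
    show ?case
    proof (cases "e \<in> S")
      case True
      have g: "g (w(e := b)) = g w" for w b
        by (rule depends_onD[OF insert.prems(3)]) (use True in auto)
      have IH: "bexp E pr (\<lambda>w. f (w(e := b)) * g w) = bexp E pr (\<lambda>w. f (w(e := b))) * bexp E pr g" for b
        by (rule insert.IH[OF pw up(1) insert.prems(3)])
      show ?thesis unfolding ins g IH by (simp only: distrib_right mult.assoc) (simp add: algebra_simps)
    next
      case False
      have f: "f (w(e := b)) = f w" for w b
        by (rule depends_onD[OF insert.prems(2)]) (use False in auto)
      have IH: "bexp E pr (\<lambda>w. f w * g (w(e := b))) = bexp E pr f * bexp E pr (\<lambda>w. g (w(e := b)))" for b
        by (rule insert.IH[OF pw insert.prems(2) up(2)])
      show ?thesis unfolding ins f IH by (simp add: algebra_simps)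
    qed
  qed
qed

text \<open>Case distinction at \<open>y * (k + 1) = x\<close>. If \<open>y\<close> is smaller, the
  factor \<open>(1 + 1 / (k + 1)) ^ k\<close> stays below \<open>e\<close>, whereas a factor
  \<open>2 ^ k\<close> in front of \<open>x ^ k\<close> would ruin a recursion over
  \<open>k\<close>. The large constant falls on \<open>y\<close>, which is a single summand in the
  application.\<close>

lemma power_sum_le_split:
  fixes x y :: real
  assumes "0 \<le> x" "0 \<le> y"
  shows "(x + y) ^ k \<le> 3 * x ^ k + (real k + 2) ^ k * y ^ k"
proof (cases "y * (real k + 1) \<le> x")
  case True
  have "(x + y) ^ k \<le> (x * (1 + 1 / (real k + 1))) ^ k"
    using True assms by (intro power_mono) (auto simp: field_simps)
  also have "\<dots> = x ^ k * (1 + 1 / (real k + 1)) ^ k" by (simp add: power_mult_distrib)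
  also have "(1 + 1 / (real k + 1)) ^ k \<le> exp (1 / (real k + 1)) ^ k"
    by (intro power_mono) (auto simp: exp_ge_add_one_self)
  also have "\<dots> = exp (real k * (1 / (real k + 1)))" by (rule exp_of_nat_mult[symmetric])
  also have "\<dots> \<le> exp 1" by simp
  also have "\<dots> \<le> 3" by (rule exp_le)
  finally have "(x + y) ^ k \<le> x ^ k * 3" using assms by (simp add: mult_left_mono)
  then show ?thesis using assms by (simp add: add_increasing2)
next
  case False
  then have "(x + y) ^ k \<le> ((real k + 2) * y) ^ k"
    using assms by (intro power_mono) (auto simp: algebra_simps)
  then show ?thesis using assms by (simp add: power_mult_distrib add_increasing)
qed

text \<open>In \<open>T ^ (k + 1)\<close> one factor is written as the sum of the
  \<open>t q\<close>, and the remaining \<open>T ^ k\<close> is compared with the power of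
  \<open>T - t q\<close>, which is independent of \<open>t q\<close>. This gives the recursion
  \<open>step\<close>; \<open>mt\<close> bounds the sum of the means and \<open>(M + 1) * R\<close>
  the effect of single summands. The first form keeps one factor \<open>mt\<close> outside the
  power, so that its conclusion has the shape required by \<open>mom\<close> in a further
  application.\<close>

lemma moment_recursion:
  fixes t :: "'q \<Rightarrow> ('e \<Rightarrow> bool) \<Rightarrow> real"
  assumes pw: "prob_weights E pr" and fin: "finite I"
    and nn: "\<And>q w. q \<in> I \<Longrightarrow> 0 \<le> t q w"
    and dep: "\<And>q. q \<in> I \<Longrightarrow> depends_on (S q) (t q)"
    and disj: "\<And>q q'. q \<in> I \<Longrightarrow> q' \<in> I \<Longrightarrow> q \<noteq> q' \<Longrightarrow> S q \<inter> S q' = {}"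
    and mom: "\<And>q k. q \<in> I \<Longrightarrow> k < M \<Longrightarrow> bexp E pr (\<lambda>w. t q w ^ Suc k) \<le> mu * R ^ k"
    and cardI: "real (card I) * mu \<le> mt" and mt: "0 \<le> mt" and R: "0 \<le> R" and B: "4 * mt \<le> B" "(real M + 1) * R \<le> B"
  shows "k < M \<Longrightarrow> bexp E pr (\<lambda>w. (\<Sum>q\<in>I. t q w) ^ Suc k) \<le> 4 * mt * B ^ k"
    and "k \<le> M \<Longrightarrow> bexp E pr (\<lambda>w. (\<Sum>q\<in>I. t q w) ^ k) \<le> B ^ k"
proof -
  define T where "T w = (\<Sum>q\<in>I. t q w)" for w
  define T' where "T' q w = (\<Sum>r\<in>I-{q}. t r w)" for q w
  have finE: "finite E" using pw by (simp add: prob_weights_def)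
  have T: "T w = T' q w + t q w" if "q \<in> I" for q w
    using that fin by (simp add: T_def T'_def sum.remove)
  have nnT': "0 \<le> T' q w" for q w unfolding T'_def by (intro sum_nonneg nn) auto
  have nnT: "0 \<le> T w" for w unfolding T_def by (intro sum_nonneg nn) auto
  have B0: "0 \<le> B" using mt B by linarith
  have depT': "depends_on (- S q) (\<lambda>w. T' q w ^ k)" if "q \<in> I" for q k
    unfolding depends_on_def T'_def
  proof (intro allI impI, rule arg_cong[where f = "\<lambda>z. z ^ k"], rule sum.cong[OF refl])
    fix w w' :: "'e \<Rightarrow> bool" and r assume *: "\<forall>e\<in>- S q. w e = w' e" and r: "r \<in> I - {q}"
    show "t r w = t r w'"
      by (rule depends_onD[OF dep]) (use r * disj[of r q] that in auto)
  qed
  have step: "bexp E pr (\<lambda>w. T w ^ Suc k) \<le> 3 * mt * bexp E pr (\<lambda>w. T w ^ k) + ((real k + 2) * R) ^ k * mt"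
    if k: "k < M" for k
  proof -
    have mu1: "bexp E pr (t q) \<le> mu" if "q \<in> I" for q
      using mom[OF that, of 0] k by simp
    have "T w ^ Suc k = (\<Sum>q\<in>I. t q w * T w ^ k)" for w
      by (simp add: T_def sum_distrib_right)
    also have "\<dots> w \<le> (\<Sum>q\<in>I. 3 * (t q w * T' q w ^ k) + (real k + 2) ^ k * t q w ^ Suc k)" for w
    proof (rule sum_mono)
      fix q assume q: "q \<in> I"
      have "t q w * T w ^ k \<le> t q w * (3 * T' q w ^ k + (real k + 2) ^ k * t q w ^ k)"
        unfolding T[OF q] using nn[OF q] nnT' by (intro mult_left_mono power_sum_le_split) auto
      then show "t q w * T w ^ k \<le> 3 * (t q w * T' q w ^ k) + (real k + 2) ^ k * t q w ^ Suc k"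
        by (simp add: algebra_simps)
    qed
    finally have "bexp E pr (\<lambda>w. T w ^ Suc k) \<le>
       bexp E pr (\<lambda>w. \<Sum>q\<in>I. 3 * (t q w * T' q w ^ k) + (real k + 2) ^ k * t q w ^ Suc k)"
      by (intro bexp_mono finE)
    also have "\<dots> = (\<Sum>q\<in>I. 3 * (bexp E pr (t q) * bexp E pr (\<lambda>w. T' q w ^ k)) + (real k + 2) ^ k * bexp E pr (\<lambda>w. t q w ^ Suc k))"
      unfolding bexp_sum[OF finE] bexp_add[OF finE] bexp_cmult
      by (rule sum.cong[OF refl]) (simp add: bexp_indep[OF pw dep depT'] del: power_Suc)
    also have "\<dots> \<le> (\<Sum>q\<in>I. 3 * (mu * bexp E pr (\<lambda>w. T w ^ k)) + (real k + 2) ^ k * (mu * R ^ k))"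
    proof (intro sum_mono add_mono mult_left_mono mult_mono mu1 mom k)
      fix q assume q: "q \<in> I"
      show "bexp E pr (\<lambda>w. T' q w ^ k) \<le> bexp E pr (\<lambda>w. T w ^ k)"
        using nn[OF q] nnT' by (intro bexp_mono finE power_mono) (auto simp: T[OF q])
      show "0 \<le> mu" using mu1[OF q] bexp_nonneg[of "t q" E pr, OF nn[OF q]] by linarith
      show "0 \<le> bexp E pr (\<lambda>w. T' q w ^ k)" using nnT' by (intro bexp_nonneg) auto
    qed auto
    also have "\<dots> = (real (card I) * mu) * (3 * bexp E pr (\<lambda>w. T w ^ k) + ((real k + 2) * R) ^ k)"
      by (simp add: power_mult_distrib) (simp add: algebra_simps)
    also have "\<dots> \<le> mt * (3 * bexp E pr (\<lambda>w. T w ^ k) + ((real k + 2) * R) ^ k)"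
      using nnT R by (intro mult_right_mono cardI add_nonneg_nonneg mult_nonneg_nonneg bexp_nonneg) auto
    finally show ?thesis by (simp add: algebra_simps)
  qed
  have Bk: "((real k + 2) * R) ^ k \<le> B ^ k" if "k < M" for k
  proof (rule power_mono)
    have "(real k + 2) * R \<le> (real M + 1) * R" using that R by (intro mult_right_mono) auto
    then show "(real k + 2) * R \<le> B" using B by linarith
  qed (use R in auto)
  have main: "k \<le> M \<Longrightarrow> bexp E pr (\<lambda>w. T w ^ k) \<le> B ^ k" for k
  proof (induction k)
    case (Suc k)
    have "bexp E pr (\<lambda>w. T w ^ Suc k) \<le> 3 * mt * bexp E pr (\<lambda>w. T w ^ k) + ((real k + 2) * R) ^ k * mt"
      using Suc.prems by (intro step) auto
    also have "\<dots> \<le> 3 * mt * B ^ k + B ^ k * mt"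
      using Suc mt by (intro add_mono mult_left_mono mult_right_mono Bk) auto
    also have "\<dots> = 4 * mt * B ^ k" by simp
    also have "\<dots> \<le> B * B ^ k" using B0 B by (intro mult_right_mono) auto
    finally show ?case by simp
  qed simp
  show "bexp E pr (\<lambda>w. (\<Sum>q\<in>I. t q w) ^ k) \<le> B ^ k" if "k \<le> M"
    using main[OF that] by (simp add: T_def)
  show "bexp E pr (\<lambda>w. (\<Sum>q\<in>I. t q w) ^ Suc k) \<le> 4 * mt * B ^ k" if "k < M"
  proof -
    have "bexp E pr (\<lambda>w. T w ^ Suc k) \<le> 3 * mt * bexp E pr (\<lambda>w. T w ^ k) + ((real k + 2) * R) ^ k * mt"
      using that by (intro step) auto
    also have "\<dots> \<le> 3 * mt * B ^ k + B ^ k * mt"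
      using main[of k] that mt by (intro add_mono mult_left_mono mult_right_mono Bk) auto
    finally show ?thesis by (simp add: T_def)
  qed
qed

section \<open>Trace functionals and resampled coordinates\<close>

definition espair :: "nat \<Rightarrow> rmat \<Rightarrow> (nat \<Rightarrow> fvec) \<times> (nat \<Rightarrow> real)" where
  "espair n A = (SOME ua. eigbasis n A (fst ua) (snd ua))"

definition evec :: "nat \<Rightarrow> rmat \<Rightarrow> nat \<Rightarrow> fvec" where "evec n A = fst (espair n A)"
definition evl :: "nat \<Rightarrow> rmat \<Rightarrow> nat \<Rightarrow> real" where "evl n A = snd (espair n A)"

lemma eigbasis_evec: "symm n A \<Longrightarrow> eigbasis n A (evec n A) (evl n A)"
  unfolding evec_def evl_def espair_def using spectral_theorem[of n A]
  by (intro someI_ex[where P = "\<lambda>ua. eigbasis n A (fst ua) (snd ua)"]) auto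

lemma evec_facts:
  assumes "symm n A"
  shows "orthonormal n (evec n A)" "i < n \<Longrightarrow> evec n A i \<in> V n"
    "i < n \<Longrightarrow> mv n n A (evec n A i) = evl n A i *\<^sub>R evec n A i"
  using eigbasis_evec[OF assms] by (auto simp: eigbasis_def is_eig_def)

text \<open>\<open>phi n r A D\<close> and \<open>psi n r A D\<close> are the traces of \<open>A\<^sup>r D\<close> and of \<open>A\<^sup>r D\<^sup>2\<close>.\<close>
definition phi :: "nat \<Rightarrow> nat \<Rightarrow> rmat \<Rightarrow> rmat \<Rightarrow> real" where
  "phi n r A D = (\<Sum>i<n. evl n A i ^ r * inner (evec n A i) (mv n n D (evec n A i)))"

definition psi :: "nat \<Rightarrow> nat \<Rightarrow> rmat \<Rightarrow> rmat \<Rightarrow> real" where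
  "psi n r A D = (\<Sum>i<n. evl n A i ^ r * (norm (mv n n D (evec n A i)))\<^sup>2)"

text \<open>For nonnegative numbers the differences \<open>x ^ k - y ^ k\<close> and
  \<open>x ^ (s - k) - y ^ (s - k)\<close> have the same sign; evenness of \<open>s\<close> allows
  passing to absolute values.\<close>

lemma even_power_pair_bound:
  fixes a b :: real
  assumes "k \<le> s" "even s"
  shows "a ^ k * b ^ (s - k) + a ^ (s - k) * b ^ k \<le> a ^ s + b ^ s"
proof -
  have mono: "0 \<le> (x ^ k - y ^ k) * (x ^ (s - k) - y ^ (s - k))" if "0 \<le> x" "0 \<le> y" for x y :: real
    using power_mono[of x y] power_mono[of y x] that
    by (cases "x \<le> y") (auto intro!: mult_nonneg_nonneg mult_nonpos_nonpos)
  have e: "x ^ k * x ^ (s - k) = x ^ s" for x :: real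
    using assms by (simp add: power_add[symmetric])
  have "a ^ k * b ^ (s - k) + a ^ (s - k) * b ^ k \<le> \<bar>a\<bar> ^ k * \<bar>b\<bar> ^ (s - k) + \<bar>a\<bar> ^ (s - k) * \<bar>b\<bar> ^ k"
    by (intro add_mono) (metis abs_ge_self abs_mult power_abs)+
  also have "\<dots> \<le> \<bar>a\<bar> ^ s + \<bar>b\<bar> ^ s"
    using mono[of "\<bar>a\<bar>" "\<bar>b\<bar>"] e[of "\<bar>a\<bar>"] e[of "\<bar>b\<bar>"] by (simp add: algebra_simps)
  finally show ?thesis using assms(2) by (simp add: power_even_abs)
qed

text \<open>The divided difference is a sum of \<open>r\<close> monomials
  \<open>a ^ k * b ^ (s - k)\<close>, and pairing \<open>k\<close> with \<open>s - k\<close> bounds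
  each pair by the two pure powers. It is the trapezoidal bound for the convex even power
  \<open>r - 1\<close>.\<close>

lemma odd_power_secant_bound:
  fixes a b :: real
  assumes "odd r"
  shows "(a - b) * (a ^ r - b ^ r) \<le> real r / 2 * ((a - b)\<^sup>2 * (a ^ (r - 1) + b ^ (r - 1)))"
proof -
  define s where "s = r - 1"
  have s: "r = Suc s" "even s" using assms by (auto simp: s_def elim: oddE)
  have "2 * (\<Sum>k<r. a ^ k * b ^ (s - k)) = (\<Sum>k<r. a ^ k * b ^ (s - k)) + (\<Sum>k<r. a ^ (s - k) * b ^ (s - (s - k)))"
    using sum.nat_diff_reindex[of "\<lambda>k. a ^ k * b ^ (s - k)" r] by (simp add: s(1))
  also have "\<dots> = (\<Sum>k<r. a ^ k * b ^ (s - k) + a ^ (s - k) * b ^ k)"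
    by (simp add: sum.distrib[symmetric] s(1))
  also have "\<dots> \<le> (\<Sum>k<r. a ^ s + b ^ s)"
    using s by (intro sum_mono even_power_pair_bound) auto
  finally have le: "(\<Sum>k<r. a ^ k * b ^ (s - k)) \<le> real r / 2 * (a ^ s + b ^ s)" by simp
  have "a ^ r - b ^ r = (a - b) * (\<Sum>k<r. a ^ k * b ^ (s - k))"
    unfolding s(1) diff_power_eq_sum by (simp add: mult.commute)
  then have "(a - b) * (a ^ r - b ^ r) = (a - b)\<^sup>2 * (\<Sum>k<r. a ^ k * b ^ (s - k))"
    by (simp add: power2_eq_square)
  also have "\<dots> \<le> (a - b)\<^sup>2 * (real r / 2 * (a ^ s + b ^ s))"
    using le by (intro mult_left_mono) auto
  finally show ?thesis by (simp add: s_def algebra_simps)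
qed

lemma mv_diff_mat:
  "(\<And>i j. i < n \<Longrightarrow> j < n \<Longrightarrow> D i j = A i j - B i j) \<Longrightarrow> mv n n D x = mv n n A x - mv n n B x"
  by (rule fvec_eqI) (auto simp: left_diff_distrib sum_subtractf)

text \<open>\<open>A\<close> and \<open>B\<close> need not commute, so both eigenbases are used at
  once: between \<open>u i\<close> and \<open>w j\<close> the matrix \<open>D\<close> has the entry
  \<open>(a i - b j) * c i j\<close>. All four traces become double sums with the common weights
  \<open>(c i j)^2\<close>, and the scalar secant bound applies term by term.\<close>

lemma trace_mean_value:
  assumes A: "symm n A" and B: "symm n B" and r: "odd r"
    and D: "\<And>i j. i < n \<Longrightarrow> j < n \<Longrightarrow> D i j = A i j - B i j"
  shows "phi n r A D - phi n r B D \<le> real r / 2 * (psi n (r - 1) A D + psi n (r - 1) B D)"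
proof -
  define u a w b where uw: "u = evec n A" "a = evl n A" "w = evec n B" "b = evl n B"
  note ua = evec_facts[OF A, folded uw(1,2)] and wb = evec_facts[OF B, folded uw(3,4)]
  define c where "c i j = inner (u i) (w j)" for i j
  have Du: "inner (w j) (mv n n D (u i)) = (a i - b j) * c i j" if "i < n" "j < n" for i j
    using mv_symm[OF B, of "w j" "u i"] ua(3)[OF that(1)] wb(3)[OF that(2)]
    by (simp add: mv_diff_mat[OF D] inner_diff_right c_def algebra_simps inner_commute)
  have Dw: "inner (u i) (mv n n D (w j)) = (a i - b j) * c i j" if "i < n" "j < n" for i j
    using mv_symm[OF A, of "u i" "w j"] ua(3)[OF that(1)] wb(3)[OF that(2)]
    by (simp add: mv_diff_mat[OF D] inner_diff_right c_def algebra_simps)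
  have 1: "inner (u i) (mv n n D (u i)) = (\<Sum>j<n. (a i - b j) * (c i j)\<^sup>2)" if "i < n" for i
    by (subst parseval[OF wb(1,2) ua(2)[OF that]])
       (auto simp: Du[OF that] c_def power2_eq_square intro!: sum.cong)
  have 2: "inner (w j) (mv n n D (w j)) = (\<Sum>i<n. (a i - b j) * (c i j)\<^sup>2)" if "j < n" for j
    by (subst parseval[OF ua(1,2) wb(2)[OF that]])
       (auto simp: Dw[OF _ that] c_def power2_eq_square inner_commute intro!: sum.cong)
  have 3: "(norm (mv n n D (u i)))\<^sup>2 = (\<Sum>j<n. (a i - b j)\<^sup>2 * (c i j)\<^sup>2)" if "i < n" for i
    by (subst parseval_norm[OF wb(1,2) mv_in_V])
       (auto simp: Du[OF that] inner_commute[of "mv n n D (u i)"] power_mult_distrib intro!: sum.cong)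
  have 4: "(norm (mv n n D (w j)))\<^sup>2 = (\<Sum>i<n. (a i - b j)\<^sup>2 * (c i j)\<^sup>2)" if "j < n" for j
    by (subst parseval_norm[OF ua(1,2) mv_in_V])
       (auto simp: Dw[OF _ that] inner_commute[of "mv n n D (w j)"] power_mult_distrib intro!: sum.cong)
  have p1: "phi n r A D = (\<Sum>i<n. \<Sum>j<n. a i ^ r * ((a i - b j) * (c i j)\<^sup>2))"
    unfolding phi_def uw(1,2)[symmetric] by (rule sum.cong) (auto simp: 1 sum_distrib_left)
  have p2: "phi n r B D = (\<Sum>i<n. \<Sum>j<n. b j ^ r * ((a i - b j) * (c i j)\<^sup>2))"
    unfolding phi_def uw(3,4)[symmetric] by (subst sum.swap, rule sum.cong) (auto simp: 2 sum_distrib_left)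
  have p3: "psi n (r - 1) A D = (\<Sum>i<n. \<Sum>j<n. a i ^ (r - 1) * ((a i - b j)\<^sup>2 * (c i j)\<^sup>2))"
    unfolding psi_def uw(1,2)[symmetric] by (rule sum.cong) (auto simp: 3 sum_distrib_left)
  have p4: "psi n (r - 1) B D = (\<Sum>i<n. \<Sum>j<n. b j ^ (r - 1) * ((a i - b j)\<^sup>2 * (c i j)\<^sup>2))"
    unfolding psi_def uw(3,4)[symmetric] by (subst sum.swap, rule sum.cong) (auto simp: 4 sum_distrib_left)
  have "phi n r A D - phi n r B D = (\<Sum>i<n. \<Sum>j<n. (a i - b j) * (a i ^ r - b j ^ r) * (c i j)\<^sup>2)"
    unfolding p1 p2 sum_subtractf[symmetric] by (intro sum.cong) (auto simp: algebra_simps)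
  also have "\<dots> \<le> (\<Sum>i<n. \<Sum>j<n. real r / 2 * ((a i - b j)\<^sup>2 * (a i ^ (r - 1) + b j ^ (r - 1))) * (c i j)\<^sup>2)"
    by (intro sum_mono mult_right_mono odd_power_secant_bound r) auto
  also have "\<dots> = real r / 2 * (psi n (r - 1) A D + psi n (r - 1) B D)"
    unfolding p3 p4 sum.distrib[symmetric] sum_distrib_left by (intro sum.cong) (auto simp: algebra_simps)
  finally show ?thesis .
qed

text \<open>Weighted arithmetic-geometric mean inequality, in a form free of division.\<close>

lemma young_power:
  fixes y z :: real
  assumes "0 \<le> y" "0 \<le> z"
  shows "real (Suc m) * (y * z ^ m) \<le> y ^ Suc m + real m * z ^ Suc m"
proof (induction m)
  case (Suc m)
  have "0 \<le> (y ^ Suc m - z ^ Suc m) * (y - z)"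
    using power_mono[of y z "Suc m"] power_mono[of z y "Suc m"] assms
    by (cases "y \<le> z") (auto intro!: mult_nonneg_nonneg mult_nonpos_nonpos simp del: power_Suc)
  moreover have "z * (real (Suc m) * (y * z ^ m)) \<le> z * (y ^ Suc m + real m * z ^ Suc m)"
    using Suc assms by (intro mult_left_mono) auto
  ultimately show ?case by (simp add: algebra_simps)
qed simp

lemma mv_sum_mat:
  "mv n n (\<lambda>i j. k * (\<Sum>e\<in>E. y e * G e i j)) x = k *\<^sub>R (\<Sum>e\<in>E. y e *\<^sub>R mv n n (G e) x)"
proof (rule fvec_eqI)
  fix i
  have "(\<Sum>j<n. k * (\<Sum>e\<in>E. y e * G e i j) * crd x j) = (\<Sum>j<n. \<Sum>e\<in>E. k * (y e * (G e i j * crd x j)))"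
    by (simp add: sum_distrib_left sum_distrib_right mult.assoc)
  also have "\<dots> = (\<Sum>e\<in>E. \<Sum>j<n. k * (y e * (G e i j * crd x j)))" by (rule sum.swap)
  finally show "crd (mv n n (\<lambda>i j. k * (\<Sum>e\<in>E. y e * G e i j)) x) i =
     crd (k *\<^sub>R (\<Sum>e\<in>E. y e *\<^sub>R mv n n (G e) x)) i"
    by (simp add: sum_distrib_left)
qed

lemma phi_sum_mat:
  "phi n r A (\<lambda>i j. k * (\<Sum>e\<in>E. y e * G e i j)) = k * (\<Sum>e\<in>E. y e * phi n r A (G e))"
proof -
  have "phi n r A (\<lambda>i j. k * (\<Sum>e\<in>E. y e * G e i j)) =
     (\<Sum>i<n. \<Sum>e\<in>E. k * (y e * (evl n A i ^ r * inner (evec n A i) (mv n n (G e) (evec n A i)))))"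
    unfolding phi_def mv_sum_mat
    by (simp add: inner_sum_right sum_distrib_left algebra_simps)
  also have "\<dots> = (\<Sum>e\<in>E. \<Sum>i<n. k * (y e * (evl n A i ^ r * inner (evec n A i) (mv n n (G e) (evec n A i)))))"
    by (rule sum.swap)
  finally show ?thesis unfolding phi_def by (simp add: sum_distrib_left)
qed

lemma phi_cong: "(\<And>i j. i < n \<Longrightarrow> j < n \<Longrightarrow> D i j = D' i j) \<Longrightarrow> phi n r A D = phi n r A D'"
  unfolding phi_def using mv_cong[of n n D D'] by simp

lemma psi_cong: "(\<And>i j. i < n \<Longrightarrow> j < n \<Longrightarrow> D i j = D' i j) \<Longrightarrow> psi n r A D = psi n r A D'"
  unfolding psi_def using mv_cong[of n n D D'] by simp

text \<open>\<open>G e\<close> is the partial derivative of \<open>F\<close> in the coordinate \<open>e\<close>. Resampling that coordinate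
  turns \<open>F\<close> into an exchangeable pair, and Young's inequality closes the resulting bound.\<close>
lemma exchange_moment:
  fixes F :: "('e \<Rightarrow> bool) \<Rightarrow> rmat"
  assumes pw: "prob_weights E pr" and sym: "\<And>w. symm n (F w)" and kappa: "0 \<le> kappa" "kappa \<le> 1"
    and dec: "\<And>w i j. i < n \<Longrightarrow> j < n \<Longrightarrow> F w i j = kappa * (\<Sum>e\<in>E. (of_bool (w e) - pr e) * G e w i j)"
    and diff: "\<And>w e i j. e \<in> E \<Longrightarrow> i < n \<Longrightarrow> j < n \<Longrightarrow> G e w i j = F (w(e := True)) i j - F (w(e := False)) i j"
    and W: "\<And>w v. v \<in> V n \<Longrightarrow> (\<Sum>e\<in>E. \<bar>of_bool (w e) - pr e\<bar> * (norm (mv n n (G e w) v))\<^sup>2) \<le> W w * (norm v)\<^sup>2"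
    and W0: "\<And>w. 0 \<le> W w" and m: "1 \<le> m"
  shows "bexp E pr (\<lambda>w. \<Sum>i<n. evl n (F w) i ^ (2 * m)) \<le> real n * (real m ^ m * bexp E pr (\<lambda>w. W w ^ m))"
proof -
  have finE: "finite E" using pw by (simp add: prob_weights_def)
  define r where "r = 2 * m - 1"
  have r: "odd r" "r - 1 = 2 * (m - 1)" "Suc r = 2 * m" using m by (auto simp: r_def)
  define Y where "Y e w = of_bool (w e) - pr e" for e w
  define X where "X = bexp E pr (\<lambda>w. \<Sum>i<n. evl n (F w) i ^ (2 * m))"
  have ind: "G e (w(e := b)) i j = G e w i j" if "e \<in> E" "i < n" "j < n" for e w b i j
    by (simp add: diff[OF that])
  \<comment> \<open>The trace of the \<open>2 m\<close>-th power is read as the trace of the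
    \<open>r\<close>-th power against one more factor \<open>F\<close>, and only that factor is
    expanded over the coordinates.\<close>
  have tr: "(\<Sum>i<n. evl n (F w) i ^ (2 * m)) = kappa * (\<Sum>e\<in>E. Y e w * phi n r (F w) (G e w))" for w
  proof -
    have "(\<Sum>i<n. evl n (F w) i ^ (2 * m)) = phi n r (F w) (F w)"
      unfolding phi_def r(3)[symmetric]
    proof (rule sum.cong[OF refl])
      fix i assume "i \<in> {..<n}"
      then have i: "i < n" by simp
      have "inner (evec n (F w) i) (evec n (F w) i) = 1"
        using evec_facts(1)[OF sym[of w]] i by (simp add: orthonormal_def)
      then show "evl n (F w) i ^ Suc r = evl n (F w) i ^ r * inner (evec n (F w) i) (mv n n (F w) (evec n (F w) i))"
        by (simp add: evec_facts(3)[OF sym i])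
    qed
    also have "\<dots> = phi n r (F w) (\<lambda>i j. kappa * (\<Sum>e\<in>E. Y e w * G e w i j))"
      by (rule phi_cong) (simp add: dec Y_def)
    finally show ?thesis by (simp add: phi_sum_mat)
  qed
  have one: "bexp E pr (\<lambda>w. Y e w * phi n r (F w) (G e w)) \<le> real r / 2 * bexp E pr (\<lambda>w. \<bar>Y e w\<bar> * psi n (r - 1) (F w) (G e w))"
    if e: "e \<in> E" for e
  proof -
    define q where "q = pr e * (1 - pr e)"
    have p: "0 \<le> pr e" "pr e \<le> 1" using pw e by (auto simp: prob_weights_def)
    have ph: "phi n r A (G e (w(e := b))) = phi n r A (G e w)" for A w b
      by (rule phi_cong) (rule ind[OF e])
    have ps: "psi n (r - 1) A (G e (w(e := b))) = psi n (r - 1) A (G e w)" for A w b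
      by (rule psi_cong) (rule ind[OF e])
    \<comment> \<open>\<open>Y e\<close> has mean zero given the other coordinates, so only the
      difference of the two traces survives, weighted with the variance \<open>q\<close>; the
      derivative \<open>G e\<close> is the same for both values.\<close>
    have "bexp E pr (\<lambda>w. Y e w * phi n r (F w) (G e w)) =
       bexp E pr (\<lambda>w. q * (phi n r (F (w(e := True))) (G e w) - phi n r (F (w(e := False))) (G e w)))"
      by (subst bexp_resample[OF pw e], simp only: ph) (simp add: Y_def q_def algebra_simps)
    also have "\<dots> \<le> bexp E pr (\<lambda>w. q * (real r / 2 * (psi n (r - 1) (F (w(e := True))) (G e w) + psi n (r - 1) (F (w(e := False))) (G e w))))"
      by (intro bexp_mono finE mult_left_mono trace_mean_value sym r diff e) (use p in \<open>auto simp: q_def\<close>)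
    also have "\<dots> = real r / 2 * bexp E pr (\<lambda>w. \<bar>Y e w\<bar> * psi n (r - 1) (F w) (G e w))"
      unfolding bexp_cmult[symmetric]
      by (subst (2) bexp_resample[OF pw e], simp only: ps) (use p in \<open>simp add: Y_def q_def algebra_simps add_divide_distrib diff_divide_distrib\<close>)
    finally show ?thesis .
  qed
  have "X = kappa * (\<Sum>e\<in>E. bexp E pr (\<lambda>w. Y e w * phi n r (F w) (G e w)))"
    unfolding X_def tr bexp_cmult bexp_sum[OF finE] ..
  also have "\<dots> \<le> kappa * (\<Sum>e\<in>E. real r / 2 * bexp E pr (\<lambda>w. \<bar>Y e w\<bar> * psi n (r - 1) (F w) (G e w)))"
    by (intro mult_left_mono sum_mono one kappa)
  also have "\<dots> = bexp E pr (\<lambda>w. kappa * (real r / 2) * (\<Sum>e\<in>E. \<bar>Y e w\<bar> * psi n (r - 1) (F w) (G e w)))"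
    by (simp only: bexp_cmult bexp_sum[OF finE] sum_distrib_left mult.assoc)
  also have "\<dots> \<le> bexp E pr (\<lambda>w. \<Sum>i<n. (real m * W w) ^ m / real m + (real m - 1) / real m * evl n (F w) i ^ (2 * m))"
  proof (rule bexp_mono[OF finE])
    fix w
    define a where "a i = (evl n (F w) i)\<^sup>2" for i
    have ar: "evl n (F w) i ^ (r - 1) = a i ^ (m - 1)" "evl n (F w) i ^ (2 * m) = a i ^ m" for i
      unfolding r(2) a_def by (simp_all only: power_mult)
    have a0: "0 \<le> a i" for i by (simp add: a_def)
    have "(\<Sum>e\<in>E. \<bar>Y e w\<bar> * psi n (r - 1) (F w) (G e w)) =
       (\<Sum>i<n. a i ^ (m - 1) * (\<Sum>e\<in>E. \<bar>Y e w\<bar> * (norm (mv n n (G e w) (evec n (F w) i)))\<^sup>2))"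
      unfolding psi_def ar sum_distrib_left by (subst sum.swap) (simp add: algebra_simps)
    also have "\<dots> \<le> (\<Sum>i<n. a i ^ (m - 1) * W w)"
    proof (intro sum_mono mult_left_mono)
      fix i assume "i \<in> {..<n}"
      then have i: "i < n" by simp
      show "(\<Sum>e\<in>E. \<bar>Y e w\<bar> * (norm (mv n n (G e w) (evec n (F w) i)))\<^sup>2) \<le> W w"
        using W[OF evec_facts(2)[OF sym i], of w] orthonormal_norm[OF evec_facts(1)[OF sym] i]
        by (simp add: Y_def)
    qed (simp add: a0)
    finally have "kappa * (real r / 2) * (\<Sum>e\<in>E. \<bar>Y e w\<bar> * psi n (r - 1) (F w) (G e w)) \<le> real m * (\<Sum>i<n. a i ^ (m - 1) * W w)"
    proof (rule mult_mono[rotated])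
      have "kappa * (real r / 2) \<le> 1 * (real r / 2)" by (rule mult_right_mono) (use kappa in auto)
      then show "kappa * (real r / 2) \<le> real m" using r(3) by linarith
      show "0 \<le> (\<Sum>e\<in>E. \<bar>Y e w\<bar> * psi n (r - 1) (F w) (G e w))"
        unfolding psi_def ar by (intro sum_nonneg mult_nonneg_nonneg) (auto simp: a0)
    qed simp
    also have "\<dots> = (\<Sum>i<n. (real m * W w) * a i ^ (m - 1))"
      by (simp add: sum_distrib_left algebra_simps)
    \<comment> \<open>Young's inequality separates \<open>W\<close> from the power of
      \<open>a\<close>. The resulting share \<open>(m - 1) / m\<close> of the trace moment is
      absorbed by the left-hand side at the end.\<close>
    also have "\<dots> \<le> (\<Sum>i<n. (real m * W w) ^ m / real m + (real m - 1) / real m * a i ^ m)"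
    proof (rule sum_mono)
      fix i
      obtain k where k: "m = Suc k" using m by (cases m) auto
      have "real (Suc k) * ((real m * W w) * a i ^ k) \<le> (real m * W w) ^ Suc k + real k * a i ^ Suc k"
        by (rule young_power) (use W0 a0 in auto)
      then have "real m * ((real m * W w) * a i ^ (m - 1)) \<le> (real m * W w) ^ m + (real m - 1) * a i ^ m"
        by (simp only: k diff_Suc_1) simp
      then show "(real m * W w) * a i ^ (m - 1) \<le> (real m * W w) ^ m / real m + (real m - 1) / real m * a i ^ m"
        using m by (simp add: field_simps)
    qed
    finally show "kappa * (real r / 2) * (\<Sum>e\<in>E. \<bar>Y e w\<bar> * psi n (r - 1) (F w) (G e w))
       \<le> (\<Sum>i<n. (real m * W w) ^ m / real m + (real m - 1) / real m * evl n (F w) i ^ (2 * m))"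
      by (simp add: ar)
  qed
  also have "\<dots> = real n * (real m ^ m * bexp E pr (\<lambda>w. W w ^ m)) / real m + (real m - 1) / real m * X"
  proof -
    have "(\<lambda>w. \<Sum>i<n. (real m * W w) ^ m / real m + (real m - 1) / real m * evl n (F w) i ^ (2 * m)) =
      (\<lambda>w. (real n * real m ^ m / real m) * W w ^ m + (real m - 1) / real m * (\<Sum>i<n. evl n (F w) i ^ (2 * m)))"
      by (auto simp: fun_eq_iff sum.distrib sum_distrib_left power_mult_distrib)
    then show ?thesis by (simp only: bexp_add[OF finE] bexp_cmult X_def) simp
  qed
  finally show ?thesis using m unfolding X_def[symmetric] by (simp add: field_simps)
qed

section \<open>Noise of the squared adjacency matrices\<close>

definition ed :: "nat \<Rightarrow> nat \<Rightarrow> nat \<Rightarrow> nat \<times> nat \<times> nat" where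
  "ed l i j = (l, min i j, max i j)"

definition sym_ext :: "(nat \<times> nat \<times> nat \<Rightarrow> real) \<Rightarrow> nat \<Rightarrow> rmat" where
  "sym_ext f l i j = (if i = j then 0 else f (ed l i j))"

lemma sym_ext_diag [simp]: "sym_ext f l i i = 0" by (simp add: sym_ext_def)

lemma ed_commute: "ed l i j = ed l j i" by (simp add: ed_def min.commute max.commute)

lemma sym_ext_commute: "sym_ext f l i j = sym_ext f l j i"
  by (simp add: sym_ext_def ed_commute)

lemma ed_eq_iff: "ed l i j = ed l' i' j' \<longleftrightarrow> l = l' \<and> (i = i' \<and> j = j' \<or> i = j' \<and> j = i')"
  by (auto simp: ed_def min_def max_def split: if_splits)

lemma ed_in_pair_set: "l < L \<Longrightarrow> i < n \<Longrightarrow> j < n \<Longrightarrow> i \<noteq> j \<Longrightarrow> ed l i j \<in> pair_set L n"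
  by (auto simp: ed_def pair_set_def)

lemma finite_pair_set: "finite (pair_set L n)"
  by (rule finite_subset[of _ "{..<L} \<times> {..<n} \<times> {..<n}"]) (auto simp: pair_set_def)

lemma card_pair_set_le: "card (pair_set L n) \<le> L * n\<^sup>2"
proof -
  have "card (pair_set L n) \<le> card ({..<L} \<times> {..<n} \<times> {..<n})"
    by (rule card_mono) (auto simp: pair_set_def)
  then show ?thesis by (simp add: card_cartesian_product power2_eq_square)
qed

text \<open>Passes from unordered edges to ordered node pairs; the two orientations of an edge
  account for the symmetrisation of \<open>h\<close>.\<close>

lemma sum_pair_set:
  fixes h :: "nat \<Rightarrow> nat \<Rightarrow> nat \<Rightarrow> real"
  shows "(\<Sum>(l,a,b)\<in>pair_set L n. f (l,a,b) * (h l a b + h l b a)) = (\<Sum>l<L. \<Sum>a<n. \<Sum>b<n. sym_ext f l a b * h l a b)"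
proof -
  have "(\<Sum>(l,a,b)\<in>pair_set L n. f (l,a,b) * (h l a b + h l b a)) =
    (\<Sum>(l,a,b)\<in>{..<L} \<times> {..<n} \<times> {..<n}. if a < b then f (l,a,b) * (h l a b + h l b a) else 0)"
    by (rule sum.mono_neutral_cong_left) (auto simp: pair_set_def split: if_splits)
  also have "\<dots> = (\<Sum>l<L. \<Sum>a<n. \<Sum>b<n. (if a < b then f (l,a,b) * h l a b else 0) + (if a < b then f (l,a,b) * h l b a else 0))"
    by (simp add: sum.cartesian_product[symmetric] distrib_left if_distrib cong: if_cong)
  also have "\<dots> = (\<Sum>l<L. (\<Sum>a<n. \<Sum>b<n. if a < b then f (l,a,b) * h l a b else 0) + (\<Sum>a<n. \<Sum>b<n. if b < a then f (l,b,a) * h l a b else 0))"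
    unfolding sum.distrib by (subst (2) sum.swap) simp
  also have "\<dots> = (\<Sum>l<L. \<Sum>a<n. \<Sum>b<n. sym_ext f l a b * h l a b)"
    unfolding sum.distrib[symmetric]
    by (intro sum.cong refl) (auto simp: sym_ext_def ed_def min_def max_def)
  finally show ?thesis .
qed

lemma sum_pair_set':
  "(\<Sum>l<L. \<Sum>a<n. \<Sum>b<n. sym_ext f l a b) = 2 * (\<Sum>e\<in>pair_set L n. f e)"
  using sum_pair_set[of f "\<lambda>_ _ _. 1" L n] by (simp add: case_prod_unfold sum_distrib_left mult.commute)

text \<open>\<open>dmat Z e\<close> is the derivative of the off-diagonal part of \<open>Z Y + Y Z\<close> in the direction of
  the symmetric entry \<open>e\<close> of \<open>Y\<close>.\<close>
definition dmat :: "(nat \<Rightarrow> rmat) \<Rightarrow> nat \<times> nat \<times> nat \<Rightarrow> rmat" where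
  "dmat Z e i j = (case e of (l,a,b) \<Rightarrow> if i = j then 0 else
     (Z l i a * of_bool (j = b) + of_bool (i = b) * Z l a j) + (Z l i b * of_bool (j = a) + of_bool (i = a) * Z l b j))"

lemma dmat_decomposition:
  assumes "i < n" "j < n"
  shows "(\<Sum>e\<in>pair_set L n. y e * dmat Z e i j) =
    (if i = j then 0 else \<Sum>l<L. \<Sum>k<n. Z l i k * sym_ext y l k j + sym_ext y l i k * Z l k j)"
proof (cases "i = j")
  case False
  define h where "h l a b = Z l i a * of_bool (j = b) + of_bool (i = b) * Z l a j" for l a b
  have "(\<Sum>e\<in>pair_set L n. y e * dmat Z e i j) = (\<Sum>(l,a,b)\<in>pair_set L n. y (l,a,b) * (h l a b + h l b a))"
    using False by (intro sum.cong refl) (auto simp: dmat_def h_def)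
  also have "\<dots> = (\<Sum>l<L. \<Sum>a<n. \<Sum>b<n. sym_ext y l a b * h l a b)" by (rule sum_pair_set)
  also have "\<dots> = (\<Sum>l<L. \<Sum>a<n. Z l i a * sym_ext y l a j + sym_ext y l i a * Z l a j)"
  proof (intro sum.cong refl)
    fix l a
    have "(\<Sum>b<n. sym_ext y l a b * h l a b) =
      (\<Sum>b<n. if b = j then sym_ext y l a b * Z l i a else 0) + (\<Sum>b<n. if b = i then sym_ext y l a b * Z l a j else 0)"
      unfolding sum.distrib[symmetric] by (intro sum.cong) (auto simp: h_def algebra_simps)
    then show "(\<Sum>b<n. sym_ext y l a b * h l a b) = Z l i a * sym_ext y l a j + sym_ext y l i a * Z l a j"
      using assms by (simp add: sym_ext_commute[of y l a i])
  qed
  finally show ?thesis using False by simp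
qed (auto simp: dmat_def intro!: sum.neutral)

text \<open>Cauchy-Schwarz with the weight divided as \<open>sqrt y * sqrt y\<close>. Signed
  coefficients enter only through the majorant \<open>y\<close>, and the right-hand side is linear
  in the squared coordinates.\<close>

lemma sum_square_weighted:
  fixes z v :: "'a \<Rightarrow> real"
  assumes "\<And>i. i \<in> A \<Longrightarrow> \<bar>z i\<bar> \<le> y i"
  shows "(\<Sum>i\<in>A. z i * v i)\<^sup>2 \<le> (\<Sum>i\<in>A. y i) * (\<Sum>i\<in>A. y i * (v i)\<^sup>2)"
proof -
  have y0: "0 \<le> y i" if "i \<in> A" for i using assms[OF that] by linarith
  have "\<bar>\<Sum>i\<in>A. z i * v i\<bar> \<le> (\<Sum>i\<in>A. \<bar>z i * v i\<bar>)" by (rule sum_abs)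
  also have "\<dots> \<le> (\<Sum>i\<in>A. sqrt (y i) * (sqrt (y i) * \<bar>v i\<bar>))"
  proof (rule sum_mono)
    fix i assume i: "i \<in> A"
    have "\<bar>z i * v i\<bar> \<le> y i * \<bar>v i\<bar>" using assms[OF i] by (simp add: abs_mult mult_right_mono)
    also have "\<dots> = sqrt (y i) * (sqrt (y i) * \<bar>v i\<bar>)" using y0[OF i] by (simp add: mult.assoc[symmetric])
    finally show "\<bar>z i * v i\<bar> \<le> sqrt (y i) * (sqrt (y i) * \<bar>v i\<bar>)" .
  qed
  finally have "(\<Sum>i\<in>A. z i * v i)\<^sup>2 \<le> (\<Sum>i\<in>A. sqrt (y i) * (sqrt (y i) * \<bar>v i\<bar>))\<^sup>2"
    by (rule abs_le_square_iff[THEN iffD1, OF order_trans]) simp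
  also have "\<dots> \<le> (\<Sum>i\<in>A. (sqrt (y i))\<^sup>2) * (\<Sum>i\<in>A. (sqrt (y i) * \<bar>v i\<bar>)\<^sup>2)"
    by (rule Cauchy_Schwarz_ineq_sum)
  also have "(\<Sum>i\<in>A. (sqrt (y i))\<^sup>2) = (\<Sum>i\<in>A. y i)" using y0 by (intro sum.cong) auto
  also have "(\<Sum>i\<in>A. (sqrt (y i) * \<bar>v i\<bar>)\<^sup>2) = (\<Sum>i\<in>A. y i * (v i)\<^sup>2)"
    using y0 by (intro sum.cong) (auto simp: power_mult_distrib)
  finally show ?thesis .
qed

text \<open>The derivative at the edge between \<open>a\<close> and \<open>b\<close> lives on the
  rows and columns of these two nodes: rows \<open>a\<close> and \<open>b\<close> give the squared
  sums, every other row has just two entries. The excluded index reflects the deleted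
  diagonal.\<close>

lemma dmat_norm_bound:
  assumes ab: "a < n" "b < n" "a \<noteq> b" and Z: "\<And>i j. Z l i j = Z l j i" "\<And>i. Z l i i = 0" and v: "v \<in> V n"
  defines "h \<equiv> \<lambda>a b. (\<Sum>j\<in>{..<n}-{a}. Z l b j * crd v j)\<^sup>2 + 2 * (crd v a)\<^sup>2 * (\<Sum>i\<in>{..<n}-{a}. (Z l b i)\<^sup>2)"
  shows "(norm (mv n n (dmat Z (l,a,b)) v))\<^sup>2 \<le> h a b + h b a"
proof -
  let ?M = "dmat Z (l,a,b)"
  define S where "S a b = (\<Sum>j\<in>{..<n}-{a}. Z l b j * crd v j)" for a b
  have ca: "(\<Sum>j<n. ?M a j * crd v j) = S a b"
    unfolding S_def using ab Z by (intro sum.mono_neutral_cong_right) (auto simp: dmat_def)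
  have cb: "(\<Sum>j<n. ?M b j * crd v j) = S b a"
    unfolding S_def using ab Z by (intro sum.mono_neutral_cong_right) (auto simp: dmat_def)
  have ci: "(\<Sum>j<n. ?M i j * crd v j) = Z l a i * crd v b + Z l b i * crd v a" if "i \<noteq> a" "i \<noteq> b" for i
  proof -
    have "(\<Sum>j<n. ?M i j * crd v j) = (\<Sum>j\<in>{a,b}. ?M i j * crd v j)"
      using ab that Z by (intro sum.mono_neutral_right) (auto simp: dmat_def)
    then show ?thesis using ab that Z by (simp add: dmat_def)
  qed
  have le: "(\<Sum>j<n. ?M i j * crd v j)\<^sup>2 \<le> (if i = a then (S a b)\<^sup>2 else 0) + (if i = b then (S b a)\<^sup>2 else 0)
     + (if i \<noteq> a then 2 * (crd v a)\<^sup>2 * (Z l b i)\<^sup>2 else 0) + (if i \<noteq> b then 2 * (crd v b)\<^sup>2 * (Z l a i)\<^sup>2 else 0)" for i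
  proof -
    consider "i = a" | "i = b" | "i \<noteq> a" "i \<noteq> b" by blast
    then show ?thesis
    proof cases
      case 1
      then show ?thesis using ab ca by auto
    next
      case 2
      then show ?thesis using ab cb by auto
    next
      case 3
      have "(x + y)\<^sup>2 \<le> 2 * x\<^sup>2 + 2 * y\<^sup>2" for x y :: real
        using zero_le_power2[of "x - y"] by (simp add: power2_eq_square algebra_simps)
      from this[of "Z l a i * crd v b" "Z l b i * crd v a"] show ?thesis
        unfolding ci[OF 3] using 3 by (simp add: power_mult_distrib algebra_simps)
    qed
  qed
  have "(norm (mv n n ?M v))\<^sup>2 = (\<Sum>i<n. (\<Sum>j<n. ?M i j * crd v j)\<^sup>2)"
    by (subst norm_V[OF mv_in_V]) simp
  also have "\<dots> \<le> (\<Sum>i<n. (if i = a then (S a b)\<^sup>2 else 0) + (if i = b then (S b a)\<^sup>2 else 0)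
     + (if i \<noteq> a then 2 * (crd v a)\<^sup>2 * (Z l b i)\<^sup>2 else 0) + (if i \<noteq> b then 2 * (crd v b)\<^sup>2 * (Z l a i)\<^sup>2 else 0))"
    by (intro sum_mono le)
  also have "\<dots> = (S a b)\<^sup>2 + (S b a)\<^sup>2 + (\<Sum>i\<in>{..<n}-{a}. 2 * (crd v a)\<^sup>2 * (Z l b i)\<^sup>2) + (\<Sum>i\<in>{..<n}-{b}. 2 * (crd v b)\<^sup>2 * (Z l a i)\<^sup>2)"
  proof -
    have "(\<Sum>i<n. if i \<noteq> a' then f i else 0) = (\<Sum>i\<in>{..<n}-{a'}. f i)" for f :: "nat \<Rightarrow> real" and a'
      by (rule sum.mono_neutral_cong_right) auto
    then show ?thesis using ab by (simp add: sum.distrib)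
  qed
  also have "\<dots> = h a b + h b a" by (simp add: h_def S_def sum_distrib_left)
  finally show ?thesis .
qed

lemma dmat_weighted_bound:
  assumes Z: "\<And>l i j. Z l i j = Z l j i" "\<And>l i. Z l i i = 0" and v: "v \<in> V n" and c: "\<And>e. 0 \<le> c e"
  shows "(\<Sum>e\<in>pair_set L n. c e * (norm (mv n n (dmat Z e) v))\<^sup>2) \<le>
    (\<Sum>l<L. \<Sum>a<n. \<Sum>b<n. sym_ext c l a b *
      ((\<Sum>j\<in>{..<n}-{a}. Z l b j * crd v j)\<^sup>2 + 2 * (crd v a)\<^sup>2 * (\<Sum>i\<in>{..<n}-{a}. (Z l b i)\<^sup>2)))"
  unfolding sum_pair_set[symmetric]
  by (intro sum_mono) (auto simp: pair_set_def intro!: mult_left_mono dmat_norm_bound Z v c)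

section \<open>Linear and quadratic noise of independent edges\<close>

locale edge_model =
  fixes L n :: nat and pr :: "nat \<times> nat \<times> nat \<Rightarrow> real" and be :: real
  assumes pr: "\<And>e. 0 \<le> pr e" "\<And>e. pr e \<le> 1" "\<And>e. pr e \<le> be"
    and n1: "1 \<le> n"
begin

abbreviation "ex \<equiv> bexp (pair_set L n) pr"

definition Y :: "(nat \<times> nat \<times> nat \<Rightarrow> bool) \<Rightarrow> nat \<Rightarrow> rmat" where
  "Y w = sym_ext (\<lambda>e. of_bool (w e) - pr e)"
definition P :: "nat \<Rightarrow> rmat" where "P = sym_ext pr"
text \<open>A nonnegative majorant of both the modulus and the square of \<open>Y\<close>; with it
  the row sums of squared derivatives become polynomials with nonnegative terms.\<close>

definition A :: "(nat \<times> nat \<times> nat \<Rightarrow> bool) \<Rightarrow> nat \<Rightarrow> rmat" where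
  "A w = sym_ext (\<lambda>e. of_bool (w e) + pr e)"

definition F1 :: "(nat \<times> nat \<times> nat \<Rightarrow> bool) \<Rightarrow> rmat" where
  "F1 w i j = (if i = j then 0 else \<Sum>l<L. \<Sum>k<n. P l i k * Y w l k j + Y w l i k * P l k j)"
definition F2 :: "(nat \<times> nat \<times> nat \<Rightarrow> bool) \<Rightarrow> rmat" where
  "F2 w i j = (if i = j then 0 else \<Sum>l<L. \<Sum>k<n. Y w l i k * Y w l k j)"

lemma be0: "0 \<le> be" using pr[of undefined] by linarith

lemma pw: "prob_weights (pair_set L n) pr"
  using pr by (simp add: prob_weights_def finite_pair_set)

lemma sym_simps: "Y w l i j = Y w l j i" "P l i j = P l j i" "A w l i j = A w l j i"
  by (simp_all add: Y_def P_def A_def sym_ext_commute)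

lemma diag_simps [simp]: "Y w l i i = 0" "P l i i = 0" "A w l i i = 0"
  by (simp_all add: Y_def P_def A_def)

lemma A_bounds: "0 \<le> A w l i j" "A w l i j \<le> 2" "\<bar>Y w l i j\<bar> \<le> A w l i j" "(Y w l i j)\<^sup>2 \<le> A w l i j"
proof -
  show "0 \<le> A w l i j" "A w l i j \<le> 2" "\<bar>Y w l i j\<bar> \<le> A w l i j"
    using pr[of "ed l i j"] by (auto simp: A_def Y_def sym_ext_def)
  have "\<bar>Y w l i j\<bar> \<le> 1" using pr[of "ed l i j"] by (auto simp: Y_def sym_ext_def)
  then have "\<bar>Y w l i j\<bar> * \<bar>Y w l i j\<bar> \<le> \<bar>Y w l i j\<bar> * 1" by (intro mult_left_mono) auto
  then show "(Y w l i j)\<^sup>2 \<le> A w l i j" using \<open>\<bar>Y w l i j\<bar> \<le> A w l i j\<close> by (simp add: power2_eq_square)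
qed

lemma P_bounds: "0 \<le> P l i j" "P l i j \<le> be"
  using pr[of "ed l i j"] be0 by (auto simp: P_def sym_ext_def)

lemma symm_F1: "symm n (F1 w)"
  unfolding symm_def F1_def by (auto intro!: sum.cong simp: sym_simps algebra_simps) 

lemma symm_F2: "symm n (F2 w)"
  unfolding symm_def F2_def
  by (auto intro!: sum.cong simp: sym_simps(1)[of w _ j for w j] mult.commute)

lemma F1_dec: "i < n \<Longrightarrow> j < n \<Longrightarrow> F1 w i j = 1 * (\<Sum>e\<in>pair_set L n. (of_bool (w e) - pr e) * dmat P e i j)"
  by (simp add: dmat_decomposition F1_def Y_def)

lemma F1_diff:
  assumes "e \<in> pair_set L n" "i < n" "j < n"
  shows "dmat P e i j = F1 (w(e := True)) i j - F1 (w(e := False)) i j"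
proof -
  have "F1 (w(e := True)) i j - F1 (w(e := False)) i j =
    (\<Sum>e'\<in>pair_set L n. if e' = e then dmat P e' i j else 0)"
    unfolding F1_dec[OF assms(2,3)] by (simp add: sum_subtractf[symmetric]) (rule sum.cong, auto simp: algebra_simps)
  then show ?thesis using assms by (simp add: finite_pair_set)
qed

text \<open>Euler's identity for a form of degree two, whence the factor
  \<open>1 / 2\<close>.\<close>

lemma F2_dec: "i < n \<Longrightarrow> j < n \<Longrightarrow> F2 w i j = 1 / 2 * (\<Sum>e\<in>pair_set L n. (of_bool (w e) - pr e) * dmat (Y w) e i j)"
  by (simp add: dmat_decomposition F2_def Y_def[symmetric] sum.distrib mult.commute sum_distrib_left)

text \<open>Loops being absent, no product \<open>Y i k * Y k j\<close> with distinct
  \<open>i\<close> and \<open>j\<close> uses an edge twice. The quadratic noise is therefore affine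
  in each edge, and its derivative does not see that edge.\<close>

lemma dmat_Y_upd:
  assumes "e \<in> pair_set L n"
  shows "dmat (Y (w(e := b))) e i j = dmat (Y w) e i j"
proof -
  obtain l a c where e: "e = (l,a,c)" "a < c" using assms by (auto simp: pair_set_def)
  have e': "e = ed l a c" using e by (simp add: ed_def)
  have "Y (w(e := b)) l x y = Y w l x y" if "\<not> (x = a \<and> y = c \<or> x = c \<and> y = a)" for x y
    using that by (auto simp: Y_def sym_ext_def e' ed_eq_iff)
  then show ?thesis using e(2) by (auto simp: dmat_def e(1))
qed

text \<open>Polarisation: a difference of squares is half the symmetrised product of sum and
  difference, and the two matrices differ by the symmetric unit matrix of the edge
  \<open>e\<close>.\<close>

lemma F2_diff:
  assumes e: "e \<in> pair_set L n" and ij: "i < n" "j < n"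
  shows "dmat (Y w) e i j = F2 (w(e := True)) i j - F2 (w(e := False)) i j"
proof (cases "i = j")
  case False
  define Y1 Y0 where Y10: "Y1 = Y (w(e := True))" "Y0 = Y (w(e := False))"
  define y where "y = (\<lambda>e'. of_bool (e' = e) :: real)"
  have y: "sym_ext y l p q = Y1 l p q - Y0 l p q" for l p q
    by (auto simp: Y10 Y_def sym_ext_def y_def)
  have "2 * (F2 (w(e := True)) i j - F2 (w(e := False)) i j) =
    (\<Sum>l<L. \<Sum>k<n. (Y1 l i k + Y0 l i k) * sym_ext y l k j + sym_ext y l i k * (Y1 l k j + Y0 l k j))"
    using False unfolding F2_def Y10[symmetric] y
    by (simp add: sum_subtractf[symmetric] sum_distrib_left) (intro sum.cong refl, simp add: algebra_simps)
  also have "\<dots> = (\<Sum>e'\<in>pair_set L n. y e' * dmat (\<lambda>l p q. Y1 l p q + Y0 l p q) e' i j)"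
    by (simp only: dmat_decomposition[OF ij] False if_False)
  also have "\<dots> = dmat (\<lambda>l p q. Y1 l p q + Y0 l p q) e i j"
    using e by (simp add: y_def finite_pair_set)
  also have "\<dots> = dmat Y1 e i j + dmat Y0 e i j"
    using False by (auto simp: dmat_def algebra_simps split: prod.split)
  finally show ?thesis by (simp add: Y10 dmat_Y_upd[OF e])
qed (auto simp: F2_def dmat_def split: prod.split)

text \<open>The factor 6 is the row bound \<open>3 * n * be^2\<close> counted for both orientations
  of an edge.\<close>

definition W1 :: "(nat \<times> nat \<times> nat \<Rightarrow> bool) \<Rightarrow> real" where
  "W1 w = 6 * real n * be\<^sup>2 * (\<Sum>e\<in>pair_set L n. of_bool (w e) + pr e)"

lemma W1_nonneg: "0 \<le> W1 w"
  unfolding W1_def by (intro mult_nonneg_nonneg sum_nonneg) (use pr in auto)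

lemma F1_weighted:
  assumes v: "v \<in> V n"
  shows "(\<Sum>e\<in>pair_set L n. \<bar>of_bool (w e) - pr e\<bar> * (norm (mv n n (dmat P e) v))\<^sup>2) \<le> W1 w * (norm v)\<^sup>2"
proof -
  let ?c = "\<lambda>e. \<bar>of_bool (w e) - pr e\<bar>"
  have s: "sym_ext ?c l a b \<le> A w l a b" "0 \<le> sym_ext ?c l a b" for l a b
    using pr[of "ed l a b"] by (auto simp: sym_ext_def A_def)
  have nv: "(norm v)\<^sup>2 = (\<Sum>i<n. (crd v i)\<^sup>2)" by (rule norm_V[OF v])
  have h: "(\<Sum>j\<in>{..<n}-{a}. P l b j * crd v j)\<^sup>2 + 2 * (crd v a)\<^sup>2 * (\<Sum>i\<in>{..<n}-{a}. (P l b i)\<^sup>2) \<le> 3 * real n * be\<^sup>2 * (norm v)\<^sup>2"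
    if a: "a < n" for l a b
  proof -
    have "(\<Sum>j\<in>{..<n}-{a}. P l b j * crd v j)\<^sup>2 \<le> (\<Sum>j\<in>{..<n}-{a}. be) * (\<Sum>j\<in>{..<n}-{a}. be * (crd v j)\<^sup>2)"
      by (rule sum_square_weighted) (use P_bounds in auto)
    also have "\<dots> \<le> (real n * be) * (be * (norm v)\<^sup>2)"
    proof (rule mult_mono)
      show "(\<Sum>j\<in>{..<n}-{a}. be) \<le> real n * be" using be0 a by (simp add: mult_right_mono)
      show "(\<Sum>j\<in>{..<n}-{a}. be * (crd v j)\<^sup>2) \<le> be * (norm v)\<^sup>2"
        unfolding nv sum_distrib_left using be0 by (intro sum_mono2) auto
    qed (use be0 in \<open>auto intro!: sum_nonneg\<close>)
    finally have 1: "(\<Sum>j\<in>{..<n}-{a}. P l b j * crd v j)\<^sup>2 \<le> real n * be\<^sup>2 * (norm v)\<^sup>2"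
      by (simp add: power2_eq_square algebra_simps)
    have "(\<Sum>i\<in>{..<n}-{a}. (P l b i)\<^sup>2) \<le> (\<Sum>i\<in>{..<n}-{a}. be\<^sup>2)"
      using P_bounds by (intro sum_mono power_mono) auto
    also have "\<dots> \<le> real n * be\<^sup>2" using a by (simp add: mult_right_mono)
    finally have 2: "(\<Sum>i\<in>{..<n}-{a}. (P l b i)\<^sup>2) \<le> real n * be\<^sup>2" .
    have "(crd v a)\<^sup>2 \<le> (norm v)\<^sup>2" unfolding nv using a by (intro member_le_sum) auto
    then have "2 * (crd v a)\<^sup>2 * (\<Sum>i\<in>{..<n}-{a}. (P l b i)\<^sup>2) \<le> 2 * (norm v)\<^sup>2 * (real n * be\<^sup>2)"
      using 2 by (intro mult_mono) (auto intro!: sum_nonneg)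
    with 1 show ?thesis by (simp add: algebra_simps)
  qed
  have "(\<Sum>e\<in>pair_set L n. ?c e * (norm (mv n n (dmat P e) v))\<^sup>2) \<le> (\<Sum>l<L. \<Sum>a<n. \<Sum>b<n. sym_ext ?c l a b *
      ((\<Sum>j\<in>{..<n}-{a}. P l b j * crd v j)\<^sup>2 + 2 * (crd v a)\<^sup>2 * (\<Sum>i\<in>{..<n}-{a}. (P l b i)\<^sup>2)))"
    by (rule dmat_weighted_bound) (auto simp: sym_simps v)
  also have "\<dots> \<le> (\<Sum>l<L. \<Sum>a<n. \<Sum>b<n. A w l a b * (3 * real n * be\<^sup>2 * (norm v)\<^sup>2))"
    by (intro sum_mono mult_mono s h) (auto simp: A_bounds intro!: add_nonneg_nonneg mult_nonneg_nonneg sum_nonneg)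
  also have "\<dots> = (\<Sum>l<L. \<Sum>a<n. \<Sum>b<n. A w l a b) * (3 * real n * be\<^sup>2 * (norm v)\<^sup>2)"
    by (simp only: sum_distrib_right)
  also have "\<dots> = W1 w * (norm v)\<^sup>2"
    unfolding A_def sum_pair_set' W1_def by simp
  finally show ?thesis .
qed

text \<open>Leaving \<open>j\<close> out of the degree of \<open>b\<close> makes it independent of
  the edge between \<open>j\<close> and \<open>b\<close>.\<close>

definition Dg :: "(nat \<times> nat \<times> nat \<Rightarrow> bool) \<Rightarrow> nat \<Rightarrow> nat \<Rightarrow> nat \<Rightarrow> real" where
  "Dg w l j b = (\<Sum>k\<in>{..<n}-{j}. A w l b k)"

definition W2 :: "(nat \<times> nat \<times> nat \<Rightarrow> bool) \<Rightarrow> nat \<Rightarrow> real" where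
  "W2 w j = (\<Sum>l<L. \<Sum>b<n. A w l j b * (4 * Dg w l j b + (Dg w l j b)\<^sup>2))"

lemma Dg_nonneg: "0 \<le> Dg w l j b" unfolding Dg_def by (intro sum_nonneg A_bounds)

lemma W2_nonneg: "0 \<le> W2 w j"
  unfolding W2_def by (intro sum_nonneg mult_nonneg_nonneg add_nonneg_nonneg A_bounds) (auto simp: Dg_nonneg)

text \<open>Row-wise Cauchy-Schwarz leaves squared coordinates of \<open>v\<close>, and exchanging
  the order of summation collects the coefficient of each. What remains is a comparison of degrees
  of the same node with different neighbours left out.\<close>

lemma F2_weighted_coord:
  assumes v: "v \<in> V n"
  shows "(\<Sum>e\<in>pair_set L n. \<bar>of_bool (w e) - pr e\<bar> * (norm (mv n n (dmat (Y w) e) v))\<^sup>2) \<le> (\<Sum>j<n. W2 w j * (crd v j)\<^sup>2)"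
proof -
  let ?c = "\<lambda>e. \<bar>of_bool (w e) - pr e\<bar>"
  have s: "sym_ext ?c l a b \<le> A w l a b" "0 \<le> sym_ext ?c l a b" for l a b
    using pr[of "ed l a b"] by (auto simp: sym_ext_def A_def)
  have "(\<Sum>e\<in>pair_set L n. ?c e * (norm (mv n n (dmat (Y w) e) v))\<^sup>2) \<le> (\<Sum>l<L. \<Sum>a<n. \<Sum>b<n. sym_ext ?c l a b *
      ((\<Sum>j\<in>{..<n}-{a}. Y w l b j * crd v j)\<^sup>2 + 2 * (crd v a)\<^sup>2 * (\<Sum>i\<in>{..<n}-{a}. (Y w l b i)\<^sup>2)))"
    by (rule dmat_weighted_bound) (auto simp: v intro: sym_simps)
  also have "\<dots> \<le> (\<Sum>l<L. \<Sum>a<n. \<Sum>b<n. A w l a b *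
      (Dg w l a b * (\<Sum>j\<in>{..<n}-{a}. A w l b j * (crd v j)\<^sup>2) + 2 * (crd v a)\<^sup>2 * Dg w l a b))"
    unfolding Dg_def
    by (intro sum_mono mult_mono s add_mono sum_square_weighted mult_left_mono)
       (auto simp: A_bounds intro!: add_nonneg_nonneg mult_nonneg_nonneg sum_nonneg)
  also have "\<dots> = (\<Sum>l<L. \<Sum>a<n. \<Sum>b<n. \<Sum>j<n. of_bool (j \<noteq> a) * A w l a b * Dg w l a b * A w l b j * (crd v j)\<^sup>2)
      + (\<Sum>l<L. \<Sum>a<n. \<Sum>b<n. A w l a b * (2 * Dg w l a b) * (crd v a)\<^sup>2)"
    (is "_ = ?S1 + ?S2")
  proof -
    have "(\<Sum>j\<in>{..<n}-{a}. f j) = (\<Sum>j<n. of_bool (j \<noteq> a) * f j)" for a and f :: "nat \<Rightarrow> real"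
      by (rule sum.mono_neutral_cong_left) auto
    then show ?thesis
      by (simp add: sum.distrib[symmetric] sum_distrib_left) (intro sum.cong refl, simp add: algebra_simps sum_distrib_left)
  qed
  also have "?S1 = (\<Sum>j<n. (\<Sum>l<L. \<Sum>b<n. A w l j b * (\<Sum>a\<in>{..<n}-{j}. A w l b a * Dg w l a b)) * (crd v j)\<^sup>2)"
  proof -
    define g where "g l a b j = of_bool (j \<noteq> a) * A w l a b * Dg w l a b * A w l b j * (crd v j)\<^sup>2" for l a b j
    have inner: "(\<Sum>a<n. g l a b j) = A w l j b * (\<Sum>a\<in>{..<n}-{j}. A w l b a * Dg w l a b) * (crd v j)\<^sup>2" for l b j
    proof -
      have "(\<Sum>a\<in>{..<n}-{j}. A w l b a * Dg w l a b) = (\<Sum>a<n. of_bool (j \<noteq> a) * (A w l b a * Dg w l a b))"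
        by (rule sum.mono_neutral_cong_left) auto
      then show ?thesis
        by (simp add: sum_distrib_left sum_distrib_right g_def sym_simps(3)[of w l b] mult_ac)
    qed
    have "?S1 = (\<Sum>l<L. \<Sum>a<n. \<Sum>j<n. \<Sum>b<n. g l a b j)"
      unfolding g_def by (intro sum.cong refl sum.swap)
    also have "\<dots> = (\<Sum>l<L. \<Sum>j<n. \<Sum>a<n. \<Sum>b<n. g l a b j)" by (intro sum.cong refl sum.swap)
    also have "\<dots> = (\<Sum>l<L. \<Sum>j<n. \<Sum>b<n. \<Sum>a<n. g l a b j)" by (intro sum.cong refl sum.swap)
    also have "\<dots> = (\<Sum>j<n. \<Sum>l<L. \<Sum>b<n. \<Sum>a<n. g l a b j)" by (rule sum.swap)
    finally show ?thesis by (simp only: inner sum_distrib_right)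
  qed
  also have "?S2 = (\<Sum>j<n. (\<Sum>l<L. \<Sum>b<n. A w l j b * (2 * Dg w l j b)) * (crd v j)\<^sup>2)"
    by (subst sum.swap) (simp add: sum_distrib_right)
  also have "(\<Sum>j<n. (\<Sum>l<L. \<Sum>b<n. A w l j b * (\<Sum>a\<in>{..<n}-{j}. A w l b a * Dg w l a b)) * (crd v j)\<^sup>2) +
     (\<Sum>j<n. (\<Sum>l<L. \<Sum>b<n. A w l j b * (2 * Dg w l j b)) * (crd v j)\<^sup>2) \<le> (\<Sum>j<n. W2 w j * (crd v j)\<^sup>2)"
  proof -
    \<comment> \<open>Degrees of \<open>b\<close> with different neighbours left out differ by at
      most one entry of \<open>A\<close>, hence by at most 2. Together with the 2 of the second sum
      this produces the coefficient 4.\<close>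
    have key: "(\<Sum>a\<in>{..<n}-{j}. A w l b a * Dg w l a b) + 2 * Dg w l j b \<le> 4 * Dg w l j b + (Dg w l j b)\<^sup>2"
      if "j < n" for l b j
    proof -
      have "Dg w l a b \<le> 2 + Dg w l j b" for a
      proof -
        have "Dg w l a b \<le> (\<Sum>k<n. A w l b k)"
          unfolding Dg_def by (rule sum_mono2) (auto simp: A_bounds)
        also have "\<dots> = A w l b j + Dg w l j b"
          unfolding Dg_def using that by (simp add: sum.remove)
        finally show ?thesis using A_bounds(2)[of w l b j] by linarith
      qed
      then have "(\<Sum>a\<in>{..<n}-{j}. A w l b a * Dg w l a b) \<le> (\<Sum>a\<in>{..<n}-{j}. A w l b a * (2 + Dg w l j b))"
        by (intro sum_mono mult_left_mono) (auto simp: A_bounds)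
      also have "\<dots> = Dg w l j b * (2 + Dg w l j b)"
        by (simp add: sum_distrib_right[symmetric] Dg_def)
      finally show ?thesis by (simp add: algebra_simps power2_eq_square)
    qed
    show ?thesis
      unfolding sum.distrib[symmetric] distrib_right[symmetric] distrib_left[symmetric] W2_def
      by (intro sum_mono mult_right_mono mult_left_mono key) (auto simp: A_bounds)
  qed
  finally show ?thesis by simp
qed

lemma F2_weighted:
  assumes v: "v \<in> V n"
  shows "(\<Sum>e\<in>pair_set L n. \<bar>of_bool (w e) - pr e\<bar> * (norm (mv n n (dmat (Y w) e) v))\<^sup>2) \<le> Max (W2 w ` {..<n}) * (norm v)\<^sup>2"
proof -
  have "(\<Sum>j<n. W2 w j * (crd v j)\<^sup>2) \<le> (\<Sum>j<n. Max (W2 w ` {..<n}) * (crd v j)\<^sup>2)"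
    by (intro sum_mono mult_right_mono Max_ge) auto
  then show ?thesis using F2_weighted_coord[OF v, of w] by (simp add: norm_V[OF v] sum_distrib_left)
qed

end

lemma power_add_le_double:
  fixes u v :: real
  assumes "0 \<le> u" "0 \<le> v"
  shows "(u + v) ^ N \<le> 2 ^ N * (u ^ N + v ^ N)"
proof -
  have "(u + v) ^ N \<le> (2 * max u v) ^ N" using assms by (intro power_mono) auto
  also have "\<dots> = 2 ^ N * (max u v) ^ N" by (simp add: power_mult_distrib)
  also have "(max u v) ^ N \<le> u ^ N + v ^ N" using assms by (auto simp: max_def)
  finally show ?thesis by simp
qed

section \<open>Moments of edge counts, degrees and path sums\<close>

lemma (in edge_model) finE: "finite (pair_set L n)" by (rule finite_pair_set)

lemma (in edge_model) edge_moment: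
  assumes e: "e \<in> pair_set L n"
  shows "ex (\<lambda>w. (of_bool (w e) + pr e) ^ Suc k) \<le> 4 * be * 2 ^ k"
proof -
  have "ex (\<lambda>w. (of_bool (w e) + pr e) ^ Suc k) = pr e * (1 + pr e) ^ Suc k + (1 - pr e) * pr e ^ Suc k"
    by (subst bexp_resample[OF pw e]) simp
  also have "\<dots> \<le> pr e * 2 ^ Suc k + 1 * (pr e * 1)"
  proof (intro add_mono mult_mono)
    show "(1 + pr e) ^ Suc k \<le> 2 ^ Suc k" using pr[of e] by (intro power_mono) auto
    show "pr e ^ Suc k \<le> pr e * 1" using pr[of e] by (simp add: mult_left_le power_le_one)
  qed (use pr[of e] in auto)
  also have "\<dots> \<le> pr e * 2 ^ Suc k + pr e * 2 ^ Suc k"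
    using pr[of e] one_le_power[of "2::real" "Suc k"] by (simp add: mult_le_cancel_left1 del: power_Suc)
  also have "\<dots> = pr e * (4 * 2 ^ k)" by simp
  also have "\<dots> \<le> be * (4 * 2 ^ k)" using pr[of e] by (intro mult_right_mono) auto
  finally show ?thesis by simp
qed

lemma (in edge_model) total_moment:
  "ex (\<lambda>w. (\<Sum>e\<in>pair_set L n. of_bool (w e) + pr e) ^ m) \<le> (16 * be * real L * (real n)\<^sup>2 + 2 * (real m + 1)) ^ m"
proof (rule moment_recursion(2)[OF pw finE, where S = "\<lambda>e. {e}" and M = m and mu = "4 * be" and R = 2
        and mt = "4 * be * real L * (real n)\<^sup>2"])
  have "real (card (pair_set L n)) \<le> real L * (real n)\<^sup>2"
    using card_pair_set_le[of L n] by (metis of_nat_le_iff of_nat_mult of_nat_power)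
  then have "real (card (pair_set L n)) * (4 * be) \<le> (real L * (real n)\<^sup>2) * (4 * be)"
    using be0 by (intro mult_right_mono) auto
  then show "real (card (pair_set L n)) * (4 * be) \<le> 4 * be * real L * (real n)\<^sup>2" by (simp add: mult_ac)
qed (use be0 in \<open>auto simp: depends_on_def pr edge_moment simp del: power_Suc\<close>)

text \<open>The factor \<open>n * be\<close> stays outside the power. In sparse layers it is much
  smaller than \<open>Bd\<close>, which is at least of the moment order, and the saving reappears in
  the leading term of \<open>Bw\<close>.\<close>

lemma (in edge_model) degree_moment:
  assumes lb: "l < L" "b < n" and K: "K \<subseteq> {..<n} - {b}" and k: "k < M"
    and Bd: "16 * real n * be \<le> Bd" "2 * (real M + 1) \<le> Bd"
  shows "ex (\<lambda>w. (\<Sum>j\<in>K. A w l b j) ^ Suc k) \<le> 16 * real n * be * Bd ^ k"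
proof -
  have finK: "finite K" using K by (rule finite_subset) auto
  have "ex (\<lambda>w. (\<Sum>j\<in>K. A w l b j) ^ Suc k) \<le> 4 * (4 * real n * be) * Bd ^ k"
  proof (rule moment_recursion(1)[OF pw finK, where S = "\<lambda>j. {ed l b j}" and M = M and mu = "4 * be" and R = 2])
    show "real (card K) * (4 * be) \<le> 4 * real n * be"
    proof -
      have "card K \<le> card {..<n}" using K by (intro card_mono) auto
      then have "real (card K) * (4 * be) \<le> real n * (4 * be)" using be0 by (intro mult_right_mono) auto
      then show ?thesis by simp
    qed
    show "depends_on {ed l b q} (\<lambda>w. A w l b q)" for q
      by (auto simp: depends_on_def A_def sym_ext_def)
    show "ex (\<lambda>w. A w l b q ^ Suc k) \<le> 4 * be * 2 ^ k" if "q \<in> K" for q k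
    proof -
      have "q \<noteq> b" "q < n" using that K by auto
      then show ?thesis using edge_moment[OF ed_in_pair_set[of l L b n q]] lb by (simp add: A_def sym_ext_def del: power_Suc)
    qed
  qed (use k Bd be0 K in \<open>auto simp: A_bounds ed_eq_iff\<close>)
  then show ?thesis by (simp add: mult_ac)
qed

text \<open>Another use of the moment recursion, now over the intermediate nodes \<open>b\<close>.
  No edge is counted in two of the sets \<open>K b\<close>, and these sets avoid \<open>j\<close>.
  Hence different summands depend on disjoint sets of edges, and within a summand the edge from
  \<open>j\<close> to \<open>b\<close> is independent of \<open>D\<close>.\<close>

lemma (in edge_model) path_moment:
  assumes j: "j < n" and m: "1 \<le> m"
    and K: "\<And>b. K b \<subseteq> {..<n} - {j, b}" "\<And>b k. k \<in> K b \<Longrightarrow> b \<notin> K k"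
  defines "Bd \<equiv> 16 * real n * be + 4 * real m + 2"
  defines "Bw \<equiv> 4096 * real L * (real n * be)\<^sup>2 * Bd + 16 * (real m + 1) * Bd\<^sup>2"
  defines "D \<equiv> \<lambda>w l b. \<Sum>k\<in>K b. A w l b k"
  shows "ex (\<lambda>w. (\<Sum>l<L. \<Sum>b\<in>{..<n}-{j}. A w l j b * (4 * D w l b + 2 * (D w l b)\<^sup>2)) ^ m) \<le> Bw ^ m"
proof -
  have finK: "finite (K b)" for b using K(1) by (rule finite_subset) auto
  have Bd1: "1 \<le> Bd" using be0 by (simp add: Bd_def add_increasing)
  define t where "t = (\<lambda>(l,b) w. A w l j b * (4 * D w l b + 2 * (D w l b)\<^sup>2))"
  define I where "I = {..<L} \<times> ({..<n}-{j})"
  define S where "S = (\<lambda>(l,b). insert (ed l j b) (ed l b ` K b))"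
  have D0: "0 \<le> D w l b" for w l b unfolding D_def by (intro sum_nonneg A_bounds)
  have "ex (\<lambda>w. (\<Sum>q\<in>I. t q w) ^ m) \<le> Bw ^ m"
  proof (rule moment_recursion(2)[OF pw, where S = S and M = m and mu = "1024 * be * (real n * be) * Bd"
       and R = "16 * Bd\<^sup>2" and mt = "1024 * real L * (real n * be)\<^sup>2 * Bd"])
    show "finite I" by (simp add: I_def)
    show "0 \<le> t q w" for q w
      unfolding t_def by (cases q) (auto intro!: mult_nonneg_nonneg add_nonneg_nonneg simp: A_bounds D0)
    show "depends_on (S q) (t q)" for q
    proof -
      obtain l b where q: "q = (l,b)" by (cases q)
      show ?thesis unfolding depends_on_def
      proof (intro allI impI)
        fix w w' :: "nat \<times> nat \<times> nat \<Rightarrow> bool" assume *: "\<forall>e\<in>S q. w e = w' e"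
        have 1: "A w l j b = A w' l j b" using * by (auto simp: A_def sym_ext_def S_def q)
        have 2: "D w l b = D w' l b" unfolding D_def
          by (rule sum.cong) (use * in \<open>auto simp: A_def sym_ext_def S_def q\<close>)
        show "t q w = t q w'" by (simp add: t_def q 1 2)
      qed
    qed
    show "S q \<inter> S q' = {}" if "q \<in> I" "q' \<in> I" "q \<noteq> q'" for q q'
    proof -
      obtain l b l' b' where q: "q = (l,b)" "q' = (l',b')" by (cases q, cases q')
      have K1: "k \<noteq> j" "k \<noteq> b" if "k \<in> K b" for k b using K(1)[of b] that by auto
      show ?thesis using that K(2) K1 unfolding q S_def I_def
        by (auto simp: ed_eq_iff)
    qed
    show "real (card I) * (1024 * be * (real n * be) * Bd) \<le> 1024 * real L * (real n * be)\<^sup>2 * Bd"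
    proof -
      have "card I \<le> L * n" using j by (simp add: I_def card_cartesian_product)
      then have "real (card I) \<le> real L * real n" by (metis of_nat_le_iff of_nat_mult)
      then have "real (card I) * (1024 * be * (real n * be) * Bd) \<le> (real L * real n) * (1024 * be * (real n * be) * Bd)"
        using be0 Bd1 by (intro mult_right_mono) auto
      then show ?thesis by (simp add: power2_eq_square mult_ac)
    qed
    show "ex (\<lambda>w. t q w ^ Suc k) \<le> 1024 * be * (real n * be) * Bd * (16 * Bd\<^sup>2) ^ k" if q: "q \<in> I" and k: "k < m" for q k
    proof -
      obtain l b where lb: "q = (l,b)" by (cases q)
      then have l: "l < L" "b < n" "b \<noteq> j" using q by (auto simp: I_def)
      define G where "G w = (4 * D w l b + 2 * (D w l b)\<^sup>2) ^ Suc k" for w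
      define N where "N = Suc k"
      have Kb: "K b \<subseteq> {..<n} - {b}" using K(1)[of b] by auto
      \<comment> \<open>The square of \<open>D\<close> doubles the order of the moments, whence the
        term \<open>4 * m + 2 = 2 * (2 * m + 1)\<close> in \<open>Bd\<close>.\<close>
      have dm: "ex (\<lambda>w. D w l b ^ Suc i) \<le> 16 * real n * be * Bd ^ i" if "i < 2 * m" for i
        unfolding D_def by (rule degree_moment[OF l(1,2) Kb that]) (use be0 in \<open>auto simp: Bd_def\<close>)
      have "ex (\<lambda>w. t q w ^ Suc k) = ex (\<lambda>w. (A w l j b) ^ Suc k * G w)"
        by (simp add: t_def lb G_def power_mult_distrib del: power_Suc)
      also have "\<dots> = ex (\<lambda>w. (A w l j b) ^ Suc k) * ex G"
      proof (rule bexp_indep[OF pw, where S = "{ed l j b}"])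
        show "depends_on {ed l j b} (\<lambda>w. (A w l j b) ^ Suc k)"
          by (auto simp: depends_on_def A_def sym_ext_def)
        show "depends_on (- {ed l j b}) G"
          unfolding depends_on_def
        proof (intro allI impI)
          fix w w' :: "nat \<times> nat \<times> nat \<Rightarrow> bool" assume *: "\<forall>e\<in>- {ed l j b}. w e = w' e"
          have "A w l b k = A w' l b k" if "k \<in> K b" for k
            using * that K(1)[of b] l by (auto simp: A_def sym_ext_def ed_eq_iff)
          then have "D w l b = D w' l b" unfolding D_def by (intro sum.cong) auto
          then show "G w = G w'" by (simp add: G_def)
        qed
      qed
      \<comment> \<open>The constants multiply to \<open>4 * 8 * 32 = 1024\<close> and the ratios to
        \<open>2 * 8 = 16\<close>; the odd exponent of \<open>Bd\<close> leaves one factor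
        \<open>Bd\<close> outside the power.\<close>
      also have "\<dots> \<le> (4 * be * 2 ^ k) * (8 ^ N * (32 * (real n * be) * Bd ^ (2 * N - 1)))"
      proof (rule mult_mono)
        show "ex (\<lambda>w. (A w l j b) ^ Suc k) \<le> 4 * be * 2 ^ k"
          using edge_moment[OF ed_in_pair_set[of l L j n b]] l j by (simp add: A_def sym_ext_def del: power_Suc)
        have "ex G \<le> ex (\<lambda>w. 8 ^ N * D w l b ^ N + 4 ^ N * D w l b ^ (2 * N))"
        proof (rule bexp_mono[OF finE])
          fix w
          have "G w \<le> 2 ^ N * ((4 * D w l b) ^ N + (2 * (D w l b)\<^sup>2) ^ N)"
            unfolding G_def N_def[symmetric] using D0 by (intro power_add_le_double) auto
          also have "\<dots> = (2 * (4 * D w l b)) ^ N + (2 * (2 * (D w l b)\<^sup>2)) ^ N"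
            by (simp only: power_mult_distrib[of 2] distrib_left)
          also have "\<dots> = 8 ^ N * D w l b ^ N + 4 ^ N * D w l b ^ (2 * N)"
          proof -
            have "2 * (4 * D w l b) = 8 * D w l b" "2 * (2 * (D w l b)\<^sup>2) = 4 * (D w l b)\<^sup>2" by simp_all
            then show ?thesis by (simp only: power_mult_distrib power_mult)
          qed
          finally show "G w \<le> 8 ^ N * D w l b ^ N + 4 ^ N * D w l b ^ (2 * N)" .
        qed
        also have "\<dots> = 8 ^ N * ex (\<lambda>w. D w l b ^ N) + 4 ^ N * ex (\<lambda>w. D w l b ^ (2 * N))"
          by (simp only: bexp_add[OF finE] bexp_cmult)
        also have "\<dots> \<le> 8 ^ N * (16 * real n * be * Bd ^ (2 * N - 1)) + 8 ^ N * (16 * real n * be * Bd ^ (2 * N - 1))"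
        proof (intro add_mono mult_mono)
          have "ex (\<lambda>w. D w l b ^ Suc k) \<le> 16 * real n * be * Bd ^ k" using k by (intro dm) auto
          also have "\<dots> \<le> 16 * real n * be * Bd ^ (2 * N - 1)"
            using be0 Bd1 by (intro mult_left_mono power_increasing) (auto simp: N_def)
          finally show "ex (\<lambda>w. D w l b ^ N) \<le> 16 * real n * be * Bd ^ (2 * N - 1)" by (simp add: N_def)
          have "ex (\<lambda>w. D w l b ^ Suc (2 * N - 1)) \<le> 16 * real n * be * Bd ^ (2 * N - 1)"
            using k by (intro dm) (auto simp: N_def)
          then show "ex (\<lambda>w. D w l b ^ (2 * N)) \<le> 16 * real n * be * Bd ^ (2 * N - 1)" by (simp add: N_def)
          show "(4::real) ^ N \<le> 8 ^ N" by (intro power_mono) auto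
        qed (auto intro!: bexp_nonneg zero_le_power D0)
        finally show "ex G \<le> 8 ^ N * (32 * (real n * be) * Bd ^ (2 * N - 1))" by (simp add: algebra_simps)
        show "0 \<le> ex G" unfolding G_def by (intro bexp_nonneg zero_le_power add_nonneg_nonneg) (auto simp: D0)
      qed (use be0 in auto)
      also have "\<dots> = 1024 * be * (real n * be) * Bd * (16 * Bd\<^sup>2) ^ k"
      proof -
        have "Bd ^ (2 * N - 1) = Bd * (Bd\<^sup>2) ^ k" by (simp add: N_def power_mult[symmetric])
        moreover have "(16::real) ^ k = 2 ^ k * 8 ^ k" by (simp add: power_mult_distrib[symmetric])
        ultimately show ?thesis by (simp add: N_def power_mult_distrib)
      qed
      finally show ?thesis .
    qed
  qed (use be0 Bd1 in \<open>auto simp: Bw_def algebra_simps\<close>)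
  moreover have "(\<Sum>q\<in>I. t q w) = (\<Sum>l<L. \<Sum>b\<in>{..<n}-{j}. A w l j b * (4 * D w l b + 2 * (D w l b)\<^sup>2))" for w
    by (auto simp: I_def t_def sum.cartesian_product intro!: sum.cong)
  ultimately show ?thesis by simp
qed

lemma (in edge_model) W2_moment:
  assumes j: "j < n" and m: "1 \<le> m"
  defines "Bd \<equiv> 16 * real n * be + 4 * real m + 2"
  defines "Bw \<equiv> 4096 * real L * (real n * be)\<^sup>2 * Bd + 16 * (real m + 1) * Bd\<^sup>2"
  shows "ex (\<lambda>w. W2 w j ^ m) \<le> 2 * (2 * Bw) ^ m"
proof -
  \<comment> \<open>Each edge between neighbours is owned by its smaller (or larger) end, which makes the summands independent.\<close>
  define K1 K2 where "K1 b = {..<n} \<inter> {b<..} - {j}" and "K2 b = {..<b} \<inter> {..<n} - {j}" for b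
  define T where "T K w = (\<Sum>l<L. \<Sum>b\<in>{..<n}-{j}. A w l j b * (4 * (\<Sum>k\<in>K b. A w l b k) + 2 * (\<Sum>k\<in>K b. A w l b k)\<^sup>2))"
    for K :: "nat \<Rightarrow> nat set" and w
  have T0: "0 \<le> T K w" for K w
    unfolding T_def by (intro sum_nonneg mult_nonneg_nonneg add_nonneg_nonneg) (auto intro!: sum_nonneg simp: A_bounds)
  have 1: "ex (\<lambda>w. T K1 w ^ m) \<le> Bw ^ m"
    unfolding T_def Bw_def Bd_def by (rule path_moment[OF j m]) (auto simp: K1_def)
  have 2: "ex (\<lambda>w. T K2 w ^ m) \<le> Bw ^ m"
    unfolding T_def Bw_def Bd_def by (rule path_moment[OF j m]) (auto simp: K2_def)
  have W: "W2 w j \<le> T K1 w + T K2 w" for w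
  proof -
    have "W2 w j = (\<Sum>l<L. \<Sum>b\<in>{..<n}-{j}. A w l j b * (4 * Dg w l j b + (Dg w l j b)\<^sup>2))"
      unfolding W2_def using j by (simp add: sum.remove[of "{..<n}" j])
    also have "\<dots> \<le> T K1 w + T K2 w"
      unfolding T_def sum.distrib[symmetric] distrib_left[symmetric]
    proof (intro sum_mono mult_left_mono A_bounds)
      fix l b assume "b \<in> {..<n} - {j}"
      define x y where "x = (\<Sum>k\<in>K1 b. A w l b k)" "y = (\<Sum>k\<in>K2 b. A w l b k)"
      have "Dg w l j b = (\<Sum>k\<in>K1 b \<union> K2 b. A w l b k)"
        unfolding Dg_def by (rule sum.mono_neutral_right) (auto simp: K1_def K2_def, metis diag_simps(3) linorder_neqE_nat)
      also have "\<dots> = x + y" unfolding x_y_def by (rule sum.union_disjoint) (auto simp: K1_def K2_def)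
      finally have D: "Dg w l j b = x + y" .
      have "0 \<le> (x - y)\<^sup>2" by simp
      then show "4 * Dg w l j b + (Dg w l j b)\<^sup>2 \<le>
         4 * (\<Sum>k\<in>K1 b. A w l b k) + 2 * (\<Sum>k\<in>K1 b. A w l b k)\<^sup>2 + (4 * (\<Sum>k\<in>K2 b. A w l b k) + 2 * (\<Sum>k\<in>K2 b. A w l b k)\<^sup>2)"
        unfolding D x_y_def[symmetric] by (simp add: power2_eq_square algebra_simps)
    qed
    finally show ?thesis .
  qed
  have "ex (\<lambda>w. W2 w j ^ m) \<le> ex (\<lambda>w. 2 ^ m * (T K1 w ^ m + T K2 w ^ m))"
  proof (rule bexp_mono[OF finE])
    fix w
    have "W2 w j ^ m \<le> (T K1 w + T K2 w) ^ m" by (intro power_mono W W2_nonneg)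
    also have "\<dots> \<le> 2 ^ m * (T K1 w ^ m + T K2 w ^ m)" by (intro power_add_le_double T0)
    finally show "W2 w j ^ m \<le> 2 ^ m * (T K1 w ^ m + T K2 w ^ m)" .
  qed
  also have "\<dots> = 2 ^ m * (ex (\<lambda>w. T K1 w ^ m) + ex (\<lambda>w. T K2 w ^ m))"
    by (simp only: bexp_cmult bexp_add[OF finE])
  also have "\<dots> \<le> 2 ^ m * (Bw ^ m + Bw ^ m)" using 1 2 by (intro mult_left_mono add_mono) auto
  finally show ?thesis by (simp add: power_mult_distrib)
qed

lemma (in edge_model) F1_trace_moment:
  assumes m: "1 \<le> m"
  shows "ex (\<lambda>w. \<Sum>i<n. evl n (F1 w) i ^ (2 * m)) \<le>
    real n * (real m * (6 * real n * be\<^sup>2 * (16 * be * real L * (real n)\<^sup>2 + 2 * (real m + 1)))) ^ m"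
proof -
  have "ex (\<lambda>w. \<Sum>i<n. evl n (F1 w) i ^ (2 * m)) \<le> real n * (real m ^ m * ex (\<lambda>w. W1 w ^ m))"
    by (rule exchange_moment[where kappa = 1 and G = "\<lambda>e w. dmat P e"])
       (use m in \<open>(intro pw symm_F1 F1_dec F1_diff F1_weighted W1_nonneg | simp)+\<close>)
  also have "ex (\<lambda>w. W1 w ^ m) = (6 * real n * be\<^sup>2) ^ m * ex (\<lambda>w. (\<Sum>e\<in>pair_set L n. of_bool (w e) + pr e) ^ m)"
    unfolding W1_def power_mult_distrib[of "6 * real n * be\<^sup>2"] bexp_cmult ..
  also have "real n * (real m ^ m * \<dots>) \<le> real n * (real m ^ m * ((6 * real n * be\<^sup>2) ^ m * (16 * be * real L * (real n)\<^sup>2 + 2 * (real m + 1)) ^ m))"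
    by (intro mult_left_mono total_moment) auto
  finally show ?thesis by (simp only: power_mult_distrib)
qed

lemma (in edge_model) F2_trace_moment:
  assumes m: "1 \<le> m"
  defines "Bd \<equiv> 16 * real n * be + 4 * real m + 2"
  defines "Bw \<equiv> 4096 * real L * (real n * be)\<^sup>2 * Bd + 16 * (real m + 1) * Bd\<^sup>2"
  shows "ex (\<lambda>w. \<Sum>i<n. evl n (F2 w) i ^ (2 * m)) \<le> 2 * (real n)\<^sup>2 * (2 * real m * Bw) ^ m"
proof -
  have ne: "W2 w ` {..<n} \<noteq> {}" for w using n1 by (auto simp: lessThan_empty_iff)
  have mx: "Max (W2 w ` {..<n}) \<in> W2 w ` {..<n}" for w by (rule Max_in) (use ne in auto)
  then have M0: "0 \<le> Max (W2 w ` {..<n})" for w by (metis W2_nonneg imageE)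
  have "ex (\<lambda>w. \<Sum>i<n. evl n (F2 w) i ^ (2 * m)) \<le> real n * (real m ^ m * ex (\<lambda>w. Max (W2 w ` {..<n}) ^ m))"
    by (rule exchange_moment[where kappa = "1/2" and G = "\<lambda>e w. dmat (Y w) e"])
       (use m in \<open>(intro pw symm_F2 F2_dec F2_diff F2_weighted M0 | simp)+\<close>)
  \<comment> \<open>Replacing the maximum by the sum of \<open>m\<close>-th powers costs a factor
    \<open>n\<close>, which is harmless after an \<open>m\<close>-th root with \<open>m\<close> of
    logarithmic size.\<close>
  also have "\<dots> \<le> real n * (real m ^ m * ex (\<lambda>w. \<Sum>j<n. W2 w j ^ m))"
  proof (intro mult_left_mono bexp_mono finE)
    fix w
    obtain j where j: "j < n" "Max (W2 w ` {..<n}) = W2 w j" using mx[of w] by auto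
    then show "Max (W2 w ` {..<n}) ^ m \<le> (\<Sum>j<n. W2 w j ^ m)"
      by (simp only: j(2)) (rule member_le_sum, auto simp: W2_nonneg)
  qed auto
  also have "ex (\<lambda>w. \<Sum>j<n. W2 w j ^ m) = (\<Sum>j<n. ex (\<lambda>w. W2 w j ^ m))" by (rule bexp_sum[OF finE])
  also have "real n * (real m ^ m * \<dots>) \<le> real n * (real m ^ m * (\<Sum>j<n. 2 * (2 * Bw) ^ m))"
    unfolding Bw_def Bd_def by (intro mult_left_mono sum_mono W2_moment m) auto
  also have "\<dots> = 2 * (real n)\<^sup>2 * (2 * real m * Bw) ^ m"
    by (simp add: power_mult_distrib power2_eq_square)
  finally show ?thesis .
qed

section \<open>From trace moments to the operator norm\<close>

lemma operator_bound_from_trace: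
  assumes sym: "symm n F" and tr: "(\<Sum>i<n. evl n F i ^ (2 * m)) \<le> c ^ m" and m: "1 \<le> m" and c: "0 \<le> c" and x: "x \<in> V n"
  shows "norm (mv n n F x) \<le> sqrt c * norm x"
proof -
  note u = evec_facts[OF sym]
  have ev: "(evl n F i)\<^sup>2 \<le> c" if "i < n" for i
  proof -
    have "((evl n F i)\<^sup>2) ^ m = evl n F i ^ (2 * m)" by (simp add: power_mult)
    also have "\<dots> \<le> (\<Sum>i<n. evl n F i ^ (2 * m))"
      by (rule member_le_sum) (use that in \<open>auto simp: power_mult\<close>)
    finally have "((evl n F i)\<^sup>2) ^ m \<le> c ^ m" using tr by linarith
    then show ?thesis using m c by (subst (asm) power_mono_iff) auto
  qed
  have "(norm (mv n n F x))\<^sup>2 = (\<Sum>i<n. (inner (mv n n F x) (evec n F i))\<^sup>2)"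
    by (rule parseval_norm[OF u(1,2) mv_in_V])
  also have "\<dots> = (\<Sum>i<n. (evl n F i)\<^sup>2 * (inner x (evec n F i))\<^sup>2)"
    by (rule sum.cong) (auto simp: mv_symm[OF sym] u(3) power_mult_distrib)
  also have "\<dots> \<le> (\<Sum>i<n. c * (inner x (evec n F i))\<^sup>2)"
    by (intro sum_mono mult_right_mono ev) auto
  also have "\<dots> = c * (norm x)\<^sup>2" unfolding sum_distrib_left[symmetric] by (simp add: parseval_norm[OF u(1,2) x, symmetric])
  finally have "(norm (mv n n F x))\<^sup>2 \<le> (sqrt c * norm x)\<^sup>2" using c by (simp add: power_mult_distrib)
  then show ?thesis by (rule power2_le_imp_le) (use c in auto)
qed

definition bprob :: "'e set \<Rightarrow> ('e \<Rightarrow> real) \<Rightarrow> ('e \<Rightarrow> bool) set \<Rightarrow> real" where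
  "bprob E pr S = measure_pmf.prob (bern E pr) S"

lemma markov_power:
  assumes fin: "finite E" and nn: "\<And>w. 0 \<le> f w" and le: "bexp E pr f \<le> a * c ^ m" and c: "0 < c" and K: "0 < K"
  shows "bprob E pr {w. \<not> f w \<le> (K * c) ^ m} \<le> a / K ^ m"
proof -
  have pos: "0 < (K * c) ^ m" using c K by simp
  have "measure_pmf.prob (bern E pr) {w. (K * c) ^ m \<le> f w} \<le> bexp E pr f / (K * c) ^ m"
    using integral_Markov_inequality_measure[of "measure_pmf (bern E pr)" f "{}" "(K * c) ^ m"]
    by (simp add: bexp_def integrable_bern[OF fin] nn pos)
  moreover have "bprob E pr {w. \<not> f w \<le> (K * c) ^ m} \<le> measure_pmf.prob (bern E pr) {w. (K * c) ^ m \<le> f w}"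
    unfolding bprob_def by (intro measure_pmf.finite_measure_mono) auto
  moreover have "bexp E pr f / (K * c) ^ m \<le> a * c ^ m / (K * c) ^ m"
    using le pos by (intro divide_right_mono) auto
  moreover have "a * c ^ m / (K * c) ^ m = a / K ^ m" using c by (simp add: power_mult_distrib)
  ultimately show ?thesis by linarith
qed

text \<open>Since \<open>m\<close> is at least \<open>ln (L + n)\<close>, enlarging the moment scale
  by \<open>exp 3\<close> gains a factor \<open>(L + n) ^ 3\<close> in Markov's inequality. This
  absorbs the dimensional prefactors \<open>n\<close> and \<open>2 n^2\<close> at the price of a
  constant in the norm.\<close>

lemma (in edge_model) noise_operator_bound:
  assumes m: "1 \<le> m" "real L + real n \<le> exp (real m)" and be: "0 < be"
  defines "Bd \<equiv> 16 * real n * be + 4 * real m + 2"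
  defines "Bw \<equiv> 4096 * real L * (real n * be)\<^sup>2 * Bd + 16 * (real m + 1) * Bd\<^sup>2"
  shows "bprob (pair_set L n) pr {w. \<not> (\<forall>x\<in>V n.
      norm (mv n n (F1 w) x) + norm (mv n n (F2 w) x) \<le> 2 * sqrt (exp 3 * (2 * real m * Bw)) * norm x)} \<le> 3 / (real L + real n)"
proof -
  define c where "c = 2 * real m * Bw"
  have Bd1: "1 \<le> Bd" using be by (simp add: Bd_def add_increasing)
  have Bw0: "0 < Bw" unfolding Bw_def using be Bd1 by (intro add_nonneg_pos) auto
  then have c0: "0 < c" using m by (simp add: c_def)
  have n0: "1 \<le> real n" using n1 by simp
  \<comment> \<open>The moment scale of the linear part is dominated by that of the quadratic part,
    so one bound serves both.\<close>
  have c1: "real m * (6 * real n * be\<^sup>2 * (16 * be * real L * (real n)\<^sup>2 + 2 * (real m + 1))) \<le> c"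
  proof -
    have nb: "0 \<le> real n * be" using be by simp
    have "6 * real n * be\<^sup>2 * (16 * be * real L * (real n)\<^sup>2 + 2 * (real m + 1)) =
       6 * real L * (real n * be)\<^sup>2 * (16 * real n * be) + 12 * ((real m + 1) * (real n * be\<^sup>2))"
      by (simp add: power2_eq_square algebra_simps)
    also have "\<dots> \<le> 4096 * real L * (real n * be)\<^sup>2 * Bd + 16 * ((real m + 1) * Bd\<^sup>2)"
    proof (intro add_mono mult_mono)
      have "real n * be\<^sup>2 \<le> real n * (real n * be\<^sup>2)" using mult_right_mono[OF n0, of "real n * be\<^sup>2"] by simp
      also have "\<dots> = (real n * be)\<^sup>2" by (simp add: power2_eq_square)
      also have "\<dots> \<le> Bd\<^sup>2" using nb unfolding Bd_def by (intro power_mono; linarith)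
      finally show "real n * be\<^sup>2 \<le> Bd\<^sup>2" .
    qed (use be Bd1 in \<open>auto simp: Bd_def\<close>)
    also have "\<dots> = Bw" by (simp add: Bw_def)
    finally have "real m * (6 * real n * be\<^sup>2 * (16 * be * real L * (real n)\<^sup>2 + 2 * (real m + 1))) \<le> real m * Bw"
      by (intro mult_left_mono) auto
    also have "real m * Bw \<le> c" using Bw0 by (simp add: c_def)
    finally show ?thesis .
  qed
  have "real n * (real m * (6 * real n * be\<^sup>2 * (16 * be * real L * (real n)\<^sup>2 + 2 * (real m + 1)))) ^ m \<le> real n * c ^ m"
    using be by (intro mult_left_mono power_mono c1) auto
  with F1_trace_moment[OF m(1)] have "ex (\<lambda>w. \<Sum>i<n. evl n (F1 w) i ^ (2 * m)) \<le> real n * c ^ m" by linarith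
  then have p1: "bprob (pair_set L n) pr {w. \<not> (\<Sum>i<n. evl n (F1 w) i ^ (2 * m)) \<le> (exp 3 * c) ^ m} \<le> real n / exp 3 ^ m"
    by (intro markov_power finE) (auto intro!: sum_nonneg simp: power_mult c0)
  have "ex (\<lambda>w. \<Sum>i<n. evl n (F2 w) i ^ (2 * m)) \<le> 2 * (real n)\<^sup>2 * c ^ m"
    using F2_trace_moment[OF m(1)] by (simp add: c_def Bw_def Bd_def)
  then have p2: "bprob (pair_set L n) pr {w. \<not> (\<Sum>i<n. evl n (F2 w) i ^ (2 * m)) \<le> (exp 3 * c) ^ m} \<le> 2 * (real n)\<^sup>2 / exp 3 ^ m"
    by (intro markov_power finE) (auto intro!: sum_nonneg simp: power_mult c0)
  have "bprob (pair_set L n) pr {w. \<not> (\<forall>x\<in>V n.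
      norm (mv n n (F1 w) x) + norm (mv n n (F2 w) x) \<le> 2 * sqrt (exp 3 * c) * norm x)} \<le>
    bprob (pair_set L n) pr ({w. \<not> (\<Sum>i<n. evl n (F1 w) i ^ (2 * m)) \<le> (exp 3 * c) ^ m} \<union>
      {w. \<not> (\<Sum>i<n. evl n (F2 w) i ^ (2 * m)) \<le> (exp 3 * c) ^ m})"
    unfolding bprob_def
  proof (rule measure_pmf.finite_measure_mono)
    have "norm (mv n n (F1 w) x) + norm (mv n n (F2 w) x) \<le> 2 * sqrt (exp 3 * c) * norm x"
      if "(\<Sum>i<n. evl n (F1 w) i ^ (2 * m)) \<le> (exp 3 * c) ^ m" "(\<Sum>i<n. evl n (F2 w) i ^ (2 * m)) \<le> (exp 3 * c) ^ m" "x \<in> V n" for w x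
      using operator_bound_from_trace[OF symm_F1 that(1) m(1) _ that(3)] operator_bound_from_trace[OF symm_F2 that(2) m(1) _ that(3)] c0
      by simp
    then show "{w. \<not> (\<forall>x\<in>V n. norm (mv n n (F1 w) x) + norm (mv n n (F2 w) x) \<le> 2 * sqrt (exp 3 * c) * norm x)} \<subseteq>
       {w. \<not> (\<Sum>i<n. evl n (F1 w) i ^ (2 * m)) \<le> (exp 3 * c) ^ m} \<union> {w. \<not> (\<Sum>i<n. evl n (F2 w) i ^ (2 * m)) \<le> (exp 3 * c) ^ m}"
      by blast
  qed simp
  also have "\<dots> \<le> real n / exp 3 ^ m + 2 * (real n)\<^sup>2 / exp 3 ^ m"
    using p1 p2 unfolding bprob_def by (intro order_trans[OF measure_Un_le] add_mono) auto
  also have "\<dots> \<le> 3 / (real L + real n)"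
  proof -
    define s where "s = real L + real n"
    have s: "real n \<le> s" "1 \<le> s" using n0 by (auto simp: s_def)
    have "s ^ 3 \<le> exp (real m) ^ 3" using m(2) s by (intro power_mono) (auto simp: s_def)
    also have "\<dots> = exp 3 ^ m" by (simp add: exp_of_nat_mult[symmetric] mult.commute)
    finally have e: "s ^ 3 \<le> exp 3 ^ m" .
    have "real n + 2 * (real n)\<^sup>2 \<le> s\<^sup>2 + 2 * s\<^sup>2"
      using s n0 by (intro add_mono mult_left_mono power_mono) (auto simp: power2_eq_square intro: mult_mono[of 1, simplified] order_trans)
    then have "(real n + 2 * (real n)\<^sup>2) / exp 3 ^ m \<le> 3 * s\<^sup>2 / s ^ 3"
      using e s by (intro frac_le) auto
    also have "\<dots> = 3 / s" using s by (simp add: power2_eq_square power3_eq_cube)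
    finally show ?thesis by (simp add: s_def add_divide_distrib)
  qed
  finally show ?thesis by (simp add: c_def)
qed

section \<open>Krylov and Ritz approximation for a perturbed low-rank matrix\<close>

lemma norm_sum_scaleR_le:
  fixes w :: "nat \<Rightarrow> 'a::real_inner"
  shows "norm (\<Sum>k<K. x k *\<^sub>R w k) \<le> sqrt (\<Sum>k<K. (x k)\<^sup>2) * sqrt (\<Sum>k<K. (norm (w k))\<^sup>2)"
proof -
  have "norm (\<Sum>k<K. x k *\<^sub>R w k) \<le> (\<Sum>k<K. \<bar>x k\<bar> * norm (w k))"
    by (rule order_trans[OF norm_sum]) simp
  also have "\<dots> = \<bar>\<Sum>k<K. \<bar>x k\<bar> * norm (w k)\<bar>" by (subst abs_of_nonneg) (auto intro!: sum_nonneg)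
  also have "\<dots> \<le> sqrt ((\<Sum>k<K. \<bar>x k\<bar>\<^sup>2) * (\<Sum>k<K. (norm (w k))\<^sup>2))"
    using Cauchy_Schwarz_ineq_sum[of "\<lambda>k. \<bar>x k\<bar>" "\<lambda>k. norm (w k)" "{..<K}"] by (intro real_le_rsqrt) simp
  finally show ?thesis by (simp add: real_sqrt_mult)
qed

lemma best_approximation:
  assumes "orthonormal m c"
  shows "norm (x - (\<Sum>a<m. inner x (c a) *\<^sub>R c a)) \<le> norm (x - (\<Sum>a<m. z a *\<^sub>R c a))"
proof -
  define w where "w = (\<Sum>a<m. z a *\<^sub>R c a)"
  have "(\<Sum>a<m. inner (x - w) (c a) *\<^sub>R c a) = (\<Sum>a<m. inner x (c a) *\<^sub>R c a) - w"
    unfolding w_def by (simp add: inner_diff_left orthonormal_inner_sum[OF assms] scaleR_diff_left sum_subtractf)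
  then have "(norm (x - w))\<^sup>2 = (\<Sum>i<m. (inner (x - w) (c i))\<^sup>2) + (norm (x - (\<Sum>a<m. inner x (c a) *\<^sub>R c a)))\<^sup>2"
    using orthonormal_pythagoras[OF assms, of "x - w"] by simp
  then have "(norm (x - (\<Sum>a<m. inner x (c a) *\<^sub>R c a)))\<^sup>2 \<le> (norm (x - w))\<^sup>2"
    by (simp add: sum_nonneg)
  then show ?thesis unfolding w_def by (rule power2_le_imp_le) simp
qed

text \<open>\<open>t\<close> spans a space containing the image of the population matrix
  \<open>Ms\<close>, \<open>s\<close> bounds its form from below there, and \<open>eta\<close> is
  the noise relative to \<open>s\<close>. The ratio \<open>S / s\<close> is a constant in the
  application; the bound \<open>1 / 16\<close> leaves room for the Ritz values to stay above
  \<open>s / 2\<close>.\<close>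

locale low_rank_perturbation =
  fixes n K :: nat and M Ms :: rmat and t :: "nat \<Rightarrow> fvec" and s S eta :: real
  assumes symM: "symm n M" and ont: "orthonormal K t" and tV: "\<And>j. j < K \<Longrightarrow> t j \<in> V n"
    and K1: "1 \<le> K" and Kn: "K \<le> n" and s0: "0 < s" and S0: "0 \<le> S" and eta: "0 \<le> eta" "eta \<le> 1 / 16"
    and lower: "\<And>x. x \<in> V n \<Longrightarrow> s * (\<Sum>j<K. (inner x (t j))\<^sup>2) \<le> inner x (mv n n Ms x)"
    and upper: "\<And>x. x \<in> V n \<Longrightarrow> norm (mv n n Ms x) \<le> S * norm x"
    and range: "\<And>x. x \<in> V n \<Longrightarrow> mv n n Ms x = (\<Sum>j<K. inner (mv n n Ms x) (t j) *\<^sub>R t j)"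
    and pert: "\<And>x. x \<in> V n \<Longrightarrow> norm (mv n n M x - mv n n Ms x) \<le> eta * s * norm x"
begin

abbreviation "T \<equiv> mv n n M"
abbreviation "Ts \<equiv> mv n n Ms"
definition PT :: "fvec \<Rightarrow> fvec" where "PT x = (\<Sum>j<K. inner x (t j) *\<^sub>R t j)"
abbreviation "u \<equiv> evec n M"
abbreviation "lam \<equiv> evl n M"

sublocale T: linear T by (rule linear_mv)
sublocale Ts: linear Ts by (rule linear_mv)

lemmas uf = evec_facts[OF symM]

lemma quad_pert: "x \<in> V n \<Longrightarrow> \<bar>inner x (T x) - inner x (Ts x)\<bar> \<le> eta * s * (norm x)\<^sup>2"
proof -
  assume x: "x \<in> V n"
  have "\<bar>inner x (T x - Ts x)\<bar> \<le> norm x * norm (T x - Ts x)" by (rule Cauchy_Schwarz_ineq2)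
  also have "\<dots> \<le> norm x * (eta * s * norm x)" by (intro mult_left_mono pert x) auto
  finally show ?thesis by (simp add: inner_diff_right power2_eq_square mult_ac)
qed

lemma norm_PT: "(norm (PT x))\<^sup>2 = (\<Sum>j<K. (inner x (t j))\<^sup>2)"
  unfolding PT_def by (rule orthonormal_norm_sum[OF ont])

lemma PT_le: "norm (PT x) \<le> norm x"
  using bessel[OF ont, of x] unfolding norm_PT[symmetric] by (rule power2_le_imp_le) simp

lemma PT_residual_le: "norm (x - PT x) \<le> norm x"
  unfolding PT_def using best_approximation[OF ont, of x "\<lambda>_. 0"] by simp

lemma PT_range: "PT (\<Sum>j<K. c j *\<^sub>R t j) = (\<Sum>j<K. c j *\<^sub>R t j)"
  unfolding PT_def by (simp add: orthonormal_inner_sum[OF ont])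

lemma PT_inner: "inner (PT x) y = inner x (PT y)"
  unfolding PT_def by (simp add: inner_sum_left inner_sum_right inner_commute mult.commute)

lemma PT_V: "PT x \<in> V n"
  unfolding PT_def by (intro V_sum V_simps tV) auto

lemma linear_PT: "linear PT"
  by (rule linearI) (auto simp: PT_def inner_add_left scaleR_add_left sum.distrib scaleR_sum_right)

lemma PT_Ts: "x \<in> V n \<Longrightarrow> PT (Ts x) = Ts x"
  unfolding PT_def using range by simp

lemma comb_facts:
  fixes c :: "nat \<Rightarrow> real"
  assumes "\<exists>j<k. c j \<noteq> 0" "orthonormal k w"
  shows "0 < norm (\<Sum>j<k. c j *\<^sub>R w j)"
proof -
  have "(\<Sum>j<k. (c j)\<^sup>2) \<noteq> 0" using assms(1) by (subst sum_nonneg_eq_0_iff) auto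
  then show ?thesis using orthonormal_norm_sum[OF assms(2), of c] by auto
qed

text \<open>Among the combinations of the \<open>K\<close> vectors \<open>t j\<close> a nonzero one
  is orthogonal to the first \<open>k < K\<close> eigenvectors; there the form is at least
  \<open>(1 - eta) * s\<close> and at most \<open>lam k\<close> times the squared norm.\<close>

lemma eig_top:
  assumes k: "k < K"
  shows "(1 - eta) * s \<le> lam k"
proof -
  obtain c where c: "\<exists>j<K. c j \<noteq> 0" "\<forall>i<k. inner (u i) (\<Sum>j<K. c j *\<^sub>R t j) = 0"
    using exists_orthogonal_combination[OF k] by blast
  define y where "y = (\<Sum>j<K. c j *\<^sub>R t j)"
  have yV: "y \<in> V n" unfolding y_def by (intro V_sum V_simps tV) auto
  have y0: "0 < norm y" unfolding y_def by (rule comb_facts[OF c(1) ont])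
  have "PT y = y" unfolding y_def by (rule PT_range)
  then have "(\<Sum>j<K. (inner y (t j))\<^sup>2) = (norm y)\<^sup>2" using norm_PT[of y] by simp
  then have "s * (norm y)\<^sup>2 \<le> inner y (Ts y)" using lower[OF yV] by simp
  moreover have "inner y (T y) \<le> lam k * (norm y)\<^sup>2"
    using eigbasis_evec[OF symM] k Kn yV c(2) unfolding eigbasis_def y_def by auto
  ultimately have "((1 - eta) * s) * (norm y)\<^sup>2 \<le> lam k * (norm y)\<^sup>2"
    using quad_pert[OF yV] by (simp add: algebra_simps abs_le_iff)
  then show ?thesis using y0 by (simp add: mult_le_cancel_right_pos)
qed

lemma lam_mono: "i \<le> k \<Longrightarrow> k < n \<Longrightarrow> lam k \<le> lam i"
proof -
  assume i: "i \<le> k" "k < n"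
  have kk: "inner (u k) (u k) = 1" using uf(1) i by (simp add: orthonormal_def)
  have "inner (u k) (T (u k)) \<le> lam i * (norm (u k))\<^sup>2"
    using eigbasis_evec[OF symM] i uf(1) uf(2)[OF i(2)] unfolding eigbasis_def orthonormal_def by auto
  then show ?thesis using uf(3)[OF i(2)] kk by (simp add: power2_norm_eq_inner)
qed

text \<open>Dual count: among the combinations of the first \<open>K + 1\<close> eigenvectors a
  nonzero one is orthogonal to all \<open>t j\<close>, and on it the population form vanishes. The
  bound from below comes from nonnegativity of the population form at \<open>u k\<close>.\<close>

lemma eig_bulk:
  assumes k: "K \<le> k" "k < n"
  shows "\<bar>lam k\<bar> \<le> eta * s"
proof -
  have onK: "orthonormal (Suc K) u" using uf(1) k by (auto simp: orthonormal_def)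
  obtain c where c: "\<exists>j<Suc K. c j \<noteq> 0" "\<forall>i<K. inner (t i) (\<Sum>j<Suc K. c j *\<^sub>R u j) = 0"
    using exists_orthogonal_combination[of K "Suc K"] by blast
  define y where "y = (\<Sum>j<Suc K. c j *\<^sub>R u j)"
  have yV: "y \<in> V n" unfolding y_def by (intro V_sum V_simps uf(2)) (use k in auto)
  have y0: "0 < norm y" unfolding y_def by (rule comb_facts[OF c(1) onK])
  have Ty: "T y = (\<Sum>j<Suc K. (c j * lam j) *\<^sub>R u j)"
    unfolding y_def T.sum T.scaleR using k by (intro sum.cong) (auto simp: uf(3))
  have "inner y (T y) = (\<Sum>j<Suc K. (c j * lam j) * c j)"
    unfolding Ty inner_sum_right by (rule sum.cong) (auto simp: y_def orthonormal_inner_sum[OF onK] simp del: sum.lessThan_Suc)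
  also have "\<dots> \<ge> (\<Sum>j<Suc K. lam k * (c j)\<^sup>2)"
  proof (rule sum_mono)
    fix j assume "j \<in> {..<Suc K}"
    then have "lam k \<le> lam j" using k by (intro lam_mono) auto
    then show "lam k * (c j)\<^sup>2 \<le> (c j * lam j) * c j"
      using mult_right_mono[of "lam k" "lam j" "(c j)\<^sup>2"] by (simp add: power2_eq_square mult_ac)
  qed
  finally have "lam k * (norm y)\<^sup>2 \<le> inner y (T y)"
    unfolding y_def orthonormal_norm_sum[OF onK] sum_distrib_left .
  moreover have "inner y (Ts y) = 0"
  proof -
    have "inner y (Ts y) = (\<Sum>j<K. inner (Ts y) (t j) * inner y (t j))"
      by (subst range[OF yV]) (simp add: inner_sum_right)
    also have "\<dots> = 0" using c(2) by (intro sum.neutral) (auto simp: y_def inner_commute simp del: sum.lessThan_Suc)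
    finally show ?thesis .
  qed
  ultimately have "lam k * (norm y)\<^sup>2 \<le> (eta * s) * (norm y)\<^sup>2" using quad_pert[OF yV] by auto
  then have up: "lam k \<le> eta * s" using y0 by (simp add: mult_le_cancel_right_pos)
  have nu: "norm (u k) = 1" using uf(1) k by (simp add: orthonormal_norm)
  have "lam k = inner (u k) (T (u k))" using uf(1) k by (simp add: uf(3) orthonormal_def)
  moreover have "0 \<le> s * (\<Sum>j<K. (inner (u k) (t j))\<^sup>2)" using s0 by (intro mult_nonneg_nonneg sum_nonneg) auto
  ultimately have "- (eta * s) \<le> lam k"
    using quad_pert[OF uf(2)[OF k(2)]] lower[OF uf(2)[OF k(2)]] nu by auto
  with up show ?thesis by auto
qed

definition PV :: "fvec \<Rightarrow> fvec" where "PV x = (\<Sum>i<K. inner x (u i) *\<^sub>R u i)"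

lemma onu: "orthonormal K u" using uf(1) Kn by (auto simp: orthonormal_def)

lemma PV_V: "PV x \<in> V n" unfolding PV_def by (intro V_sum V_simps uf(2)) (use Kn in auto)

lemma residual_bulk:
  assumes "r \<in> V n" "\<And>i. i < K \<Longrightarrow> inner r (u i) = 0"
  shows "norm (T r) \<le> eta * s * norm r"
proof -
  have "(norm (T r))\<^sup>2 = (\<Sum>i<n. (inner (T r) (u i))\<^sup>2)"
    by (rule parseval_norm[OF uf(1,2) mv_in_V])
  also have "\<dots> = (\<Sum>i<n. (lam i)\<^sup>2 * (inner r (u i))\<^sup>2)"
    by (rule sum.cong) (auto simp: mv_symm[OF symM] uf(3) power_mult_distrib)
  also have "\<dots> \<le> (\<Sum>i<n. (eta * s)\<^sup>2 * (inner r (u i))\<^sup>2)"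
  proof (rule sum_mono)
    fix i assume i: "i \<in> {..<n}"
    show "(lam i)\<^sup>2 * (inner r (u i))\<^sup>2 \<le> (eta * s)\<^sup>2 * (inner r (u i))\<^sup>2"
    proof (cases "i < K")
      case False
      then have "\<bar>lam i\<bar> \<le> eta * s" using i by (intro eig_bulk) auto
      then have "\<bar>lam i\<bar>\<^sup>2 \<le> (eta * s)\<^sup>2" by (intro power_mono) auto
      then show ?thesis by (intro mult_right_mono) auto
    qed (simp add: assms(2))
  qed
  also have "\<dots> = (eta * s * norm r)\<^sup>2"
    by (simp add: sum_distrib_left[symmetric] parseval_norm[OF uf(1,2) assms(1), symmetric] power_mult_distrib)
  finally show ?thesis by (rule power2_le_imp_le) (use eta s0 in auto)
qed

text \<open>An estimate of Davis-Kahan type. \<open>T\<close> is small on the residual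
  \<open>r\<close>, hence so is \<open>Ts\<close>, and coercivity on the span makes
  \<open>PT r\<close> small. As \<open>x\<close> lies in the span, the squared norm of
  \<open>r\<close> equals \<open>inner (PT r) x\<close>, which transfers the bound to
  \<open>r\<close> itself.\<close>

lemma range_near_eigenspace:
  assumes x: "PT x = x"
  shows "norm (x - PV x) \<le> 2 * eta * norm x"
proof -
  have xV: "x \<in> V n" using PT_V[of x] x by simp
  define r where "r = x - PV x"
  have rV: "r \<in> V n" unfolding r_def by (intro V_simps xV PV_V)
  have ru: "inner r (u i) = 0" if "i < K" for i
    unfolding r_def PV_def by (rule orthonormal_residual[OF onu that])
  have "norm (Ts r) \<le> norm (T r) + norm (T r - Ts r)" by (metis norm_triangle_sub norm_minus_commute)
  then have Tsr: "norm (Ts r) \<le> 2 * eta * s * norm r"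
    using residual_bulk[OF rV ru] pert[OF rV] by auto
  have "s * (norm (PT r))\<^sup>2 \<le> inner r (Ts r)" using lower[OF rV] by (simp add: norm_PT)
  also have "inner r (Ts r) = inner (PT r) (Ts r)" by (simp add: PT_inner PT_Ts[OF rV])
  also have "\<dots> \<le> norm (PT r) * norm (Ts r)" by (rule norm_cauchy_schwarz)
  also have "\<dots> \<le> norm (PT r) * (2 * eta * s * norm r)" using Tsr by (intro mult_left_mono) auto
  finally have "norm (PT r) * (s * norm (PT r)) \<le> norm (PT r) * (s * (2 * eta * norm r))"
    by (simp add: power2_eq_square mult_ac)
  then have PTr: "norm (PT r) \<le> 2 * eta * norm r"
    using s0 eta by (cases "norm (PT r) = 0") (auto simp: mult_le_cancel_left_pos)
  have "inner r (PV x) = 0" unfolding PV_def by (simp add: inner_sum_right ru)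
  then have "(norm r)\<^sup>2 = inner r x" unfolding power2_norm_eq_inner by (subst (2) r_def) (simp add: inner_diff_right)
  also have "\<dots> = inner (PT r) x" using x by (simp add: PT_inner)
  also have "\<dots> \<le> norm (PT r) * norm x" by (rule norm_cauchy_schwarz)
  also have "\<dots> \<le> (2 * eta * norm r) * norm x" using PTr by (intro mult_right_mono) auto
  finally have "norm r * norm r \<le> norm r * (2 * eta * norm x)" by (simp add: power2_eq_square mult_ac)
  then show ?thesis using eta unfolding r_def[symmetric]
    by (cases "norm r = 0") (auto simp: mult_le_cancel_left_pos)
qed

lemma funpow_V: "x \<in> V n \<Longrightarrow> (T ^^ N) x \<in> V n"
  by (induction N) auto

lemma funpow_inner: "x \<in> V n \<Longrightarrow> i < n \<Longrightarrow> inner ((T ^^ N) x) (u i) = lam i ^ N * inner x (u i)"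
  by (induction N) (auto simp: mv_symm[OF symM] uf(3))

text \<open>The coefficients are chosen so that the power iterate and \<open>x\<close> have the same
  components along the leading eigenvectors. The error is then the bulk part: it is damped by
  \<open>(eta * s) ^ N\<close>, while matching the components amplifies by at most
  \<open>1 / ((1 - eta) * s) ^ N\<close>. The factor \<open>Fr / tau\<close> is the price of
  inverting the projected test matrix.\<close>

lemma power_range_near:
  assumes om: "\<And>k. k < K \<Longrightarrow> om k \<in> V n" and tau: "0 < tau" and Fr: "0 \<le> Fr"
    and cond: "\<And>y. \<exists>x. (\<forall>j<K. (\<Sum>k<K. inner (u j) (om k) * x k) = y j) \<and> tau * sqrt (\<Sum>k<K. (x k)\<^sup>2) \<le> sqrt (\<Sum>k<K. (y k)\<^sup>2)"
    and fro: "sqrt (\<Sum>k<K. (norm (om k))\<^sup>2) \<le> Fr" and x: "PT x = x"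
  shows "\<exists>c. norm (x - (\<Sum>k<K. c k *\<^sub>R (T ^^ N) (om k))) \<le> (2 * eta + (2 * eta) ^ N * (Fr / tau)) * norm x"
proof -
  have xV: "x \<in> V n" using PT_V[of x] x by simp
  define y where "y j = inner x (u j) / lam j ^ N" for j
  obtain c where c: "\<And>j. j < K \<Longrightarrow> (\<Sum>k<K. inner (u j) (om k) * c k) = y j"
      and cn: "tau * sqrt (\<Sum>k<K. (c k)\<^sup>2) \<le> sqrt (\<Sum>k<K. (y k)\<^sup>2)"
    using cond[of y] by blast
  define z where "z = (\<Sum>k<K. c k *\<^sub>R om k)"
  have zV: "z \<in> V n" unfolding z_def by (intro V_sum V_simps om) auto
  have linN: "linear (T ^^ N)"
  proof (induction N)
    case 0 show ?case unfolding funpow.simps by (rule linear_id)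
  next
    case (Suc N) then show ?case unfolding funpow.simps by (intro linear_compose linear_mv)
  qed
  define w where "w = (T ^^ N) z"
  have w: "w = (\<Sum>k<K. c k *\<^sub>R (T ^^ N) (om k))"
    unfolding w_def z_def using linN by (simp add: linear_sum linear_scale)
  have wV: "w \<in> V n" unfolding w_def by (rule funpow_V[OF zV])
  define a where "a = (1 - eta) * s"
  have a0: "0 < a" unfolding a_def using eta s0 by (intro mult_pos_pos) auto
  have lampos: "0 < lam j" if "j < K" for j using eig_top[OF that] a0 by (simp add: a_def)
  have wu: "inner w (u j) = inner x (u j)" if j: "j < K" for j
  proof -
    have "inner z (u j) = y j" unfolding c[OF j, symmetric] z_def inner_sum_left
      by (rule sum.cong) (auto simp: inner_commute mult.commute)
    then show ?thesis using funpow_inner[OF zV, of j N] j Kn lampos[OF j] by (simp add: w_def y_def)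
  qed
  define e where "e = w - PV x"
  have eV: "e \<in> V n" unfolding e_def by (intro V_simps wV PV_V)
  have eu: "inner e (u j) = (if j < K then 0 else lam j ^ N * inner z (u j))" if j: "j < n" for j
  proof (cases "j < K")
    case True
    then show ?thesis unfolding e_def PV_def by (simp add: inner_diff_left orthonormal_inner_sum[OF onu] wu)
  next
    case False
    have "inner (PV x) (u j) = 0" unfolding PV_def inner_sum_left using uf(1) False j Kn
      by (intro sum.neutral) (auto simp: orthonormal_def)
    then show ?thesis using False by (simp add: e_def inner_diff_left w_def funpow_inner[OF zV j])
  qed
  have es: "0 \<le> eta * s" using eta s0 by simp
  have "(norm e)\<^sup>2 = (\<Sum>j<n. (inner e (u j))\<^sup>2)" by (rule parseval_norm[OF uf(1,2) eV])
  also have "\<dots> \<le> (\<Sum>j<n. ((eta * s) ^ N)\<^sup>2 * (inner z (u j))\<^sup>2)"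
  proof (rule sum_mono)
    fix j assume "j \<in> {..<n}"
    then have j: "j < n" by simp
    show "(inner e (u j))\<^sup>2 \<le> ((eta * s) ^ N)\<^sup>2 * (inner z (u j))\<^sup>2"
    proof (cases "j < K")
      case False
      then have "\<bar>lam j\<bar> ^ N \<le> (eta * s) ^ N" using j by (intro power_mono eig_bulk) auto
      then have "(\<bar>lam j\<bar> ^ N)\<^sup>2 \<le> ((eta * s) ^ N)\<^sup>2" by (rule power_mono) auto
      then have "(lam j ^ N)\<^sup>2 \<le> ((eta * s) ^ N)\<^sup>2" by (simp add: power_abs[symmetric])
      then show ?thesis using False by (simp add: eu[OF j] power_mult_distrib mult_right_mono)
    qed (simp add: eu[OF j])
  qed
  also have "\<dots> = ((eta * s) ^ N * norm z)\<^sup>2"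
    by (simp add: sum_distrib_left[symmetric] parseval_norm[OF uf(1,2) zV, symmetric] power_mult_distrib)
  finally have e1: "norm e \<le> (eta * s) ^ N * norm z" by (rule power2_le_imp_le) (use es in auto)
  have y_le: "sqrt (\<Sum>k<K. (y k)\<^sup>2) \<le> norm x / a ^ N"
  proof -
    have "(\<Sum>k<K. (y k)\<^sup>2) \<le> (\<Sum>k<K. (inner x (u k))\<^sup>2 / (a ^ N)\<^sup>2)"
    proof (rule sum_mono)
      fix k assume "k \<in> {..<K}"
      then have "a ^ N \<le> lam k ^ N" using a0 eig_top[of k] by (intro power_mono) (auto simp: a_def)
      then have "(a ^ N)\<^sup>2 \<le> (lam k ^ N)\<^sup>2" using a0 by (intro power_mono[of "a ^ N"]) auto
      then show "(y k)\<^sup>2 \<le> (inner x (u k))\<^sup>2 / (a ^ N)\<^sup>2"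
        unfolding y_def power_divide using a0 by (intro divide_left_mono) (auto intro!: mult_pos_pos, metis \<open>k \<in> {..<K}\<close> lampos lessThan_iff less_irrefl)
    qed
    also have "\<dots> \<le> (norm x)\<^sup>2 / (a ^ N)\<^sup>2"
      unfolding sum_divide_distrib[symmetric] by (intro divide_right_mono bessel onu) auto
    finally show ?thesis using a0 by (intro real_le_lsqrt) (auto simp: power_divide)
  qed
  have "norm z \<le> sqrt (\<Sum>k<K. (c k)\<^sup>2) * sqrt (\<Sum>k<K. (norm (om k))\<^sup>2)"
    unfolding z_def by (rule norm_sum_scaleR_le)
  also have "\<dots> \<le> (norm x / a ^ N / tau) * Fr"
  proof (rule mult_mono[OF _ fro])
    have "tau * sqrt (\<Sum>k<K. (c k)\<^sup>2) \<le> norm x / a ^ N" using cn y_le by linarith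
    then show "sqrt (\<Sum>k<K. (c k)\<^sup>2) \<le> norm x / a ^ N / tau" by (simp only: pos_le_divide_eq[OF tau] mult.commute)
  qed (use tau a0 in \<open>auto intro!: sum_nonneg\<close>)
  finally have "norm e \<le> (eta * s) ^ N * ((norm x / a ^ N / tau) * Fr)"
    using e1 es by (meson mult_left_mono order_trans zero_le_power)
  also have "\<dots> = (eta * s / a) ^ N * (Fr / tau) * norm x" by (simp add: power_divide)
  also have "\<dots> \<le> (2 * eta) ^ N * (Fr / tau) * norm x"
  proof (intro mult_right_mono power_mono)
    have "eta * s / a = eta / (1 - eta)" using s0 eta by (simp add: a_def)
    also have "\<dots> \<le> 2 * eta"
    proof -
      have "eta * 1 \<le> eta * (2 * (1 - eta))" using eta by (intro mult_left_mono) auto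
      moreover have "0 < 1 - eta" using eta by linarith
      ultimately show ?thesis by (simp only: pos_divide_le_eq mult_1_right mult_ac)
    qed
    finally show "eta * s / a \<le> 2 * eta" .
  qed (use tau Fr es a0 in auto)
  finally have "norm e \<le> (2 * eta) ^ N * (Fr / tau) * norm x" .
  moreover have "norm (x - w) \<le> norm (x - PV x) + norm e"
    unfolding e_def using norm_triangle_ineq[of "x - PV x" "PV x - w"] by (simp add: norm_minus_commute)
  ultimately have "norm (x - w) \<le> (2 * eta + (2 * eta) ^ N * (Fr / tau)) * norm x"
    using range_near_eigenspace[OF x] by (simp add: algebra_simps)
  then show ?thesis unfolding w by blast
qed


text \<open>No gap between Ritz values is involved, so every admissible choice of Ritz vectors is
  covered. Once the Ritz values exceed \<open>s / 2\<close>, the Ritz equation writes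
  \<open>lr k *\<^sub>R uh k\<close> as the compression of \<open>T (uh k)\<close>. The population
  part of the latter already lies in the span of the \<open>t j\<close>, and the compression moves
  it by a relative amount of at most \<open>de\<close>.\<close>

lemma ritz_vectors:
  assumes onQ: "orthonormal_cols n m Q"
    and top: "top_eigvecs m K (mmult n (mtrans Q) (mmult n M Q)) U"
    and near: "\<And>x. PT x = x \<Longrightarrow> norm (x - (\<Sum>a<m. inner x (mkv n (\<lambda>i. Q i a)) *\<^sub>R mkv n (\<lambda>i. Q i a))) \<le> de * norm x"
    and de: "0 \<le> de" "de \<le> 1 / 4"
  defines "uh \<equiv> \<lambda>k. mkv n (\<lambda>i. mmult m Q U i k)"
  shows "orthonormal K uh" "\<And>k. k < K \<Longrightarrow> norm (uh k - PT (uh k)) \<le> 2 * (de * S / s + eta)"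
proof -
  define C where "C = mmult n (mtrans Q) (mmult n M Q)"
  define c where "c a = mkv n (\<lambda>i. Q i a)" for a
  define Uc where "Uc k = mkv m (\<lambda>a. U a k)" for k
  define J where "J = mv n m Q"
  define J' where "J' = mv m n (mtrans Q)"
  interpret J: linear J unfolding J_def by (rule linear_mv)
  interpret J': linear J' unfolding J'_def by (rule linear_mv)
  have onc: "orthonormal m c"
    using onQ unfolding orthonormal_def orthonormal_cols_def c_def by (simp add: inner_V[OF mkv_in_V])
  have JV: "J y \<in> V n" "J' x \<in> V m" for x y by (auto simp: J_def J'_def)
  have Jc: "J y = (\<Sum>a<m. crd y a *\<^sub>R c a)" for y
    by (rule V_eqI[of _ n]) (auto simp: J_def c_def mult.commute)
  have J'c: "crd (J' x) a = inner x (c a)" if "a < m" for x a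
    using that by (simp add: J'_def c_def inner_V2[OF mkv_in_V] mtrans_def mult.commute)
  have adj: "inner (J' x) y = inner x (J y)" for x y
    unfolding J_def J'_def mv_adj mtrans_def ..
  have JJ': "J (J' x) = (\<Sum>a<m. inner x (c a) *\<^sub>R c a)" for x
    unfolding Jc by (rule sum.cong) (auto simp: J'c)
  have J'J: "J' (J y) = y" if "y \<in> V m" for y
    by (rule V_eqI[of _ m]) (auto simp: JV that J'c, subst Jc, simp add: orthonormal_inner_sum[OF onc])
  have isoJ: "inner (J x) (J y) = inner x y" if "x \<in> V m" for x y
    by (subst adj[symmetric]) (simp add: J'J[OF that])
  have normJ: "norm (J x) = norm x" if "x \<in> V m" for x
    by (simp add: norm_eq_sqrt_inner isoJ[OF that])
  have Cy: "mv m m C y = J' (T (J y))" for y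
    unfolding C_def mv_mmult J_def J'_def ..
  have symC: "symm m C"
  proof -
    have "inner (bv i) (mv m m C (bv j)) = inner (bv j) (mv m m C (bv i))" for i j
    proof -
      have "inner (bv i) (mv m m C (bv j)) = inner (T (J (bv j))) (J (bv i))"
        unfolding Cy by (subst inner_commute, subst adj) simp
      also have "\<dots> = inner (J (bv j)) (T (J (bv i)))" by (rule mv_symm[OF symM])
      also have "\<dots> = inner (bv j) (mv m m C (bv i))"
        unfolding Cy by (subst inner_commute, subst adj[symmetric], rule inner_commute)
      finally show ?thesis .
    qed
    moreover have "inner (bv i) (mv m m C (bv j)) = C i j" if "i < m" "j < m" for i j
      using that by (simp add: if_distrib cong: if_cong)
    ultimately show ?thesis unfolding symm_def by metis
  qed
  obtain lr where onU: "orthonormal_cols m K U"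
    and lr: "\<forall>k<K. \<forall>a<m. (\<Sum>b<m. C a b * U b k) = lr k * U a k"
    and tmax: "\<And>w mu k. (\<exists>a<m. w a \<noteq> 0) \<Longrightarrow> (\<forall>a<m. (\<Sum>b<m. C a b * w b) = mu * w a) \<Longrightarrow>
       (\<forall>k<K. (\<Sum>a<m. w a * U a k) = 0) \<Longrightarrow> k < K \<Longrightarrow> mu \<le> lr k"
    using top unfolding top_eigvecs_def C_def[symmetric] by blast
  have UV: "Uc k \<in> V m" for k by (simp add: Uc_def)
  have onUc: "orthonormal K Uc"
    using onU unfolding orthonormal_def orthonormal_cols_def Uc_def by (simp add: inner_V[OF mkv_in_V])
  have eigU: "is_eig m C (Uc k) (lr k)" if "k < K" for k
    unfolding is_eig_def using lr that by (auto simp: Uc_def intro!: V_eqI[of _ m])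
  have uhJ: "uh k = J (Uc k)" for k
    unfolding uh_def J_def Uc_def by (rule V_eqI[of _ n]) (auto simp: mmult_def)
  show onuh: "orthonormal K uh"
    using onUc unfolding orthonormal_def uhJ by (simp add: isoJ[OF UV])
  \<comment> \<open>The definition of top eigenvectors compares eigenvectors only. The maximiser of
    the form on the complement is an eigenvector, so the comparison extends to a Rayleigh bound on
    the whole complement.\<close>
  have perp: "inner y (mv m m C y) \<le> lr k * (norm y)\<^sup>2"
    if y: "y \<in> V m" "\<And>j. j < K \<Longrightarrow> inner (Uc j) y = 0" and k: "k < K" for y k
  proof (cases "K < m")
    case True
    obtain x mu where x: "norm x = 1" "is_eig m C x mu" "\<forall>i<K. inner (Uc i) x = 0"
      "\<forall>y\<in>V m. (\<forall>i<K. inner (Uc i) y = 0) \<longrightarrow> inner y (mv m m C y) \<le> mu * (norm y)\<^sup>2"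
      using max_eigenvector[OF symC True, of Uc lr] eigU by blast
    have xV: "x \<in> V m" and xe: "mv m m C x = mu *\<^sub>R x" using x(2) by (auto simp: is_eig_def)
    have "mu \<le> lr k"
    proof (rule tmax[of "crd x"])
      show "\<exists>a<m. crd x a \<noteq> 0"
      proof (rule ccontr)
        assume "\<not> (\<exists>a<m. crd x a \<noteq> 0)"
        then have "x = 0" using xV by (intro V_eqI[of _ m]) auto
        then show False using x(1) by simp
      qed
      show "\<forall>a<m. (\<Sum>b<m. C a b * crd x b) = mu * crd x a"
      proof (intro allI impI)
        fix a assume a: "a < m"
        have "crd (mv m m C x) a = mu * crd x a" by (simp add: xe)
        then show "(\<Sum>b<m. C a b * crd x b) = mu * crd x a" using a by simp
      qed
      show "\<forall>k<K. (\<Sum>a<m. crd x a * U a k) = 0"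
        using x(3) by (auto simp: Uc_def inner_V[OF mkv_in_V] mult.commute)
    qed (use k in auto)
    then have "mu * (norm y)\<^sup>2 \<le> lr k * (norm y)\<^sup>2" by (intro mult_right_mono) auto
    moreover have "inner y (mv m m C y) \<le> mu * (norm y)\<^sup>2" using x(4) y by auto
    ultimately show ?thesis by linarith
  next
    case False
    then have onm: "orthonormal m Uc" using onUc by (auto simp: orthonormal_def)
    have "y = (\<Sum>i<m. inner y (Uc i) *\<^sub>R Uc i)" by (rule orthonormal_expansion[OF onm UV y(1)])
    also have "\<dots> = 0" using y(2) False by (intro sum.neutral) (auto simp: inner_commute)
    finally show ?thesis by simp
  qed
  interpret Cl: linear "mv m m C" by (rule linear_mv)
  have lr_ge: "s / 2 \<le> lr k" if k: "k < K" for k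
  proof -
    \<comment> \<open>\<open>f\<close> enumerates the \<open>K - 1\<close> Ritz vectors other than
      the \<open>k\<close>-th. A vector of the span orthogonal to these has a Ritz component along
      \<open>uh k\<close> alone.\<close>
    define f where "f i = uh (if i < k then i else Suc i)" for i
    obtain d where d: "\<exists>j<K. d j \<noteq> 0" "\<forall>i<K - 1. inner (f i) (\<Sum>j<K. d j *\<^sub>R t j) = 0"
      using exists_orthogonal_combination[of "K - 1" K f t] K1 by auto
    define x where "x = (\<Sum>j<K. d j *\<^sub>R t j)"
    have xu: "inner (uh i) x = 0" if ik: "i < K" "i \<noteq> k" for i
    proof (cases "i < k")
      case True then show ?thesis using d(2)[rule_format, of i] k by (simp add: f_def x_def)
    next
      case False
      then obtain i' where i': "i = Suc i'" "\<not> i' < k" using ik by (cases i) auto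
      then show ?thesis using d(2)[rule_format, of i'] ik by (simp add: f_def x_def)
    qed
    have x0: "0 < norm x" unfolding x_def by (rule comb_facts[OF d(1) ont])
    have PTx: "PT x = x" unfolding x_def by (rule PT_range)
    define y where "y = J' x"
    define b where "b = inner y (Uc k)"
    define y0 where "y0 = y - b *\<^sub>R Uc k"
    have yV: "y \<in> V m" by (simp add: y_def JV)
    have yU: "inner y (Uc i) = 0" if "i < K" "i \<noteq> k" for i
      using xu[OF that] by (simp add: y_def adj uhJ inner_commute)
    have kk: "inner (Uc k) (Uc k) = 1" using onUc k by (simp add: orthonormal_def)
    have y0V: "y0 \<in> V m" unfolding y0_def by (intro V_simps yV UV)
    have y0U: "inner (Uc j) y0 = 0" if "j < K" for j
      using yU[OF that] onUc k that kk by (cases "j = k") (auto simp: y0_def inner_diff_right b_def inner_commute orthonormal_def)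
    have y_eq: "y = y0 + b *\<^sub>R Uc k" by (simp add: y0_def)
    have CU: "mv m m C (Uc k) = lr k *\<^sub>R Uc k" using eigU[OF k] by (simp add: is_eig_def)
    have cross: "inner (Uc k) (mv m m C y0) = 0"
      using mv_symm[OF symC, of "Uc k" y0] y0U[OF k] by (simp add: CU)
    have "inner y (mv m m C y) = inner y0 (mv m m C y0) + b\<^sup>2 * lr k"
      unfolding y_eq using cross y0U[OF k] kk
      by (simp add: Cl.add Cl.scaleR CU inner_add_left inner_add_right inner_commute power2_eq_square)
    moreover have "(norm y)\<^sup>2 = (norm y0)\<^sup>2 + b\<^sup>2"
      unfolding power2_norm_eq_inner y_eq using y0U[OF k] kk
      by (simp add: inner_add_left inner_add_right inner_commute power2_eq_square)
    ultimately have q1: "inner y (mv m m C y) \<le> lr k * (norm y)\<^sup>2"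
      using perp[OF y0V y0U k] by (simp add: algebra_simps)
    define w where "w = J y"
    have wV: "w \<in> V n" by (simp add: w_def JV)
    have q2: "inner y (mv m m C y) = inner w (T w)"
      unfolding Cy w_def by (subst inner_commute, subst adj) (rule inner_commute)
    have nw: "norm y = norm w" by (simp add: w_def normJ[OF yV])
    have xw: "norm (x - w) \<le> de * norm x" using near[OF PTx] by (simp add: w_def y_def JJ' c_def)
    interpret PT: linear PT by (rule linear_PT)
    have "norm x \<le> norm (PT w) + norm (PT (x - w))"
      using norm_triangle_ineq[of "PT w" "PT (x - w)"] PTx by (simp add: PT.diff)
    also have "norm (PT (x - w)) \<le> de * norm x" using PT_le xw order_trans by blast
    finally have Pw: "(1 - de) * norm x \<le> norm (PT w)" by (simp add: algebra_simps)
    have wx: "norm w \<le> norm x"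
      unfolding nw[symmetric]
    proof (rule power2_le_imp_le)
      have "(norm y)\<^sup>2 = inner x (J y)" unfolding power2_norm_eq_inner by (subst (1) y_def) (rule adj)
      also have "\<dots> \<le> norm x * norm y" using norm_cauchy_schwarz[of x "J y"] by (simp add: normJ[OF yV])
      finally have "norm y * norm y \<le> norm x * norm y" by (simp add: power2_eq_square)
      then have "norm y \<le> norm x" by (cases "norm y = 0") auto
      then show "(norm y)\<^sup>2 \<le> (norm x)\<^sup>2" by (intro power_mono) auto
    qed simp
    \<comment> \<open>With \<open>de\<close> at most \<open>1 / 4\<close> the projection keeps
      \<open>9 / 16\<close> of the squared norm, and the noise takes away at most
      \<open>1 / 16\<close>; this leaves the factor \<open>1 / 2\<close> in the bound for
      \<open>lr k\<close>.\<close>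
    have "(3 / 4 * norm x) \<le> (1 - de) * norm x" using de by (intro mult_right_mono) auto
    then have Pw': "3 / 4 * norm x \<le> norm (PT w)" using Pw by linarith
    have "(3 / 4 * norm w)\<^sup>2 \<le> (norm (PT w))\<^sup>2" using wx Pw' by (intro power_mono) auto
    then have "9 / 16 * (norm w)\<^sup>2 \<le> (norm (PT w))\<^sup>2" by (simp add: power_mult_distrib power2_eq_square)
    then have "s * (9 / 16 * (norm w)\<^sup>2) \<le> s * (norm (PT w))\<^sup>2" using s0 by (intro mult_left_mono) auto
    also have "\<dots> \<le> inner w (Ts w)" using lower[OF wV] by (simp add: norm_PT)
    also have "\<dots> \<le> inner w (T w) + eta * s * (norm w)\<^sup>2" using quad_pert[OF wV] by linarith
    also have "eta * s * (norm w)\<^sup>2 \<le> 1 / 16 * s * (norm w)\<^sup>2" using eta s0 by (intro mult_right_mono) auto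
    finally have "s / 2 * (norm w)\<^sup>2 \<le> lr k * (norm w)\<^sup>2" using q1 q2 nw by simp
    moreover have "0 < norm w" using x0 PT_le[of w] Pw' by linarith
    ultimately show ?thesis by (simp add: mult_le_cancel_right_pos)
  qed
  fix k assume k: "k < K"
  have uV: "uh k \<in> V n" by (simp add: uh_def)
  have nu: "norm (uh k) = 1" by (rule orthonormal_norm[OF onuh k])
  have Ru: "lr k *\<^sub>R uh k = J (J' (T (uh k)))"
  proof -
    have "J (mv m m C (Uc k)) = lr k *\<^sub>R J (Uc k)" using eigU[OF k] by (simp add: is_eig_def J.scaleR)
    then show ?thesis unfolding uhJ Cy by simp
  qed
  have contr: "norm (J (J' x)) \<le> norm x" for x
    unfolding JJ' using orthonormal_norm_sum[OF onc, of "\<lambda>a. inner x (c a)"] bessel[OF onc, of x]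
    by (metis (no_types, lifting) norm_ge_zero power2_le_imp_le)
  interpret PT: linear PT by (rule linear_PT)
  define g where "g = T (uh k) - Ts (uh k)"
  define p where "p = Ts (uh k)"
  have PTp: "PT p = p" unfolding p_def by (rule PT_Ts[OF uV])
  have np: "norm p \<le> S" unfolding p_def using upper[OF uV] nu by simp
  have ng: "norm g \<le> eta * s" unfolding g_def using pert[OF uV] nu by simp
  have dec: "lr k *\<^sub>R uh k = J (J' g) + J (J' p)"
    unfolding Ru J.add[symmetric] J'.add[symmetric] by (simp add: g_def p_def)
  \<comment> \<open>Subtracting the projection removes \<open>p\<close>, so only the noise
    \<open>g\<close> and the defect \<open>J (J' p) - p\<close> remain.\<close>
  have split: "lr k *\<^sub>R (uh k - PT (uh k)) = (J (J' g) - PT (J (J' g))) + ((J (J' p) - p) - PT (J (J' p) - p))"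
  proof -
    have "lr k *\<^sub>R (uh k - PT (uh k)) = lr k *\<^sub>R uh k - PT (lr k *\<^sub>R uh k)" by (simp add: scaleR_diff_right PT.scaleR)
    then show ?thesis unfolding dec by (simp add: PT.add PT.diff PTp)
  qed
  have "norm (lr k *\<^sub>R (uh k - PT (uh k))) \<le> norm (J (J' g)) + norm (J (J' p) - p)"
    unfolding split using norm_triangle_ineq[of "J (J' g) - PT (J (J' g))" "(J (J' p) - p) - PT (J (J' p) - p)"]
      PT_residual_le[of "J (J' g)"] PT_residual_le[of "J (J' p) - p"] by linarith
  also have "norm (J (J' g)) \<le> eta * s" using contr[of g] ng by linarith
  also have "norm (J (J' p) - p) \<le> de * norm p" using near[OF PTp] by (simp add: JJ' c_def norm_minus_commute)
  also have "de * norm p \<le> de * S" using np de by (intro mult_left_mono) auto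
  finally have "lr k * norm (uh k - PT (uh k)) \<le> eta * s + de * S"
    using lr_ge[OF k] s0 by simp
  moreover have "s / 2 * norm (uh k - PT (uh k)) \<le> lr k * norm (uh k - PT (uh k))"
    using lr_ge[OF k] by (intro mult_right_mono) auto
  ultimately show "norm (uh k - PT (uh k)) \<le> 2 * (de * S / s + eta)"
    using s0 by (simp add: field_simps)
qed

end

section \<open>Recovery by k-means\<close>

text \<open>A misplaced node can alter only its own row, and a row has \<open>K\<close>
  entries.\<close>

lemma misclass_rate_le:
  assumes sg: "sg permutes {..<K}" and B: "finite B" "\<And>i. i < n \<Longrightarrow> i \<notin> B \<Longrightarrow> sg (h i) = g i"
    and h: "\<And>i. i < n \<Longrightarrow> h i < K"
  shows "misclass_rate n K (membership g) (membership h) \<le> real K * real (card B) / real n"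
proof -
  let ?D = "{(i,k). i < n \<and> k < K \<and> mmult K (membership h) (perm_matrix sg) i k \<noteq> membership g i k}"
  have mm: "mmult K (membership h) (perm_matrix sg) i k = (if sg (h i) = k then 1 else 0)" if "i < n" for i k
  proof -
    have "mmult K (membership h) (perm_matrix sg) i k = (\<Sum>j<K. if j = h i then (if sg j = k then 1 else 0) else 0)"
      unfolding mmult_def by (rule sum.cong) (auto simp: membership_def perm_matrix_def)
    then show ?thesis using h[OF that] by simp
  qed
  have "?D \<subseteq> B \<times> {..<K}"
  proof (clarify)
    fix i k assume *: "i < n" "k < K" "mmult K (membership h) (perm_matrix sg) i k \<noteq> membership g i k"
    have "i \<in> B"
    proof (rule ccontr)
      assume "i \<notin> B"
      then show False using *(3) B(2)[OF *(1)] unfolding mm[OF *(1)] by (simp add: membership_def split: if_splits)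
    qed
    then show "i \<in> B \<and> k \<in> {..<K}" using * by auto
  qed
  then have "card ?D \<le> card (B \<times> {..<K})" by (rule card_mono[rotated]) (use B in auto)
  then have "real (card ?D) \<le> real (card (B \<times> {..<K}))" by (rule of_nat_mono)
  also have "\<dots> = real K * real (card B)" by (simp add: card_cartesian_product)
  finally have D: "real (card ?D) \<le> real K * real (card B)" .
  have "misclass_rate n K (membership g) (membership h) \<le> real (card ?D) / real n"
    unfolding misclass_rate_def by (rule Min_le) (use sg in \<open>auto simp: finite_permutations\<close>)
  also have "\<dots> \<le> real K * real (card B) / real n" using D by (rule divide_right_mono) simp
  finally show ?thesis .
qed

lemma misclass_rate_trivial:
  assumes "1 \<le> n" "\<And>i. i < n \<Longrightarrow> h i < K"
  shows "misclass_rate n K (membership g) (membership h) \<le> real K"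
  using misclass_rate_le[of id K "{..<n}" n h g] assms by (simp add: permutes_id)

section \<open>Community indicators and the separation of centroids\<close>

definition comm_vec :: "nat \<Rightarrow> (nat \<Rightarrow> nat) \<Rightarrow> nat \<Rightarrow> fvec" where
  "comm_vec n g k = mkv n (\<lambda>i. if g i = k then 1 / sqrt (real (comm_size n g k)) else 0)"

lemma sum_comm: "(\<Sum>i<n. if g i = k then c else 0) = real (comm_size n g k) * c"
proof -
  have "(\<Sum>i<n. if g i = k then c else 0) = (\<Sum>i\<in>{i. i < n \<and> g i = k}. c)"
    by (rule sum.mono_neutral_cong_right) auto
  then show ?thesis by (simp add: comm_size_def)
qed

lemma orthonormal_comm_vec:
  assumes "\<And>k. k < K \<Longrightarrow> 0 < comm_size n g k"
  shows "orthonormal K (comm_vec n g)"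
  unfolding orthonormal_def
proof (intro allI impI)
  fix i j assume ij: "i < K" "j < K"
  have "inner (comm_vec n g i) (comm_vec n g j) =
    (\<Sum>x<n. if g x = i then (if i = j then 1 / real (comm_size n g i) else 0) else 0)"
    unfolding comm_vec_def inner_V[OF mkv_in_V] by (rule sum.cong) (auto simp: real_sqrt_mult[symmetric])
  also have "\<dots> = (if i = j then 1 else 0)"
    unfolding sum_comm using assms[OF ij(1)] by auto
  finally show "inner (comm_vec n g i) (comm_vec n g j) = (if i = j then 1 else 0)" .
qed

text \<open>Bessel's inequality is applied to a rotated copy of the pair \<open>t j\<close>, \<open>t j'\<close>.\<close>
lemma centroid_separation:
  assumes ont: "orthonormal K t" and onu: "orthonormal K uh"
    and near: "\<And>k. k < K \<Longrightarrow> (norm (uh k - (\<Sum>j<K. inner (uh k) (t j) *\<^sub>R t j)))\<^sup>2 \<le> e"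
    and j: "j < K" "j' < K" "j \<noteq> j'"
  shows "(1 - real K * e) * (a\<^sup>2 + b\<^sup>2) \<le> (\<Sum>k<K. (a * inner (uh k) (t j) - b * inner (uh k) (t j'))\<^sup>2)"
proof -
  define q where "q i = (\<Sum>k<K. (inner (uh k) (t i))\<^sup>2)" for i
  have q1: "q i \<le> 1" if "i < K" for i
    using bessel[OF onu, of "t i"] orthonormal_norm[OF ont that] by (simp add: q_def inner_commute)
  have "(\<Sum>i<K. q i) = (\<Sum>k<K. \<Sum>i<K. (inner (uh k) (t i))\<^sup>2)"
    unfolding q_def by (rule sum.swap)
  also have "\<dots> \<ge> (\<Sum>k<K. 1 - e)"
  proof (rule sum_mono)
    fix k assume "k \<in> {..<K}"
    then have k: "k < K" by simp
    show "1 - e \<le> (\<Sum>i<K. (inner (uh k) (t i))\<^sup>2)"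
      using orthonormal_pythagoras[OF ont, of "uh k"] near[OF k] orthonormal_norm[OF onu k] by simp
  qed
  finally have tot: "real K - real K * e \<le> (\<Sum>i<K. q i)" by (simp add: algebra_simps)
  \<comment> \<open>No \<open>q i\<close> exceeds 1 while their total is at least
    \<open>K - K * e\<close>; hence the two selected ones fall short of 2 by at most
    \<open>K * e\<close> together.\<close>
  have "(\<Sum>i<K. q i) = (\<Sum>i\<in>{..<K}-{j,j'}. q i) + (q j + q j')"
    using j by (subst sum.subset_diff[of "{j,j'}"]) auto
  also have "(\<Sum>i\<in>{..<K}-{j,j'}. q i) \<le> (\<Sum>i\<in>{..<K}-{j,j'}. 1)"
    by (intro sum_mono q1) auto
  also have "(\<Sum>i\<in>{..<K}-{j,j'}. 1) = real K - 2"
  proof -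
    have "card ({..<K}-{j,j'}) = K - 2" using j by (subst card_Diff_subset) auto
    moreover have "2 \<le> K" using j by linarith
    ultimately show ?thesis by simp
  qed
  finally have qq: "2 - real K * e \<le> q j + q j'" using tot by linarith
  have jj: "inner (t j) (t j) = 1" "inner (t j') (t j') = 1" "inner (t j) (t j') = 0" "inner (t j') (t j) = 0"
    using ont j by (auto simp: orthonormal_def)
  have "(\<Sum>k<K. (b * inner (uh k) (t j) + a * inner (uh k) (t j'))\<^sup>2) = (\<Sum>k<K. (inner (b *\<^sub>R t j + a *\<^sub>R t j') (uh k))\<^sup>2)"
    by (rule sum.cong) (auto simp: inner_add_left inner_commute[of "uh _"])
  also have "\<dots> \<le> (norm (b *\<^sub>R t j + a *\<^sub>R t j'))\<^sup>2" by (rule bessel[OF onu])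
  also have "\<dots> = a\<^sup>2 + b\<^sup>2"
    unfolding power2_norm_eq_inner by (simp add: inner_add_left inner_add_right jj power2_eq_square)
  finally have rot: "(\<Sum>k<K. (b * inner (uh k) (t j) + a * inner (uh k) (t j'))\<^sup>2) \<le> a\<^sup>2 + b\<^sup>2" .
  \<comment> \<open>The two rotated combinations share the total
    \<open>(a^2 + b^2) * (q j + q j')\<close>, so the upper bound for one is a lower bound for the
    other.\<close>
  have "(\<Sum>k<K. (a * inner (uh k) (t j) - b * inner (uh k) (t j'))\<^sup>2) + (\<Sum>k<K. (b * inner (uh k) (t j) + a * inner (uh k) (t j'))\<^sup>2)
     = (a\<^sup>2 + b\<^sup>2) * (q j + q j')"
    unfolding q_def sum.distrib[symmetric] sum_distrib_left
    by (rule sum.cong) (auto simp: power2_eq_square algebra_simps)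
  moreover have "(a\<^sup>2 + b\<^sup>2) * (2 - real K * e) \<le> (a\<^sup>2 + b\<^sup>2) * (q j + q j')"
    using qq by (intro mult_left_mono) auto
  ultimately show ?thesis using rot by (simp add: algebra_simps)
qed

lemma sum_square_triangle:
  fixes x y z :: "nat \<Rightarrow> real"
  shows "(\<Sum>k<K. (x k - z k)\<^sup>2) \<le> 2 * (\<Sum>k<K. (x k - y k)\<^sup>2) + 2 * (\<Sum>k<K. (y k - z k)\<^sup>2)"
proof -
  have "(p - r)\<^sup>2 \<le> 2 * (p - q)\<^sup>2 + 2 * (q - r)\<^sup>2" for p q r :: real
    using zero_le_power2[of "(p - q) - (q - r)"] by (simp add: power2_eq_square algebra_simps)
  then show ?thesis unfolding sum_distrib_left sum.distrib[symmetric] by (intro sum_mono)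
qed

text \<open>The true labels with the projected centroids \<open>X\<close> cost at most
  \<open>K * e\<close>, and an optimal clustering costs no more; therefore few nodes receive a
  centre far from their own centroid. Outside this set \<open>B\<close> equal labels force equal
  communities, and since every community keeps a node outside \<open>B\<close>, labels and
  communities correspond through a permutation.\<close>

lemma kmeans_recovery:
  assumes g: "\<And>i. i < n \<Longrightarrow> g i < K" and n1: "1 \<le> n"
    and size: "\<And>k. k < K \<Longrightarrow> 0 < comm_size n g k" "\<And>k. k < K \<Longrightarrow> real (comm_size n g k) \<le> Nmax"
    and U: "\<And>i k. i < n \<Longrightarrow> k < K \<Longrightarrow> U i k = crd (uh k) i" "\<And>k. k < K \<Longrightarrow> uh k \<in> V n"
    and onu: "orthonormal K uh"
    and near: "\<And>k. k < K \<Longrightarrow> (norm (uh k - (\<Sum>j<K. inner (uh k) (comm_vec n g j) *\<^sub>R comm_vec n g j)))\<^sup>2 \<le> e"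
    and e: "real K * e \<le> 1 / 2" "\<And>k. k < K \<Longrightarrow> 16 * real K * Nmax * e < real (comm_size n g k)"
    and km: "kmeans_opt n K U h"
  shows "misclass_rate n K (membership g) (membership h) \<le> 16 * (real K)\<^sup>2 * Nmax * e / real n"
proof -
  define N where "N k = real (comm_size n g k)" for k
  have N0: "0 < N k" if "k < K" for k using size(1)[OF that] by (simp add: N_def)
  define t where "t = comm_vec n g"
  have ont: "orthonormal K t" unfolding t_def by (rule orthonormal_comm_vec[OF size(1)])
  define X where "X j k = inner (uh k) (t j) / sqrt (N j)" for j k
  have K0: "0 < K" using g[of 0] n1 by auto
  have Nm: "0 < Nmax" using size(2)[OF K0] N0[OF K0] by (simp add: N_def)
  have costX: "kmeans_cost n K U g X \<le> real K * e"
  proof -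
    have "kmeans_cost n K U g X = (\<Sum>k<K. \<Sum>i<n. (U i k - X (g i) k)\<^sup>2)"
      unfolding kmeans_cost_def by (rule sum.swap)
    also have "\<dots> \<le> (\<Sum>k<K. e)"
    proof (rule sum_mono)
      fix k assume "k \<in> {..<K}"
      then have k: "k < K" by simp
      define r where "r = uh k - (\<Sum>j<K. inner (uh k) (t j) *\<^sub>R t j)"
      have tV: "t j \<in> V n" for j by (simp add: t_def comm_vec_def)
      have rV: "r \<in> V n" unfolding r_def by (intro V_simps U(2) V_sum tV k)
      have "crd r i = U i k - X (g i) k" if i: "i < n" for i
      proof -
        have "(\<Sum>j<K. inner (uh k) (t j) * crd (t j) i) = (\<Sum>j<K. if j = g i then inner (uh k) (t j) / sqrt (N j) else 0)"
          by (rule sum.cong) (use i in \<open>auto simp: t_def comm_vec_def N_def\<close>)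
        then show ?thesis using g[OF i] by (simp add: r_def U(1)[OF i k] X_def)
      qed
      then have "(\<Sum>i<n. (U i k - X (g i) k)\<^sup>2) = (norm r)\<^sup>2" by (simp add: norm_V[OF rV])
      then show "(\<Sum>i<n. (U i k - X (g i) k)\<^sup>2) \<le> e" using near[OF k] by (simp add: r_def t_def)
    qed
    finally show ?thesis by simp
  qed
  obtain z where z: "\<And>h' z'. (\<forall>i<n. h' i < K) \<Longrightarrow> kmeans_cost n K U h z \<le> kmeans_cost n K U h' z'"
    and hK: "\<And>i. i < n \<Longrightarrow> h i < K"
    using km unfolding kmeans_opt_def by blast
  have costz: "kmeans_cost n K U h z \<le> real K * e" using z[of g X] g costX by fastforce
  define d where "d i = (\<Sum>k<K. (X (g i) k - z (h i) k)\<^sup>2)" for i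
  have "(\<Sum>i<n. d i) \<le> (\<Sum>i<n. 2 * (\<Sum>k<K. (X (g i) k - U i k)\<^sup>2) + 2 * (\<Sum>k<K. (U i k - z (h i) k)\<^sup>2))"
    unfolding d_def by (intro sum_mono sum_square_triangle)
  also have "\<dots> = 2 * kmeans_cost n K U g X + 2 * kmeans_cost n K U h z"
    unfolding kmeans_cost_def by (simp add: sum.distrib sum_distrib_left power2_commute[of "X _ _"])
  finally have dsum: "(\<Sum>i<n. d i) \<le> 4 * (real K * e)" using costX costz by linarith
  have d0: "0 \<le> d i" for i unfolding d_def by (intro sum_nonneg) auto
  \<comment> \<open>Two nodes outside \<open>B\<close> with the same label have centroids at squared
    distance below \<open>1 / Nmax\<close>, which separation excludes when \<open>K * e\<close> is
    at most \<open>1 / 2\<close> and the communities differ.\<close>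
  define B where "B = {i. i < n \<and> 1 / (4 * Nmax) \<le> d i}"
  have finB: "finite B" by (simp add: B_def)
  have "real (card B) * (1 / (4 * Nmax)) = (\<Sum>i\<in>B. 1 / (4 * Nmax))" by simp
  also have "\<dots> \<le> (\<Sum>i\<in>B. d i)" by (intro sum_mono) (auto simp: B_def)
  also have "\<dots> \<le> (\<Sum>i<n. d i)" by (intro sum_mono2) (auto simp: B_def d0)
  also have "\<dots> \<le> 4 * (real K * e)" by (rule dsum)
  finally have cardB: "real (card B) \<le> 16 * real K * Nmax * e" using Nm by (simp add: field_simps)
  have sep: "g i = g i'" if i: "i < n" "i' < n" "i \<notin> B" "i' \<notin> B" "h i = h i'" for i i'
  proof (rule ccontr)
    assume ne: "g i \<noteq> g i'"
    have gi: "g i < K" "g i' < K" using i g by auto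
    have "(1 - real K * e) * ((1 / sqrt (N (g i)))\<^sup>2 + (1 / sqrt (N (g i')))\<^sup>2) \<le>
      (\<Sum>k<K. (1 / sqrt (N (g i)) * inner (uh k) (t (g i)) - 1 / sqrt (N (g i')) * inner (uh k) (t (g i')))\<^sup>2)"
      by (rule centroid_separation[OF ont onu _ gi ne]) (use near in \<open>simp add: t_def\<close>)
    also have "\<dots> = (\<Sum>k<K. (X (g i) k - X (g i') k)\<^sup>2)" by (simp add: X_def)
    also have "\<dots> \<le> 2 * (\<Sum>k<K. (X (g i) k - z (h i) k)\<^sup>2) + 2 * (\<Sum>k<K. (z (h i) k - X (g i') k)\<^sup>2)"
      by (rule sum_square_triangle)
    also have "\<dots> = 2 * d i + 2 * d i'" unfolding d_def using i(5) by (simp add: power2_commute[of "z _ _"])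
    also have "\<dots> < 2 * (1 / (4 * Nmax)) + 2 * (1 / (4 * Nmax))"
      using i by (intro add_strict_mono mult_strict_left_mono) (auto simp: B_def)
    finally have lt: "(1 - real K * e) * (1 / N (g i) + 1 / N (g i')) < 1 / Nmax"
      using N0 gi by (simp add: power_divide less_imp_le)
    have "1 / Nmax \<le> 1 / N (g i)" "1 / Nmax \<le> 1 / N (g i')"
      using size(2) gi N0 by (auto intro!: divide_left_mono mult_pos_pos simp: N_def Nm)
    then have "1 / 2 * (2 * (1 / Nmax)) \<le> (1 - real K * e) * (1 / N (g i) + 1 / N (g i'))"
      using e(1) Nm by (intro mult_mono) auto
    with lt show False by simp
  qed
  have "\<exists>i. i < n \<and> i \<notin> B \<and> g i = k" if k: "k < K" for k
  proof (rule ccontr)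
    assume "\<not> ?thesis"
    then have "{i. i < n \<and> g i = k} \<subseteq> B" by auto
    then have "comm_size n g k \<le> card B" unfolding comm_size_def by (rule card_mono[OF finB])
    then show False using cardB e(2)[OF k] by linarith
  qed
  then obtain rep where rep: "\<And>k. k < K \<Longrightarrow> rep k < n \<and> rep k \<notin> B \<and> g (rep k) = k" by metis
  \<comment> \<open>The identity outside the label range, as \<open>permutes\<close>
    demands.\<close>
  define p where "p k = (if k < K then h (rep k) else k)" for k
  have inj: "inj_on p {..<K}"
    by (rule inj_onI) (use sep rep in \<open>auto simp: p_def\<close>, metis)
  have img: "p ` {..<K} \<subseteq> {..<K}" using hK rep by (auto simp: p_def)
  have bij: "bij_betw p {..<K} {..<K}"
    using inj img by (metis bij_betw_def card_image card_subset_eq finite_lessThan)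
  have perm: "p permutes {..<K}" by (rule bij_imp_permutes[OF bij]) (simp add: p_def)
  have good: "h i = p (g i)" if i: "i < n" "i \<notin> B" for i
  proof -
    have "h i \<in> p ` {..<K}" using hK[OF i(1)] bij by (simp add: bij_betw_def)
    then obtain k where k: "k < K" "h i = p k" by auto
    then have "g i = k" using sep[of i "rep k"] rep[OF k(1)] i by (simp add: p_def)
    then show ?thesis using k by simp
  qed
  have "misclass_rate n K (membership g) (membership h) \<le> real K * real (card B) / real n"
  proof (rule misclass_rate_le[OF permutes_inv[OF perm] finB])
    fix i assume "i < n" "i \<notin> B"
    then show "inv p (h i) = g i" using good permutes_inj[OF perm] by simp
  qed (rule hK)
  also have "\<dots> \<le> real K * (16 * real K * Nmax * e) / real n"
    using cardB by (intro divide_right_mono mult_left_mono) auto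
  finally show ?thesis by (simp add: power2_eq_square mult_ac)
qed

section \<open>Conditioning of the Gaussian test matrix\<close>

abbreviation stdN :: "real measure" where "stdN \<equiv> density lborel std_normal_density"

interpretation stdN: prob_space stdN by (rule prob_space_normal_density) simp

interpretation PN: product_sigma_finite "\<lambda>_ :: nat \<times> nat. stdN"
  by standard

lemma prob_space_PiM_stdN: "prob_space (PiM I (\<lambda>_ :: nat \<times> nat. stdN))"
  by (rule prob_space_PiM) (rule stdN.prob_space_axioms)

lemma stdN_interval:
  assumes a: "a \<noteq> 0" and tau: "0 < tau"
  shows "emeasure stdN {x. \<bar>a * x + c\<bar> < tau} \<le> ennreal (tau / \<bar>a\<bar>)"
proof -
  define A where "A = {(- c / a) - tau / \<bar>a\<bar> .. (- c / a) + tau / \<bar>a\<bar>}"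
  have sub: "{x. \<bar>a * x + c\<bar> < tau} \<subseteq> A"
  proof
    fix x assume "x \<in> {x. \<bar>a * x + c\<bar> < tau}"
    then have "\<bar>a\<bar> * \<bar>x + c / a\<bar> < tau" using a by (simp add: abs_mult[symmetric] distrib_left)
    then have "\<bar>x + c / a\<bar> < tau / \<bar>a\<bar>" using a by (simp add: field_simps)
    then show "x \<in> A" unfolding A_def by auto
  qed
  have dens: "std_normal_density x \<le> 1 / 2" for x
  proof -
    have "2 \<le> sqrt (2 * pi)" by (rule real_le_rsqrt) (use pi_ge_two in simp)
    then have "1 / sqrt (2 * pi) \<le> 1 / 2" by (intro divide_left_mono) auto
    moreover have "exp (- x\<^sup>2 / 2) \<le> 1" by simp
    ultimately have "1 / sqrt (2 * pi) * exp (- x\<^sup>2 / 2) \<le> 1 / 2 * 1" by (intro mult_mono) auto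
    then show ?thesis by (simp add: std_normal_density_def)
  qed
  have "emeasure stdN {x. \<bar>a * x + c\<bar> < tau} \<le> emeasure stdN A"
    by (rule emeasure_mono[OF sub]) (simp add: A_def)
  also have "\<dots> = (\<integral>\<^sup>+ x. ennreal (std_normal_density x) * indicator A x \<partial>lborel)"
    by (subst emeasure_density) (auto simp: A_def)
  also have "\<dots> \<le> (\<integral>\<^sup>+ x. ennreal (1 / 2) * indicator A x \<partial>lborel)"
    by (intro nn_integral_mono mult_right_mono ennreal_leI dens) auto
  also have "\<dots> = ennreal (1 / 2) * emeasure lborel A"
    by (rule nn_integral_cmult_indicator) (simp add: A_def)
  also have "emeasure lborel A = ennreal (2 * (tau / \<bar>a\<bar>))"
    unfolding A_def using tau by (subst emeasure_lborel_Icc) auto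
  also have "ennreal (1 / 2) * \<dots> = ennreal (tau / \<bar>a\<bar>)"
    using tau by (subst ennreal_mult[symmetric]) auto
  finally show ?thesis .
qed

text \<open>Conditionally on the other coordinates the sum is affine in coordinate
  \<open>i0\<close>, and the Gaussian density is bounded.\<close>

lemma gaussian_sum_small_ball:
  fixes I :: "(nat \<times> nat) set"
  assumes fin: "finite I" and i0: "i0 \<in> I" and al: "0 < al" "al \<le> \<bar>a i0\<bar>" and tau: "0 < tau"
  shows "emeasure (PiM I (\<lambda>_. stdN)) {w \<in> space (PiM I (\<lambda>_. stdN)). \<bar>\<Sum>i\<in>I. a i * w i\<bar> < tau} \<le> ennreal (tau / al)"
proof -
  define J where "J = I - {i0}"
  have J: "finite J" "i0 \<notin> J" "I = insert i0 J" using fin i0 by (auto simp: J_def)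
  let ?P = "PiM (insert i0 J) (\<lambda>_. stdN)"
  let ?B = "{w \<in> space ?P. \<bar>\<Sum>i\<in>insert i0 J. a i * w i\<bar> < tau}"
  have [measurable]: "(\<lambda>w. \<Sum>i\<in>insert i0 J. a i * w i) \<in> borel_measurable ?P"
    by (intro borel_measurable_sum borel_measurable_times borel_measurable_const) 
       (use measurable_component_singleton[of _ "insert i0 J" "\<lambda>_. stdN"] in simp)
  have B: "?B \<in> sets ?P" by measurable
  have "emeasure ?P ?B = (\<integral>\<^sup>+ w. indicator ?B w \<partial>?P)" using B by simp
  also have "\<dots> = (\<integral>\<^sup>+ x. (\<integral>\<^sup>+ y. indicator ?B (x(i0 := y)) \<partial>stdN) \<partial>PiM J (\<lambda>_. stdN))"
    by (rule PN.product_nn_integral_insert[OF J(1,2)]) (use B in simp)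
  also have "\<dots> \<le> (\<integral>\<^sup>+ x. ennreal (tau / al) \<partial>PiM J (\<lambda>_. stdN))"
  proof (rule nn_integral_mono)
    fix x assume "x \<in> space (PiM J (\<lambda>_. stdN))"
    define c where "c = (\<Sum>i\<in>J. a i * x i)"
    have "(\<integral>\<^sup>+ y. indicator ?B (x(i0 := y)) \<partial>stdN) \<le> (\<integral>\<^sup>+ y. indicator {y. \<bar>a i0 * y + c\<bar> < tau} y \<partial>stdN)"
    proof (rule nn_integral_mono)
      fix y
      have "(\<Sum>i\<in>insert i0 J. a i * (x(i0 := y)) i) = a i0 * y + c"
        using J by (simp add: c_def) (rule sum.cong, auto)
      then show "indicator ?B (x(i0 := y)) \<le> (indicator {y. \<bar>a i0 * y + c\<bar> < tau} y :: ennreal)"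
        by (auto simp: indicator_def)
    qed
    also have "\<dots> = emeasure stdN {y. \<bar>a i0 * y + c\<bar> < tau}" by (rule nn_integral_indicator) simp
    also have "\<dots> \<le> ennreal (tau / \<bar>a i0\<bar>)" by (rule stdN_interval) (use al tau in auto)
    also have "\<dots> \<le> ennreal (tau / al)" using al tau by (intro ennreal_leI divide_left_mono) auto
    finally show "(\<integral>\<^sup>+ y. indicator ?B (x(i0 := y)) \<partial>stdN) \<le> ennreal (tau / al)" .
  qed
  also have "\<dots> = ennreal (tau / al)"
    using prob_space.emeasure_space_1[OF prob_space_PiM_stdN, of J] by simp
  finally show ?thesis unfolding J(3) .
qed

section \<open>Smallest singular value of the projected test matrix\<close>

definition gcoef :: "nat \<Rightarrow> (nat \<Rightarrow> fvec) \<Rightarrow> (nat \<times> nat \<Rightarrow> real) \<Rightarrow> nat \<Rightarrow> nat \<Rightarrow> real" where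
  "gcoef n v W j k = (\<Sum>i<n. crd (v j) i * W (i,k))"

lemma gcoef_inner: "v j \<in> V n \<Longrightarrow> gcoef n v W j k = inner (v j) (mkv n (\<lambda>i. W (i,k)))"
  by (simp add: gcoef_def inner_V)

text \<open>Minimised over \<open>b\<close>, this is the squared distance of the \<open>k\<close>-th
  projected column from the span of the others.\<close>

definition colcomb :: "nat \<Rightarrow> nat \<Rightarrow> (nat \<Rightarrow> fvec) \<Rightarrow> (nat \<Rightarrow> real) \<Rightarrow> nat \<Rightarrow> (nat \<times> nat \<Rightarrow> real) \<Rightarrow> real" where
  "colcomb n K v b k W = (\<Sum>j<K. (\<Sum>k'<K. (if k' = k then 1 else b k') * gcoef n v W j k')\<^sup>2)"

text \<open>Rational coefficients suffice by density and keep the event measurable.\<close>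
definition badcol :: "nat \<Rightarrow> nat \<Rightarrow> (nat \<Rightarrow> fvec) \<Rightarrow> real \<Rightarrow> nat \<Rightarrow> (nat \<times> nat \<Rightarrow> real) set" where
  "badcol n K v tau k = (\<Union>b\<in>PiE {..<K} (\<lambda>_. \<rat>).
     {W \<in> space (gaussian_measure n K). colcomb n K v b k W < tau\<^sup>2})"

lemma measurable_gcoef: 
  assumes "k < K"
  shows "(\<lambda>W. gcoef n v W j k) \<in> borel_measurable (gaussian_measure n K)"
  unfolding gcoef_def gaussian_measure_def
  by (intro borel_measurable_sum borel_measurable_times borel_measurable_const)
     (use measurable_component_singleton[of _ "{..<n} \<times> {..<K}" "\<lambda>_. stdN"] assms in simp)

lemma badcol_sets: "badcol n K v tau k \<in> sets (gaussian_measure n K)"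
  unfolding badcol_def
proof (rule sets.countable_UN'')
  show "countable (PiE {..<K} (\<lambda>_. \<rat> :: real set))" by (rule countable_PiE) (auto simp: countable_rat)
  fix b
  have [measurable]: "colcomb n K v b k \<in> borel_measurable (gaussian_measure n K)"
    unfolding colcomb_def[abs_def]
    by (intro borel_measurable_sum borel_measurable_power borel_measurable_times borel_measurable_const measurable_gcoef) auto
  show "{W \<in> space (gaussian_measure n K). colcomb n K v b k W < tau\<^sup>2} \<in> sets (gaussian_measure n K)"
    by measurable
qed

text \<open>In \<open>K\<close> dimensions there is a unit vector \<open>a\<close> orthogonal to all
  the other projected columns. Pairing with \<open>a\<close> bounds the distance from below for all
  coefficients \<open>b\<close> at once, so the union over \<open>b\<close> costs nothing. What
  remains is a linear form in the \<open>k\<close>-th column, one of whose coefficients is at least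
  \<open>1 / sqrt n\<close> in modulus.\<close>

lemma badcol_prob:
  assumes v: "orthonormal K v" "\<And>j. j < K \<Longrightarrow> v j \<in> V n" and k: "k < K" and n1: "1 \<le> n" and tau: "0 < tau"
  shows "emeasure (gaussian_measure n K) (badcol n K v tau k) \<le> ennreal (tau * sqrt (real n))"
proof -
  define I where "I = {..<n} \<times> {k}"
  define J where "J = {..<n} \<times> ({..<K} - {k})"
  have IJ: "J \<inter> I = {}" "finite J" "finite I" "J \<union> I = {..<n} \<times> {..<K}" using k by (auto simp: I_def J_def)
  let ?B = "badcol n K v tau k"
  have G: "gaussian_measure n K = PiM (J \<union> I) (\<lambda>_. stdN)" by (simp add: gaussian_measure_def IJ)
  have B: "?B \<in> sets (PiM (J \<union> I) (\<lambda>_. stdN))" using badcol_sets[of n K v tau k] by (simp only: G)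
  have "emeasure (PiM (J \<union> I) (\<lambda>_. stdN)) ?B = (\<integral>\<^sup>+ w. indicator ?B w \<partial>PiM (J \<union> I) (\<lambda>_. stdN))" using B by simp
  also have "\<dots> = (\<integral>\<^sup>+ x. (\<integral>\<^sup>+ y. indicator ?B (merge J I (x, y)) \<partial>PiM I (\<lambda>_. stdN)) \<partial>PiM J (\<lambda>_. stdN))"
    by (rule PN.product_nn_integral_fold[OF IJ(1-3)]) (use B in simp)
  also have "\<dots> \<le> (\<integral>\<^sup>+ x. ennreal (tau * sqrt (real n)) \<partial>PiM J (\<lambda>_. stdN))"
  proof (rule nn_integral_mono)
    fix x
    obtain a0 where a0: "\<exists>j\<in>{..<K}. a0 j \<noteq> 0" "\<forall>k'\<in>{..<K}-{k}. (\<Sum>j<K. gcoef n v x j k' * a0 j) = 0"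
      using underdetermined_system[of "{..<K}-{k}" "{..<K}" "\<lambda>k' j. gcoef n v x j k'"] k by auto
    define s where "s = sqrt (\<Sum>j<K. (a0 j)\<^sup>2)"
    have "(\<Sum>j<K. (a0 j)\<^sup>2) \<noteq> 0" using a0(1) by (subst sum_nonneg_eq_0_iff) auto
    moreover have "0 \<le> (\<Sum>j<K. (a0 j)\<^sup>2)" by (intro sum_nonneg) auto
    ultimately have s0: "0 < s" unfolding s_def by simp
    define a where "a j = a0 j / s" for j
    have a1: "(\<Sum>j<K. (a j)\<^sup>2) = 1"
      using s0 unfolding a_def power_divide sum_divide_distrib[symmetric] by (simp add: s_def)
    have az: "(\<Sum>j<K. a j * gcoef n v x j k') = 0" if "k' < K" "k' \<noteq> k" for k'
    proof -
      have "(\<Sum>j<K. a j * gcoef n v x j k') = (\<Sum>j<K. gcoef n v x j k' * a0 j) / s"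
        unfolding a_def sum_divide_distrib by (rule sum.cong) auto
      then show ?thesis using a0(2) that by simp
    qed
    define p where "p = (\<Sum>j<K. a j *\<^sub>R v j)"
    have pV: "p \<in> V n" unfolding p_def by (intro V_sum V_simps v) auto
    have "(norm p)\<^sup>2 = 1" unfolding p_def orthonormal_norm_sum[OF v(1)] by (rule a1)
    then have psum: "(\<Sum>i<n. (crd p i)\<^sup>2) = 1" by (simp add: norm_V[OF pV])
    have "\<exists>i0<n. 1 / sqrt (real n) \<le> \<bar>crd p i0\<bar>"
    proof (rule ccontr)
      assume "\<not> ?thesis"
      then have lt: "\<bar>crd p i\<bar> < 1 / sqrt (real n)" if "i < n" for i using that by (meson not_le)
      have "(\<Sum>i<n. (crd p i)\<^sup>2) < (\<Sum>i<n. (1 / sqrt (real n))\<^sup>2)"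
      proof (rule sum_strict_mono)
        fix i assume "i \<in> {..<n}"
        then have "\<bar>crd p i\<bar>\<^sup>2 < (1 / sqrt (real n))\<^sup>2" using lt by (intro power_strict_mono) auto
        then show "(crd p i)\<^sup>2 < (1 / sqrt (real n))\<^sup>2" by simp
      qed (use n1 in \<open>auto simp: lessThan_empty_iff\<close>)
      also have "\<dots> = 1" using n1 by (simp add: power_divide)
      finally show False using psum by simp
    qed
    then obtain i0 where i0: "i0 < n" "1 / sqrt (real n) \<le> \<bar>crd p i0\<bar>" by blast
    let ?S = "{y \<in> space (PiM I (\<lambda>_. stdN)). \<bar>\<Sum>q\<in>I. crd p (fst q) * y q\<bar> < tau}"
    have [measurable]: "(\<lambda>y. \<Sum>q\<in>I. crd p (fst q) * y q) \<in> borel_measurable (PiM I (\<lambda>_. stdN))"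
      by (intro borel_measurable_sum borel_measurable_times borel_measurable_const)
         (use measurable_component_singleton[of _ I "\<lambda>_. stdN"] in simp)
    have S: "?S \<in> sets (PiM I (\<lambda>_. stdN))" by measurable
    have "(\<integral>\<^sup>+ y. indicator ?B (merge J I (x, y)) \<partial>PiM I (\<lambda>_. stdN)) \<le> (\<integral>\<^sup>+ y. indicator ?S y \<partial>PiM I (\<lambda>_. stdN))"
    proof (rule nn_integral_mono)
      fix y assume y: "y \<in> space (PiM I (\<lambda>_. stdN))"
      let ?W = "merge J I (x, y)"
      have "y \<in> ?S" if W: "?W \<in> ?B"
      proof -
        obtain b where b: "colcomb n K v b k ?W < tau\<^sup>2" using W by (auto simp: badcol_def)
        have Gx: "gcoef n v ?W j k' = gcoef n v x j k'" if "k' < K" "k' \<noteq> k" for j k'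
          unfolding gcoef_def by (rule sum.cong) (use that in \<open>auto simp: merge_def J_def I_def\<close>)
        have Gy: "gcoef n v ?W j k = (\<Sum>i<n. crd (v j) i * y (i, k))" for j
          unfolding gcoef_def by (rule sum.cong) (auto simp: merge_def J_def I_def)
        have "(\<Sum>q\<in>I. crd p (fst q) * y q) = (\<Sum>i<n. crd p i * y (i,k))"
          unfolding I_def by (rule sum.reindex_bij_witness[of _ "\<lambda>i. (i,k)" fst]) auto
        also have "\<dots> = (\<Sum>i<n. \<Sum>j<K. a j * (crd (v j) i * y (i,k)))"
          by (simp add: p_def sum_distrib_right mult.assoc)
        also have "\<dots> = (\<Sum>j<K. \<Sum>i<n. a j * (crd (v j) i * y (i,k)))" by (rule sum.swap)
        also have "\<dots> = (\<Sum>j<K. a j * gcoef n v ?W j k)" by (simp add: Gy sum_distrib_left)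
        also have "\<dots> = (\<Sum>k'<K. (if k' = k then 1 else b k') * (\<Sum>j<K. a j * gcoef n v ?W j k'))"
        proof -
          have "(\<Sum>k'<K. (if k' = k then 1 else b k') * (\<Sum>j<K. a j * gcoef n v ?W j k')) =
            (\<Sum>k'<K. if k' = k then (\<Sum>j<K. a j * gcoef n v ?W j k') else 0)"
            by (rule sum.cong) (auto simp: Gx az)
          then show ?thesis using k by simp
        qed
        also have "\<dots> = (\<Sum>j<K. a j * (\<Sum>k'<K. (if k' = k then 1 else b k') * gcoef n v ?W j k'))"
          unfolding sum_distrib_left by (subst sum.swap) (simp add: mult.left_commute)
        finally have eq: "(\<Sum>q\<in>I. crd p (fst q) * y q) = \<dots>" .
        have "(\<Sum>q\<in>I. crd p (fst q) * y q)\<^sup>2 \<le> (\<Sum>j<K. (a j)\<^sup>2) * colcomb n K v b k ?W"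
          unfolding eq colcomb_def by (rule Cauchy_Schwarz_ineq_sum)
        also have "\<dots> < tau\<^sup>2" using a1 b by simp
        finally have "\<bar>\<Sum>q\<in>I. crd p (fst q) * y q\<bar> < tau" using tau abs_le_square_iff[of tau "\<Sum>q\<in>I. crd p (fst q) * y q"] by linarith
        then show ?thesis using y by simp
      qed
      then show "indicator ?B ?W \<le> (indicator ?S y :: ennreal)" by (auto simp: indicator_def)
    qed
    also have "\<dots> = emeasure (PiM I (\<lambda>_. stdN)) ?S" using S by simp
    also have "\<dots> \<le> ennreal (tau / (1 / sqrt (real n)))"
      by (rule gaussian_sum_small_ball[OF IJ(3), of "(i0,k)"]) (use i0 n1 tau in \<open>auto simp: I_def\<close>)
    finally show "(\<integral>\<^sup>+ y. indicator ?B (merge J I (x, y)) \<partial>PiM I (\<lambda>_. stdN)) \<le> ennreal (tau * sqrt (real n))" by simp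
  qed
  also have "\<dots> = ennreal (tau * sqrt (real n))"
    using prob_space.emeasure_space_1[OF prob_space_PiM_stdN, of J] by simp
  finally show ?thesis by (simp only: G)
qed

lemma not_badcol_real:
  assumes W: "W \<in> space (gaussian_measure n K)" "W \<notin> badcol n K v tau k"
  shows "tau\<^sup>2 \<le> colcomb n K v b k W"
proof (rule ccontr)
  assume "\<not> ?thesis"
  then have lt: "colcomb n K v b k W < tau\<^sup>2" by simp
  \<comment> \<open>Truncation of the coefficients to multiples of \<open>1 / Suc N\<close>.\<close>
  define c where "c N k' = of_int \<lfloor>real (Suc N) * b k'\<rfloor> / real (Suc N)" for N k'
  have conv: "(\<lambda>N. c N k') \<longlonglongrightarrow> b k'" for k'
  proof (rule LIMSEQ_I)
    fix r :: real assume "0 < r"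
    then obtain M where M: "inverse (real (Suc M)) < r" using reals_Archimedean by blast
    have "norm (c N k' - b k') < r" if "M \<le> N" for N
    proof -
      have "\<bar>of_int \<lfloor>real (Suc N) * b k'\<rfloor> - real (Suc N) * b k'\<bar> \<le> 1" by linarith
      then have "\<bar>(of_int \<lfloor>real (Suc N) * b k'\<rfloor> - real (Suc N) * b k') / real (Suc N)\<bar> \<le> 1 / real (Suc N)"
        by (simp add: divide_right_mono)
      then have "\<bar>c N k' - b k'\<bar> \<le> inverse (real (Suc N))" by (simp add: c_def diff_divide_distrib inverse_eq_divide)
      also have "\<dots> \<le> inverse (real (Suc M))" using that by (intro le_imp_inverse_le) auto
      finally show ?thesis using M by simp
    qed
    then show "\<exists>no. \<forall>N\<ge>no. norm (c N k' - b k') < r" by blast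
  qed
  have "(\<lambda>N. colcomb n K v (c N) k W) \<longlonglongrightarrow> colcomb n K v b k W"
    unfolding colcomb_def
  proof (intro tendsto_intros)
    show "(\<lambda>N. if k' = k then 1 else c N k') \<longlonglongrightarrow> (if k' = k then 1 else b k')" for k'
      using conv by (cases "k' = k") auto
  qed
  then have "eventually (\<lambda>N. colcomb n K v (c N) k W < tau\<^sup>2) sequentially" using lt by (rule order_tendstoD)
  then obtain N where N: "colcomb n K v (c N) k W < tau\<^sup>2" by (auto simp: eventually_sequentially)
  have "colcomb n K v (restrict (c N) {..<K}) k W = colcomb n K v (c N) k W"
    unfolding colcomb_def by (intro sum.cong arg_cong[where f = "\<lambda>x. x\<^sup>2"] refl) auto
  moreover have "restrict (c N) {..<K} \<in> PiE {..<K} (\<lambda>_. \<rat>)" by (auto simp: c_def)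
  ultimately have "W \<in> badcol n K v tau k" using W(1) N unfolding badcol_def by (intro UN_I[of "restrict (c N) {..<K}"]) auto
  with W(2) show False by simp
qed

text \<open>Dividing a vector by its largest coordinate turns the norm of its image into the
  distance of one column from the span of the others; this bounds the smallest singular value below
  by \<open>tau / sqrt K\<close>. For solvability \<open>- y\<close> is adjoined as a further
  column: by injectivity a kernel vector of the enlarged system must involve it.\<close>

lemma well_conditioned:
  assumes W: "W \<in> space (gaussian_measure n K)" "\<And>k. k < K \<Longrightarrow> W \<notin> badcol n K v tau k" and tau: "0 < tau" and K1: "1 \<le> K"
    and v: "\<And>j. j < K \<Longrightarrow> v j \<in> V n"
  shows "\<exists>x. (\<forall>j<K. (\<Sum>k<K. inner (v j) (mkv n (\<lambda>i. W (i,k))) * x k) = y j) \<and>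
    tau / sqrt (real K) * sqrt (\<Sum>k<K. (x k)\<^sup>2) \<le> sqrt (\<Sum>k<K. (y k)\<^sup>2)"
proof -
  let ?G = "gcoef n v W"
  have low: "tau\<^sup>2 / real K * (\<Sum>k<K. (x k)\<^sup>2) \<le> (\<Sum>j<K. (\<Sum>k<K. ?G j k * x k)\<^sup>2)" for x
  proof -
    define m where "m = Max ((\<lambda>k. \<bar>x k\<bar>) ` {..<K})"
    have "m \<in> (\<lambda>k. \<bar>x k\<bar>) ` {..<K}" unfolding m_def by (rule Max_in) (use K1 in \<open>auto simp: lessThan_empty_iff\<close>)
    then obtain k where k: "k < K" "m = \<bar>x k\<bar>" by auto
    have mx: "\<bar>x i\<bar> \<le> \<bar>x k\<bar>" if "i < K" for i unfolding k(2)[symmetric] m_def using that by (intro Max_ge) auto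
    have "(\<Sum>i<K. (x i)\<^sup>2) \<le> (\<Sum>i<K. (x k)\<^sup>2)"
    proof (rule sum_mono)
      fix i assume "i \<in> {..<K}"
      then have "\<bar>x i\<bar>\<^sup>2 \<le> \<bar>x k\<bar>\<^sup>2" by (intro power_mono mx) auto
      then show "(x i)\<^sup>2 \<le> (x k)\<^sup>2" by simp
    qed
    then have "tau\<^sup>2 / real K * (\<Sum>k<K. (x k)\<^sup>2) \<le> tau\<^sup>2 / real K * (real K * (x k)\<^sup>2)" by (intro mult_left_mono) auto
    also have "\<dots> = (x k)\<^sup>2 * tau\<^sup>2" using K1 by simp
    also have "\<dots> \<le> (\<Sum>j<K. (\<Sum>k<K. ?G j k * x k)\<^sup>2)"
    proof (cases "x k = 0")
      case False
      define b where "b i = x i / x k" for i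
      have "(x k)\<^sup>2 * tau\<^sup>2 \<le> (x k)\<^sup>2 * colcomb n K v b k W"
        by (intro mult_left_mono not_badcol_real[OF W(1) W(2)[OF k(1)]]) auto
      also have "\<dots> = (\<Sum>j<K. (\<Sum>i<K. ?G j i * x i)\<^sup>2)"
        unfolding colcomb_def sum_distrib_left power_mult_distrib[symmetric]
        by (intro sum.cong refl arg_cong[where f = "\<lambda>z. z\<^sup>2"]) (use False in \<open>auto simp: b_def\<close>)
      finally show ?thesis .
    qed (auto intro!: sum_nonneg)
    finally show ?thesis .
  qed
  define A where "A j k = (if k = K then - y j else ?G j k)" for j k
  obtain c where c: "\<exists>k\<in>{..<Suc K}. c k \<noteq> 0" "\<forall>j\<in>{..<K}. (\<Sum>k<Suc K. A j k * c k) = 0"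
    using underdetermined_system[of "{..<K}" "{..<Suc K}" A] by auto
  have Gc: "(\<Sum>k<K. ?G j k * c k) = y j * c K" if "j < K" for j
    using c(2) that by (auto simp: A_def)
  have cK: "c K \<noteq> 0"
  proof
    assume z: "c K = 0"
    then have "(\<Sum>j<K. (\<Sum>k<K. ?G j k * c k)\<^sup>2) = 0" by (simp add: Gc)
    then have "tau\<^sup>2 / real K * (\<Sum>k<K. (c k)\<^sup>2) \<le> 0" using low[of c] by simp
    then have "(\<Sum>k<K. (c k)\<^sup>2) \<le> 0" using tau K1 by (simp add: mult_le_0_iff divide_le_0_iff)
    moreover have "0 \<le> (\<Sum>k<K. (c k)\<^sup>2)" by (intro sum_nonneg) auto
    ultimately have "(\<Sum>k<K. (c k)\<^sup>2) = 0" by linarith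
    then have "\<forall>k<K. c k = 0" by (subst (asm) sum_nonneg_eq_0_iff) auto
    then show False using c(1) z less_Suc_eq by auto
  qed
  define x where "x k = c k / c K" for k
  have Gx: "(\<Sum>k<K. ?G j k * x k) = y j" if "j < K" for j
  proof -
    have "(\<Sum>k<K. ?G j k * x k) = (\<Sum>k<K. ?G j k * c k) / c K" unfolding x_def sum_divide_distrib by simp
    then show ?thesis using Gc[OF that] cK by simp
  qed
  have "tau\<^sup>2 / real K * (\<Sum>k<K. (x k)\<^sup>2) \<le> (\<Sum>j<K. (y j)\<^sup>2)" using low[of x] by (simp add: Gx)
  then have "sqrt (tau\<^sup>2 / real K * (\<Sum>k<K. (x k)\<^sup>2)) \<le> sqrt (\<Sum>j<K. (y j)\<^sup>2)" by (rule real_sqrt_le_mono)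
  then have "tau / sqrt (real K) * sqrt (\<Sum>k<K. (x k)\<^sup>2) \<le> sqrt (\<Sum>k<K. (y k)\<^sup>2)"
    using tau by (simp add: real_sqrt_mult real_sqrt_divide)
  then show ?thesis using Gx gcoef_inner[OF v] by (intro exI[of _ x]) auto
qed

lemma gaussian_frobenius:
  assumes T: "0 < T" and nK: "1 \<le> n" "1 \<le> K"
  shows "{W \<in> space (gaussian_measure n K). T * (real n * real K) \<le> (\<Sum>q\<in>{..<n} \<times> {..<K}. (W q)\<^sup>2)} \<in> sets (gaussian_measure n K)" (is "?F \<in> _")
    and "emeasure (gaussian_measure n K) {W \<in> space (gaussian_measure n K). T * (real n * real K) \<le> (\<Sum>q\<in>{..<n} \<times> {..<K}. (W q)\<^sup>2)} \<le> ennreal (1 / T)"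
proof -
  let ?M = "gaussian_measure n K" and ?I = "{..<n} \<times> {..<K}"
  have comp: "(\<lambda>W. W q) \<in> measurable ?M stdN" if "q \<in> ?I" for q
    unfolding gaussian_measure_def by (rule measurable_component_singleton[OF that])
  then have comp': "(\<lambda>W. W q) \<in> borel_measurable ?M" if "q \<in> ?I" for q using that by simp
  have [measurable]: "(\<lambda>W. \<Sum>q\<in>?I. (W q)\<^sup>2) \<in> borel_measurable ?M"
    by (intro borel_measurable_sum borel_measurable_power comp')
  show F: "?F \<in> sets ?M" by measurable
  have one: "(\<integral>\<^sup>+ W. ennreal ((W q)\<^sup>2) \<partial>?M) = 1" if q: "q \<in> ?I" for q
  proof -
    have "(\<integral>\<^sup>+ W. ennreal ((W q)\<^sup>2) \<partial>?M) = (\<integral>\<^sup>+ x. ennreal (x\<^sup>2) \<partial>(distr ?M stdN (\<lambda>W. W q)))"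
      by (subst nn_integral_distr[OF comp[OF q]]) auto
    also have "distr ?M stdN (\<lambda>W. W q) = stdN"
      unfolding gaussian_measure_def by (rule distr_PiM_component[OF stdN.prob_space_axioms q])
    also have "(\<integral>\<^sup>+ x. ennreal (x\<^sup>2) \<partial>stdN) = (\<integral>\<^sup>+ x. ennreal (std_normal_density x * x ^ (2 * 1)) \<partial>lborel)"
      by (subst nn_integral_density) (auto simp: ennreal_mult'')
    also have "\<dots> = ennreal (fact (2 * 1) / (2 ^ 1 * fact 1))"
      by (rule nn_integral_eq_integral[THEN trans])
         (use std_normal_moment_even[of 1] in \<open>auto simp: has_bochner_integral_iff\<close>)
    also have "\<dots> = 1" by (simp add: fact_numeral)
    finally show ?thesis .
  qed
  have "(\<integral>\<^sup>+ W. ennreal (\<Sum>q\<in>?I. (W q)\<^sup>2) \<partial>?M) = (\<integral>\<^sup>+ W. (\<Sum>q\<in>?I. ennreal ((W q)\<^sup>2)) \<partial>?M)"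
    by (intro nn_integral_cong) (simp add: sum_ennreal)
  also have "\<dots> = (\<Sum>q\<in>?I. \<integral>\<^sup>+ W. ennreal ((W q)\<^sup>2) \<partial>?M)"
    by (rule nn_integral_sum) (intro measurable_compose[OF _ measurable_ennreal] borel_measurable_power comp')
  also have "\<dots> = ennreal (real n * real K)" by (simp add: one card_cartesian_product ennreal_of_nat_eq_real_of_nat)
  finally have tot: "(\<integral>\<^sup>+ W. ennreal (\<Sum>q\<in>?I. (W q)\<^sup>2) \<partial>?M) = ennreal (real n * real K)" .
  define c where "c = 1 / (T * (real n * real K))"
  have Tn: "0 < T * (real n * real K)" using T nK by simp
  then have c0: "0 < c" by (simp add: c_def)
  have "emeasure ?M ?F \<le> emeasure ?M {W \<in> space ?M. 1 \<le> ennreal c * ennreal (\<Sum>q\<in>?I. (W q)\<^sup>2)}"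
  proof (rule emeasure_mono)
    show "{W \<in> space ?M. 1 \<le> ennreal c * ennreal (\<Sum>q\<in>?I. (W q)\<^sup>2)} \<in> sets ?M" by measurable
    show "?F \<subseteq> {W \<in> space ?M. 1 \<le> ennreal c * ennreal (\<Sum>q\<in>?I. (W q)\<^sup>2)}"
    proof (clarify)
      fix W assume "T * (real n * real K) \<le> (\<Sum>q\<in>?I. (W q)\<^sup>2)"
      then have "1 \<le> c * (\<Sum>q\<in>?I. (W q)\<^sup>2)" using Tn by (simp add: c_def)
      then have "ennreal 1 \<le> ennreal (c * (\<Sum>q\<in>?I. (W q)\<^sup>2))" by (rule ennreal_leI)
      then show "1 \<le> ennreal c * ennreal (\<Sum>q\<in>?I. (W q)\<^sup>2)" using c0 by (simp add: ennreal_mult')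
    qed
  qed
  also have "\<dots> \<le> ennreal c * (\<integral>\<^sup>+ W. ennreal (\<Sum>q\<in>?I. (W q)\<^sup>2) * indicator (space ?M) W \<partial>?M)"
    by (rule nn_integral_Markov_inequality) measurable
  also have "\<dots> = ennreal c * (\<integral>\<^sup>+ W. ennreal (\<Sum>q\<in>?I. (W q)\<^sup>2) \<partial>?M)"
    by (intro arg_cong2[where f = "(*)"] refl nn_integral_cong) (auto simp: indicator_def)
  also have "\<dots> = ennreal (1 / T)"
    unfolding tot using nK T by (subst ennreal_mult[symmetric]) (auto simp: c_def)
  finally show "emeasure ?M ?F \<le> ennreal (1 / T)" .
qed

text \<open>\<open>tau\<close> and the factor \<open>2 * exp K\<close> are tuned so that the
  \<open>K\<close> small-ball events together, and the norm event, each fail with probability at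
  most \<open>exp (- K) / 2\<close>.\<close>

lemma gaussian_good_event:
  assumes v: "orthonormal K v" "\<And>j. j < K \<Longrightarrow> v j \<in> V n" and K1: "1 \<le> K" and n1: "1 \<le> n"
  defines "tau \<equiv> exp (- real K) / (2 * real K * sqrt (real n))"
  shows "\<exists>H\<in>sets (gaussian_measure n K). 1 - exp (- real K) \<le> measure (gaussian_measure n K) H \<and>
    (\<forall>W\<in>H. sqrt (\<Sum>k<K. (norm (mkv n (\<lambda>i. W (i,k))))\<^sup>2) \<le> sqrt (2 * exp (real K) * (real n * real K)) \<and>
      (\<forall>y. \<exists>x. (\<forall>j<K. (\<Sum>k<K. inner (v j) (mkv n (\<lambda>i. W (i,k))) * x k) = y j) \<and>
        tau / sqrt (real K) * sqrt (\<Sum>k<K. (x k)\<^sup>2) \<le> sqrt (\<Sum>k<K. (y k)\<^sup>2)))"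
proof -
  let ?M = "gaussian_measure n K"
  interpret M: prob_space ?M unfolding gaussian_measure_def by (rule prob_space_PiM_stdN)
  have tau0: "0 < tau" using K1 n1 by (simp add: tau_def)
  define T where "T = 2 * exp (real K)"
  have T0: "0 < T" by (simp add: T_def)
  define F where "F = {W \<in> space ?M. T * (real n * real K) \<le> (\<Sum>q\<in>{..<n} \<times> {..<K}. (W q)\<^sup>2)}"
  have F: "F \<in> sets ?M" "measure ?M F \<le> 1 / T"
    using gaussian_frobenius[OF T0 n1 K1] T0 unfolding F_def
    by (auto simp: M.emeasure_eq_measure)
  define Bd where "Bd = (\<Union>k\<in>{..<K}. badcol n K v tau k)"
  have Bds: "Bd \<in> sets ?M" unfolding Bd_def by (intro sets.finite_UN badcol_sets) auto
  have "measure ?M Bd \<le> (\<Sum>k<K. measure ?M (badcol n K v tau k))"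
    unfolding Bd_def by (rule measure_UNION_le) (auto intro: badcol_sets)
  also have "\<dots> \<le> (\<Sum>k<K. tau * sqrt (real n))"
  proof (rule sum_mono)
    fix k assume "k \<in> {..<K}"
    then show "measure ?M (badcol n K v tau k) \<le> tau * sqrt (real n)"
      using badcol_prob[OF v _ n1 tau0, of k] tau0 by (simp add: M.emeasure_eq_measure)
  qed
  also have "\<dots> = exp (- real K) / 2" using K1 n1 by (simp add: tau_def)
  finally have Bd: "measure ?M Bd \<le> exp (- real K) / 2" .
  define H where "H = space ?M - (F \<union> Bd)"
  have "measure ?M (F \<union> Bd) \<le> exp (- real K)"
  proof -
    have "1 / T = exp (- real K) / 2" by (simp add: T_def exp_minus field_simps)
    then show ?thesis using measure_Un_le[OF F(1) Bds] F(2) Bd by linarith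
  qed
  then have mH: "1 - exp (- real K) \<le> measure ?M H"
    unfolding H_def using F Bds by (subst M.prob_compl) auto
  have "H \<in> sets ?M" unfolding H_def using F Bds by auto
  moreover have "sqrt (\<Sum>k<K. (norm (mkv n (\<lambda>i. W (i,k))))\<^sup>2) \<le> sqrt (2 * exp (real K) * (real n * real K))" if W: "W \<in> H" for W
  proof -
    have "(\<Sum>k<K. (norm (mkv n (\<lambda>i. W (i,k))))\<^sup>2) = (\<Sum>k<K. \<Sum>i<n. (W (i,k))\<^sup>2)"
      by (rule sum.cong) (auto simp: norm_V[OF mkv_in_V])
    also have "\<dots> = (\<Sum>i<n. \<Sum>k<K. (W (i,k))\<^sup>2)" by (rule sum.swap)
    also have "\<dots> = (\<Sum>q\<in>{..<n} \<times> {..<K}. (W q)\<^sup>2)" by (simp add: sum.cartesian_product)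
    also have "\<dots> \<le> T * (real n * real K)" using W by (auto simp: H_def F_def)
    finally show ?thesis by (simp add: T_def)
  qed
  moreover have "\<exists>x. (\<forall>j<K. (\<Sum>k<K. inner (v j) (mkv n (\<lambda>i. W (i,k))) * x k) = y j) \<and>
        tau / sqrt (real K) * sqrt (\<Sum>k<K. (x k)\<^sup>2) \<le> sqrt (\<Sum>k<K. (y k)\<^sup>2)" if W: "W \<in> H" for W y
    by (rule well_conditioned) (use W tau0 K1 v in \<open>auto simp: H_def Bd_def\<close>)
  ultimately show ?thesis using mH by blast
qed

section \<open>The multi-layer stochastic block model\<close>

lemma mv_mpow: "x \<in> V n \<Longrightarrow> mv n n (mpow n M N) x = (mv n n M ^^ N) x"
  by (induction N) (auto simp: mv_mid mv_mmult)

lemma schur_test: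
  assumes B: "\<And>i j. i < n \<Longrightarrow> j < n \<Longrightarrow> \<bar>B i j\<bar> \<le> d i j"
    and row: "\<And>i. i < n \<Longrightarrow> (\<Sum>j<n. d i j) \<le> R" and col: "\<And>j. j < n \<Longrightarrow> (\<Sum>i<n. d i j) \<le> R" and R: "0 \<le> R"
    and x: "x \<in> V n"
  shows "norm (mv n n B x) \<le> R * norm x"
proof -
  have d0: "0 \<le> d i j" if "i < n" "j < n" for i j using B[OF that] by linarith
  have "(norm (mv n n B x))\<^sup>2 = (\<Sum>i<n. (\<Sum>j<n. B i j * crd x j)\<^sup>2)" by (subst norm_V[OF mv_in_V]) simp
  also have "\<dots> \<le> (\<Sum>i<n. R * (\<Sum>j<n. d i j * (crd x j)\<^sup>2))"
  proof (rule sum_mono)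
    fix i assume i: "i \<in> {..<n}"
    have "(\<Sum>j<n. B i j * crd x j)\<^sup>2 \<le> (\<Sum>j<n. d i j) * (\<Sum>j<n. d i j * (crd x j)\<^sup>2)"
      by (rule sum_square_weighted) (use B i in auto)
    also have "\<dots> \<le> R * (\<Sum>j<n. d i j * (crd x j)\<^sup>2)"
      using i d0 row by (intro mult_right_mono sum_nonneg) auto
    finally show "(\<Sum>j<n. B i j * crd x j)\<^sup>2 \<le> R * (\<Sum>j<n. d i j * (crd x j)\<^sup>2)" .
  qed
  also have "\<dots> = R * (\<Sum>j<n. (\<Sum>i<n. d i j) * (crd x j)\<^sup>2)"
    unfolding sum_distrib_left[symmetric] by (subst sum.swap) (simp add: sum_distrib_right)
  also have "\<dots> \<le> R * (\<Sum>j<n. R * (crd x j)\<^sup>2)"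
    using col R by (intro mult_left_mono sum_mono mult_right_mono) auto
  also have "\<dots> = (R * norm x)\<^sup>2"
    by (simp add: power_mult_distrib norm_V[OF x] sum_distrib_left[symmetric]) (simp add: power2_eq_square)
  finally show ?thesis by (rule power2_le_imp_le) (use R in auto)
qed

text \<open>The hypothesis speaks of eigenvalues only; an eigenbasis turns it into a bound for the
  quadratic form.\<close>

lemma eigen_gap_quadratic:
  assumes eg: "eigen_gap K L B0 c" and sym: "symm K (sum_sq K L B0)" and x: "x \<in> V K"
  shows "c * real L * (norm x)\<^sup>2 \<le> inner x (mv K K (sum_sq K L B0) x)"
proof -
  let ?A = "sum_sq K L B0"
  note u = evec_facts[OF sym]
  have ev: "c * real L \<le> evl K ?A i" if i: "i < K" for i
  proof -
    have "is_eigenvalue K ?A (evl K ?A i)"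
      unfolding is_eigenvalue_def
    proof (intro exI[of _ "crd (evec K ?A i)"] conjI allI impI)
      show "\<exists>a<K. crd (evec K ?A i) a \<noteq> 0"
      proof (rule ccontr)
        assume "\<not> ?thesis"
        then have "evec K ?A i = 0" using u(2)[OF i] by (intro V_eqI[of _ K]) auto
        then show False using orthonormal_norm[OF u(1) i] by simp
      qed
      fix a assume a: "a < K"
      have "crd (mv K K ?A (evec K ?A i)) a = evl K ?A i * crd (evec K ?A i) a" by (simp only: u(3)[OF i] crd_simps)
      then show "(\<Sum>j<K. ?A a j * crd (evec K ?A i) j) = evl K ?A i * crd (evec K ?A i) a" using a by simp
    qed
    then show ?thesis using eg unfolding eigen_gap_def by blast
  qed
  have "inner x (mv K K ?A x) = (\<Sum>i<K. inner x (evec K ?A i) * inner (evec K ?A i) (mv K K ?A x))"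
    by (rule parseval[OF u(1,2) x])
  also have "\<dots> = (\<Sum>i<K. evl K ?A i * (inner x (evec K ?A i))\<^sup>2)"
  proof (rule sum.cong[OF refl])
    fix i assume "i \<in> {..<K}"
    then have "inner (evec K ?A i) (mv K K ?A x) = evl K ?A i * inner x (evec K ?A i)"
      using mv_symm[OF sym, of "evec K ?A i" x] by (simp add: u(3) inner_commute)
    then show "inner x (evec K ?A i) * inner (evec K ?A i) (mv K K ?A x) = evl K ?A i * (inner x (evec K ?A i))\<^sup>2"
      by (simp add: power2_eq_square)
  qed
  also have "\<dots> \<ge> (\<Sum>i<K. (c * real L) * (inner x (evec K ?A i))\<^sup>2)"
    by (intro sum_mono mult_right_mono ev) auto
  finally show ?thesis by (simp add: parseval_norm[OF u(1,2) x] sum_distrib_left)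
qed

lemma comm_vec_in_V [simp]: "comm_vec n g k \<in> V n" by (simp add: comm_vec_def)

lemma inner_comm_vec:
  assumes y: "y \<in> V n" and s: "0 < comm_size n g k"
  shows "sqrt (real (comm_size n g k)) * inner y (comm_vec n g k) = (\<Sum>i<n. if g i = k then crd y i else 0)"
  unfolding inner_V[OF y] sum_distrib_left comm_vec_def using s by (intro sum.cong) auto

lemma constant_on_communities:
  assumes size: "\<And>k. k < K \<Longrightarrow> 0 < comm_size n g k" and g: "\<And>i. i < n \<Longrightarrow> g i < K"
    and y: "y \<in> V n" "\<And>i. i < n \<Longrightarrow> crd y i = f (g i)"
  shows "y = (\<Sum>j<K. inner y (comm_vec n g j) *\<^sub>R comm_vec n g j)"
proof (rule V_eqI[of _ n])
  fix i assume i: "i < n"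
  have ip: "inner y (comm_vec n g j) = sqrt (real (comm_size n g j)) * f j" if "j < K" for j
  proof -
    have "sqrt (real (comm_size n g j)) * inner y (comm_vec n g j) = (\<Sum>i<n. if g i = j then f j else 0)"
      unfolding inner_comm_vec[OF y(1) size[OF that]] by (rule sum.cong) (auto simp: y(2))
    also have "\<dots> = sqrt (real (comm_size n g j)) * (sqrt (real (comm_size n g j)) * f j)"
      by (simp add: sum_comm mult.assoc[symmetric])
    finally show ?thesis using size[OF that] by simp
  qed
  have "crd (\<Sum>j<K. inner y (comm_vec n g j) *\<^sub>R comm_vec n g j) i =
     (\<Sum>j<K. if j = g i then f j else 0)"
    unfolding crd_sum crd_simps
  proof (rule sum.cong[OF refl])
    fix j assume "j \<in> {..<K}"
    then have j: "j < K" by simp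
    show "inner y (comm_vec n g j) * crd (comm_vec n g j) i = (if j = g i then f j else 0)"
      unfolding ip[OF j] using i size[OF j] by (cases "j = g i") (auto simp: comm_vec_def)
  qed
  then show "crd y i = crd (\<Sum>j<K. inner y (comm_vec n g j) *\<^sub>R comm_vec n g j) i"
    using g[OF i] y(2)[OF i] by simp
qed (use y in \<open>auto intro!: V_sum\<close>)

lemma sum_over_communities:
  fixes n K :: nat and g :: "nat \<Rightarrow> nat"
  assumes g: "\<And>i. i < n \<Longrightarrow> g i < K"
  shows "(\<Sum>i<n. F (g i) * y i) = (\<Sum>k<K. F k * (\<Sum>i<n. if g i = k then y i else (0::real)))"
proof -
  have "(\<Sum>k<K. F k * (\<Sum>i<n. if g i = k then y i else 0)) = (\<Sum>i<n. \<Sum>k<K. if k = g i then F k * y i else 0)"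
    unfolding sum_distrib_left by (subst sum.swap) (intro sum.cong, auto)
  also have "\<dots> = (\<Sum>i<n. F (g i) * y i)" by (rule sum.cong) (simp_all add: g)
  finally show ?thesis by simp
qed

locale sbm =
  fixes K n L :: nat and g :: "nat \<Rightarrow> nat" and B0 :: "nat \<Rightarrow> nat \<Rightarrow> nat \<Rightarrow> real" and b rho c C p :: real
  assumes K1: "1 \<le> K" and model: "sbm_model K n L g B0 b rho" and bal: "balanced K n g c C" and gap: "eigen_gap K L B0 c"
    and c0: "0 < c" and C0: "0 < C" and b1: "1 \<le> b" and p: "0 < p" "p \<le> 1"
begin

definition rp :: real where "rp = p * rho"
definition be :: real where "be = b * rp"
text \<open>Zero outside the edge set, since \<open>edge_model\<close> asks for its bounds at every
  index.\<close>

definition pr :: "nat \<times> nat \<times> nat \<Rightarrow> real" where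
  "pr = (\<lambda>(l,i,j). if (l,i,j) \<in> pair_set L n then rp * B0 l (g i) (g j) else 0)"

lemma n1: "1 \<le> n" and L1: "1 \<le> L" and rho0: "0 < rho" and gK: "\<And>i. i < n \<Longrightarrow> g i < K"
  and B0: "\<And>l k k'. l < L \<Longrightarrow> k < K \<Longrightarrow> k' < K \<Longrightarrow> B0 l k k' = B0 l k' k \<and> 0 \<le> B0 l k k' \<and> B0 l k k' \<le> b \<and> rho * B0 l k k' \<le> 1"
  using model by (auto simp: sbm_model_def)

lemma rp0: "0 < rp" using p rho0 by (simp add: rp_def)
lemma be0: "0 < be" using rp0 b1 by (simp add: be_def)

lemma size: "k < K \<Longrightarrow> c * real n / real K \<le> real (comm_size n g k)" "k < K \<Longrightarrow> real (comm_size n g k) \<le> C * real n / real K"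
  "k < K \<Longrightarrow> 0 < comm_size n g k"
proof -
  show 1: "c * real n / real K \<le> real (comm_size n g k)" "real (comm_size n g k) \<le> C * real n / real K" if "k < K" for k
    using bal that by (auto simp: balanced_def)
  have "0 < c * real n / real K" using c0 n1 K1 by simp
  then show "k < K \<Longrightarrow> 0 < comm_size n g k" using 1(1)[of k] by (metis less_le_trans of_nat_0_less_iff)
qed

sublocale edge_model L n pr be
proof
  fix e :: "nat \<times> nat \<times> nat"
  obtain l i j where e: "e = (l,i,j)" by (cases e)
  have *: "0 \<le> pr e \<and> pr e \<le> 1 \<and> pr e \<le> be"
  proof (cases "e \<in> pair_set L n")
    case True
    then have lij: "l < L" "g i < K" "g j < K" using gK by (auto simp: e pair_set_def)
    note B = B0[OF lij]
    have "rp * B0 l (g i) (g j) = p * (rho * B0 l (g i) (g j))" by (simp add: rp_def)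
    also have "\<dots> \<le> 1 * 1" using p B rho0 by (intro mult_mono) auto
    finally have "rp * B0 l (g i) (g j) \<le> 1" by simp
    moreover have "rp * B0 l (g i) (g j) \<le> rp * b" using B rp0 by (intro mult_left_mono) auto
    ultimately show ?thesis using True B rp0 by (simp add: pr_def e be_def mult.commute)
  next
    case False
    then show ?thesis using be0 by (auto simp: pr_def e)
  qed
  then show "0 \<le> pr e" "pr e \<le> 1" "pr e \<le> be" by auto
qed (rule n1)

section \<open>The population matrix and its distance to the sampled one\<close>

definition Pf :: "nat \<Rightarrow> rmat" where "Pf l i j = rp * B0 l (g i) (g j)"
text \<open>The loops and the diagonal of the squares are kept although the observed matrix has
  neither: in this way the matrix is exactly constant on the blocks of communities. The difference
  is the bias estimated in \<open>noise_decomposition\<close>.\<close>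

definition Ms :: rmat where "Ms i j = (\<Sum>l<L. \<Sum>k<n. Pf l i k * Pf l k j)"

lemma Pf_bounds: "l < L \<Longrightarrow> i < n \<Longrightarrow> j < n \<Longrightarrow> 0 \<le> Pf l i j" "l < L \<Longrightarrow> i < n \<Longrightarrow> j < n \<Longrightarrow> Pf l i j \<le> be"
  "l < L \<Longrightarrow> i < n \<Longrightarrow> j < n \<Longrightarrow> Pf l i j = Pf l j i"
  using B0[of l "g i" "g j"] gK rp0 by (auto simp: Pf_def be_def mult.commute intro!: mult_right_mono mult_left_mono)

lemma P_Pf: "l < L \<Longrightarrow> i < n \<Longrightarrow> j < n \<Longrightarrow> P l i j = (if i = j then 0 else Pf l i j)"
  unfolding P_def using Pf_bounds(3)[of l i j]
  by (auto simp: sym_ext_def ed_def pr_def pair_set_def Pf_def min_def max_def)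

text \<open>\<open>False\<close> outside the edge set, the convention of
  \<open>bern\<close>.\<close>

definition cut :: "(nat \<times> nat \<times> nat \<Rightarrow> bool) \<Rightarrow> (nat \<times> nat \<times> nat \<Rightarrow> bool) \<Rightarrow> nat \<times> nat \<times> nat \<Rightarrow> bool" where
  "cut a s e = (e \<in> pair_set L n \<and> a e \<and> s e)"

definition X :: "(nat \<times> nat \<times> nat \<Rightarrow> bool) \<Rightarrow> nat \<Rightarrow> rmat" where
  "X w = sym_ext (\<lambda>e. of_bool (w e))"

lemma X_PY: "X w l i j = P l i j + Y w l i j"
  by (simp add: X_def P_def Y_def sym_ext_def)

lemma sampled_adj_X:
  assumes "l < L" "i < n" "j < n"
  shows "sampled_adj p AA S l i j = X (cut AA S) l i j / p"
  using assms by (auto simp: sampled_adj_def sym_entry_def X_def sym_ext_def cut_def ed_def pair_set_def min_def max_def)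

text \<open>Before scaling the entries are 0 or 1, so a diagonal entry of the square is the degree
  itself and the bias correction cancels the diagonal without remainder.\<close>

lemma Mbar_eq:
  assumes ij: "i < n" "j < n"
  shows "Mbar L n p AA S i j = 1 / (real L * real n * p\<^sup>2) * (if i = j then 0 else \<Sum>l<L. \<Sum>k<n. X (cut AA S) l i k * X (cut AA S) l k j)"
proof -
  define w where "w = cut AA S"
  have Xsym: "X w l i j = X w l j i" for l i j by (simp add: X_def sym_ext_commute)
  have X01: "X w l i j = 0 \<or> X w l i j = 1" for l i j by (auto simp: X_def sym_ext_def)
  have summand: "mmult n (sampled_adj p AA S l) (sampled_adj p AA S l) i j / real n
      - (if i = j then real (sampled_deg n p AA S l i) / (real n * p ^ 2) else 0) =
      1 / (real n * p\<^sup>2) * (if i = j then 0 else \<Sum>k<n. X w l i k * X w l k j)" if l: "l < L" for l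
  proof -
    have mm: "mmult n (sampled_adj p AA S l) (sampled_adj p AA S l) i j = (\<Sum>k<n. X w l i k * X w l k j) / p\<^sup>2"
      unfolding mmult_def sum_divide_distrib
      by (rule sum.cong) (use l ij in \<open>auto simp: sampled_adj_X w_def power2_eq_square\<close>)
    show ?thesis
    proof (cases "i = j")
      case False then show ?thesis by (simp add: mm)
    next
      case True
      have "real (sampled_deg n p AA S l i) = (\<Sum>k\<in>{k. k < n \<and> sampled_adj p AA S l i k = 1 / p}. 1)"
        by (simp add: sampled_deg_def)
      also have "\<dots> = (\<Sum>k<n. X w l i k * X w l k j)"
      proof (rule sum.mono_neutral_cong_left)
        show "\<forall>k\<in>{..<n} - {k. k < n \<and> sampled_adj p AA S l i k = 1 / p}. X w l i k * X w l k j = 0"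
          using sampled_adj_X[OF l ij(1)] X01 p by (auto simp: w_def) (metis w_def)
        show "1 = X w l i k * X w l k j" if "k \<in> {k. k < n \<and> sampled_adj p AA S l i k = 1 / p}" for k
          using that sampled_adj_X[OF l ij(1), of k AA S] True Xsym[of l i k] p by (auto simp: w_def)
      qed auto
      finally show ?thesis unfolding mm using True by (simp add: mult.commute)
    qed
  qed
  show ?thesis
    unfolding Mbar_def w_def[symmetric]
    by (simp add: summand sum_distrib_left[symmetric] sum_divide_distrib[symmetric] mult.assoc)
qed

lemma symm_Mbar: "symm n (Mbar L n p AA S)"
  unfolding symm_def
proof (intro allI impI)
  fix i j assume ij: "i < n" "j < n"
  have "X (cut AA S) l i k * X (cut AA S) l k j = X (cut AA S) l j k * X (cut AA S) l k i" for l k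
    by (simp add: X_def sym_ext_commute[of _ l k] mult.commute)
  then show "Mbar L n p AA S i j = Mbar L n p AA S j i" unfolding Mbar_eq[OF ij] Mbar_eq[OF ij(2,1)] by auto
qed

text \<open>Expanding the square of \<open>P + Y\<close> off the diagonal leaves
  \<open>F1 + F2\<close>; \<open>D0\<close> collects what the population matrix has in addition. In
  a row of \<open>D0\<close>, one layer contributes at most \<open>n * be^2\<close> on the diagonal
  and, through its loops, at most \<open>2 * be^2\<close> in each of the other columns, hence the
  factor 3.\<close>

lemma noise_decomposition:
  assumes x: "x \<in> V n" and A: "w = cut AA S"
  shows "norm ((real L * real n * p\<^sup>2) *\<^sub>R mv n n (Mbar L n p AA S) x - mv n n Ms x) \<le>
    norm (mv n n (F1 w) x) + norm (mv n n (F2 w) x) + 3 * real L * real n * be\<^sup>2 * norm x"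
proof -
  define D0 where "D0 i j = Ms i j - (if i = j then 0 else \<Sum>l<L. \<Sum>k<n. P l i k * P l k j)" for i j
  have q0: "real L * real n * p\<^sup>2 \<noteq> 0" using n1 L1 p by simp
  have ent: "(real L * real n * p\<^sup>2) * Mbar L n p AA S i j - Ms i j = F1 w i j + F2 w i j - D0 i j"
    if ij: "i < n" "j < n" for i j
    using q0 unfolding Mbar_eq[OF ij] D0_def F1_def F2_def A[symmetric]
    by (simp add: X_PY sum.distrib[symmetric] algebra_simps)
  have "(real L * real n * p\<^sup>2) *\<^sub>R mv n n (Mbar L n p AA S) x - mv n n Ms x = mv n n (F1 w) x + mv n n (F2 w) x - mv n n D0 x"
  proof (rule V_eqI[of _ n])
    fix i assume i: "i < n"
    have "(\<Sum>j<n. ((real L * real n * p\<^sup>2) * Mbar L n p AA S i j - Ms i j) * crd x j) = (\<Sum>j<n. (F1 w i j + F2 w i j - D0 i j) * crd x j)"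
      by (rule sum.cong) (auto simp: ent[OF i])
    then show "crd ((real L * real n * p\<^sup>2) *\<^sub>R mv n n (Mbar L n p AA S) x - mv n n Ms x) i = crd (mv n n (F1 w) x + mv n n (F2 w) x - mv n n D0 x) i"
      using i by (simp add: sum_distrib_left sum.distrib sum_subtractf algebra_simps)
  qed auto
  moreover have "norm (mv n n D0 x) \<le> (3 * real L * real n * be\<^sup>2) * norm x"
  proof (rule schur_test[OF _ _ _ _ x])
    define d where "d i j = real L * be\<^sup>2 * (2 + (if i = j then real n else 0))" for i j :: nat
    have bsq: "0 \<le> Pf l i j * Pf l i' j'" "Pf l i j * Pf l i' j' \<le> be\<^sup>2" if "l < L" "i < n" "j < n" "i' < n" "j' < n" for l i j i' j'
      using that be0 by (auto simp: power2_eq_square intro!: mult_nonneg_nonneg mult_mono Pf_bounds)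
    show "\<bar>D0 i j\<bar> \<le> d i j" if ij: "i < n" "j < n" for i j
    proof (cases "i = j")
      case True
      have "\<bar>D0 i j\<bar> \<le> (\<Sum>l<L. \<Sum>k<n. be\<^sup>2)"
      proof -
        have "0 \<le> D0 i j" unfolding D0_def Ms_def using True ij by (auto intro!: sum_nonneg bsq)
        moreover have "D0 i j \<le> (\<Sum>l<L. \<Sum>k<n. be\<^sup>2)"
          unfolding D0_def Ms_def using True ij by (simp del: sum_constant) (intro sum_mono bsq, auto)
        ultimately show ?thesis by linarith
      qed
      also have "\<dots> \<le> d i j" using True by (simp add: d_def algebra_simps)
      finally show ?thesis .
    next
      case False
      have "D0 i j = (\<Sum>l<L. \<Sum>k<n. Pf l i k * Pf l k j - P l i k * P l k j)"
        using False by (simp add: D0_def Ms_def sum_subtractf)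
      also have "\<dots> = (\<Sum>l<L. Pf l i i * Pf l i j + Pf l i j * Pf l j j)"
      proof (rule sum.cong[OF refl])
        fix l assume l: "l \<in> {..<L}"
        have "(\<Sum>k<n. Pf l i k * Pf l k j - P l i k * P l k j) = (\<Sum>k\<in>{i,j}. Pf l i k * Pf l k j - P l i k * P l k j)"
          by (rule sum.mono_neutral_right) (use ij l in \<open>auto simp: P_Pf\<close>)
        then show "(\<Sum>k<n. Pf l i k * Pf l k j - P l i k * P l k j) = Pf l i i * Pf l i j + Pf l i j * Pf l j j"
          using False by simp
      qed
      finally have "\<bar>D0 i j\<bar> \<le> (\<Sum>l<L. \<bar>Pf l i i * Pf l i j + Pf l i j * Pf l j j\<bar>)" by simp
      also have "\<dots> \<le> (\<Sum>l<L. be\<^sup>2 + be\<^sup>2)"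
      proof (rule sum_mono)
        fix l assume "l \<in> {..<L}"
        then have l: "l < L" by simp
        show "\<bar>Pf l i i * Pf l i j + Pf l i j * Pf l j j\<bar> \<le> be\<^sup>2 + be\<^sup>2"
          using bsq[OF l, of i i i j] bsq[OF l, of i j j j] ij by simp
      qed
      also have "\<dots> = d i j" using False by (simp add: d_def)
      finally show ?thesis .
    qed
    have "(\<Sum>j<n. d i j) = real L * be\<^sup>2 * (real n * 2 + real n)" if "i < n" for i
      using that unfolding d_def sum_distrib_left[symmetric] by (simp add: sum.distrib)
    then show "(\<Sum>j<n. d i j) \<le> 3 * real L * real n * be\<^sup>2" if "i < n" for i using that by simp
    then show "(\<Sum>i<n. d i j) \<le> 3 * real L * real n * be\<^sup>2" if "j < n" for j
      using that by (subst sum.cong[of _ _ _ "\<lambda>i. d j i"]) (auto simp: d_def)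
    show "0 \<le> 3 * real L * real n * be\<^sup>2" by simp
  qed
  moreover have "norm (a1 + a2 - a3) \<le> norm a1 + norm a2 + norm a3" for a1 a2 a3 :: fvec
    using norm_triangle_ineq4[of "a1 + a2" a3] norm_triangle_ineq[of a1 a2] by linarith
  ultimately show ?thesis by (smt (verit))
qed

lemma mv_Pf: 
  assumes l: "l < L" and x: "x \<in> V n" and i: "i < n"
  shows "crd (mv n n (Pf l) x) i = rp * (\<Sum>k<K. B0 l (g i) k * (sqrt (real (comm_size n g k)) * inner x (comm_vec n g k)))"
proof -
  have "crd (mv n n (Pf l) x) i = rp * (\<Sum>j<n. B0 l (g i) (g j) * crd x j)"
    using i by (simp add: Pf_def sum_distrib_left mult.assoc)
  also have "(\<Sum>j<n. B0 l (g i) (g j) * crd x j) = (\<Sum>k<K. B0 l (g i) k * (\<Sum>j<n. if g j = k then crd x j else 0))"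
    by (rule sum_over_communities) (rule gK)
  also have "\<dots> = (\<Sum>k<K. B0 l (g i) k * (sqrt (real (comm_size n g k)) * inner x (comm_vec n g k)))"
    by (rule sum.cong) (auto simp: inner_comm_vec[OF x size(3)])
  finally show ?thesis .
qed

lemma mv_Ms: "mv n n Ms x = (\<Sum>l<L. mv n n (Pf l) (mv n n (Pf l) x))"
proof (rule V_eqI[of _ n])
  fix i assume i: "i < n"
  have "crd (mv n n Ms x) i = (\<Sum>j<n. \<Sum>l<L. (\<Sum>k<n. Pf l i k * Pf l k j) * crd x j)"
    using i by (simp add: Ms_def sum_distrib_right)
  also have "\<dots> = (\<Sum>l<L. \<Sum>j<n. (\<Sum>k<n. Pf l i k * Pf l k j) * crd x j)" by (rule sum.swap)
  also have "\<dots> = (\<Sum>l<L. crd (mv n n (mmult n (Pf l) (Pf l)) x) i)" using i by (simp add: mmult_def)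
  finally show "crd (mv n n Ms x) i = crd (\<Sum>l<L. mv n n (Pf l) (mv n n (Pf l) x)) i" by (simp add: mv_mmult)
qed auto

lemma symm_Pf: "l < L \<Longrightarrow> symm n (Pf l)"
  by (auto simp: symm_def Pf_bounds(3))

text \<open>The form is a sum of squared norms of vectors constant on communities, and so reduces to
  the \<open>K\<close>-dimensional form of \<open>sum_sq\<close>. The smallest community size enters
  twice, on the way into and out of the coordinates \<open>y\<close>, and the eigen-gap once; this
  is the exponent in \<open>c ^ 3\<close>.\<close>

lemma Ms_lower:
  assumes x: "x \<in> V n"
  shows "real L * (real n)\<^sup>2 * rp\<^sup>2 * c ^ 3 / (real K)\<^sup>2 * (\<Sum>j<K. (inner x (comm_vec n g j))\<^sup>2) \<le> inner x (mv n n Ms x)"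
proof -
  define N where "N k = real (comm_size n g k)" for k
  define y where "y = mkv K (\<lambda>k. sqrt (N k) * inner x (comm_vec n g k))"
  have yV: "y \<in> V K" by (simp add: y_def)
  define m where "m = c * real n / real K"
  have m0: "0 < m" unfolding m_def using c0 n1 K1 by simp
  have mN: "m \<le> N k" if "k < K" for k using size(1)[OF that] by (simp add: m_def N_def)
  have symS: "symm K (sum_sq K L B0)"
    unfolding symm_def sum_sq_def mmult_def
  proof (intro allI impI sum.cong refl)
    fix i j l k assume "i < K" "j < K" "l \<in> {..<L}" "k \<in> {..<K}"
    then show "B0 l i k * B0 l k j = B0 l j k * B0 l k i" using B0[of l i k] B0[of l k j] by (simp add: mult.commute)
  qed
  have "inner x (mv n n Ms x) = (\<Sum>l<L. (norm (mv n n (Pf l) x))\<^sup>2)"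
    unfolding mv_Ms inner_sum_right power2_norm_eq_inner
    by (rule sum.cong) (auto simp: mv_symm[OF symm_Pf])
  also have "\<dots> = (\<Sum>l<L. \<Sum>i<n. rp\<^sup>2 * (crd (mv K K (B0 l) y) (g i))\<^sup>2)"
  proof (rule sum.cong[OF refl])
    fix l assume "l \<in> {..<L}"
    then have l: "l < L" by simp
    show "(norm (mv n n (Pf l) x))\<^sup>2 = (\<Sum>i<n. rp\<^sup>2 * (crd (mv K K (B0 l) y) (g i))\<^sup>2)"
      unfolding norm_V[OF mv_in_V]
      by (rule sum.cong) (auto simp only: lessThan_iff mv_Pf[OF l x] power_mult_distrib, auto simp: y_def N_def gK)
  qed
  also have "\<dots> = (\<Sum>l<L. \<Sum>k<K. rp\<^sup>2 * (crd (mv K K (B0 l) y) k)\<^sup>2 * N k)"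
  proof (rule sum.cong[OF refl])
    fix l
    show "(\<Sum>i<n. rp\<^sup>2 * (crd (mv K K (B0 l) y) (g i))\<^sup>2) = (\<Sum>k<K. rp\<^sup>2 * (crd (mv K K (B0 l) y) k)\<^sup>2 * N k)"
      using sum_over_communities[of n g K "\<lambda>k. rp\<^sup>2 * (crd (mv K K (B0 l) y) k)\<^sup>2" "\<lambda>_. 1", OF gK]
      by (simp add: sum_comm N_def)
  qed
  also have "\<dots> \<ge> (\<Sum>l<L. \<Sum>k<K. rp\<^sup>2 * (crd (mv K K (B0 l) y) k)\<^sup>2 * m)"
    by (intro sum_mono mult_left_mono mN) auto
  also have "(\<Sum>l<L. \<Sum>k<K. rp\<^sup>2 * (crd (mv K K (B0 l) y) k)\<^sup>2 * m) = rp\<^sup>2 * m * (\<Sum>l<L. (norm (mv K K (B0 l) y))\<^sup>2)"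
    unfolding norm_V[OF mv_in_V] sum_distrib_left by (intro sum.cong) (auto simp: mult_ac)
  also have "(\<Sum>l<L. (norm (mv K K (B0 l) y))\<^sup>2) = inner y (mv K K (sum_sq K L B0) y)"
  proof -
    have "mv K K (sum_sq K L B0) y = (\<Sum>l<L. mv K K (mmult K (B0 l) (B0 l)) y)"
    proof (rule V_eqI[of _ K])
      fix i assume i: "i < K"
      have "(\<Sum>j<K. \<Sum>l<L. mmult K (B0 l) (B0 l) i j * crd y j) = (\<Sum>l<L. \<Sum>j<K. mmult K (B0 l) (B0 l) i j * crd y j)"
        by (rule sum.swap)
      then show "crd (mv K K (sum_sq K L B0) y) i = crd (\<Sum>l<L. mv K K (mmult K (B0 l) (B0 l)) y) i"
        using i by (simp add: sum_sq_def sum_distrib_right)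
    qed auto
    then have "inner y (mv K K (sum_sq K L B0) y) = (\<Sum>l<L. inner y (mv K K (B0 l) (mv K K (B0 l) y)))"
      by (simp add: inner_sum_right mv_mmult)
    also have "\<dots> = (\<Sum>l<L. (norm (mv K K (B0 l) y))\<^sup>2)"
    proof (rule sum.cong[OF refl])
      fix l assume "l \<in> {..<L}"
      then have "symm K (B0 l)" unfolding symm_def using B0 by auto
      then show "inner y (mv K K (B0 l) (mv K K (B0 l) y)) = (norm (mv K K (B0 l) y))\<^sup>2"
        by (simp add: mv_symm[symmetric] power2_norm_eq_inner)
    qed
    finally show ?thesis by simp
  qed
  finally have 1: "rp\<^sup>2 * m * inner y (mv K K (sum_sq K L B0) y) \<le> inner x (mv n n Ms x)" .
  have 2: "rp\<^sup>2 * m * (c * real L * (norm y)\<^sup>2) \<le> rp\<^sup>2 * m * inner y (mv K K (sum_sq K L B0) y)"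
    using m0 by (intro mult_left_mono eigen_gap_quadratic[OF gap symS yV]) auto
  have "m * (\<Sum>j<K. (inner x (comm_vec n g j))\<^sup>2) \<le> (\<Sum>j<K. N j * (inner x (comm_vec n g j))\<^sup>2)"
    unfolding sum_distrib_left by (intro sum_mono mult_right_mono mN) auto
  also have "\<dots> = (norm y)\<^sup>2"
    unfolding norm_V[OF yV] by (rule sum.cong) (auto simp: y_def power_mult_distrib N_def)
  finally have 3: "rp\<^sup>2 * m * (c * real L * (m * (\<Sum>j<K. (inner x (comm_vec n g j))\<^sup>2))) \<le> rp\<^sup>2 * m * (c * real L * (norm y)\<^sup>2)"
    using m0 c0 by (intro mult_left_mono) auto
  have "rp\<^sup>2 * m * (c * real L * (m * (\<Sum>j<K. (inner x (comm_vec n g j))\<^sup>2))) =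
    real L * (real n)\<^sup>2 * rp\<^sup>2 * c ^ 3 / (real K)\<^sup>2 * (\<Sum>j<K. (inner x (comm_vec n g j))\<^sup>2)"
    by (simp add: m_def power2_eq_square power3_eq_cube)
  then show ?thesis using 1 2 3 by linarith
qed

lemma Ms_upper:
  assumes x: "x \<in> V n"
  shows "norm (mv n n Ms x) \<le> real L * (real n)\<^sup>2 * be\<^sup>2 * norm x"
proof -
  have Pfn: "norm (mv n n (Pf l) y) \<le> real n * be * norm y" if "l < L" "y \<in> V n" for l y
    by (rule schur_test[where d = "\<lambda>_ _. be"]) (use that be0 Pf_bounds(1,2)[OF that(1)] in auto)
  have "norm (mv n n Ms x) \<le> (\<Sum>l<L. norm (mv n n (Pf l) (mv n n (Pf l) x)))"
    unfolding mv_Ms by (rule norm_sum)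
  also have "\<dots> \<le> (\<Sum>l<L. real n * be * (real n * be * norm x))"
    by (intro sum_mono order_trans[OF Pfn] mult_left_mono Pfn x) (use be0 in auto)
  finally show ?thesis by (simp add: power2_eq_square mult_ac)
qed

lemma Ms_range:
  assumes x: "x \<in> V n"
  shows "mv n n Ms x = (\<Sum>j<K. inner (mv n n Ms x) (comm_vec n g j) *\<^sub>R comm_vec n g j)"
proof (rule constant_on_communities[OF size(3) gK mv_in_V])
  fix i assume i: "i < n"
  show "crd (mv n n Ms x) i = (\<lambda>a. \<Sum>l<L. rp * (\<Sum>k<K. B0 l a k * (sqrt (real (comm_size n g k)) * inner (mv n n (Pf l) x) (comm_vec n g k)))) (g i)"
    unfolding mv_Ms crd_sum by (rule sum.cong) (auto simp: mv_Pf[OF _ mv_in_V i] simp del: crd_mv)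
qed


lemma K_le_n: "K \<le> n"
proof -
  have "{..<K} \<subseteq> g ` {..<n}"
  proof
    fix k assume "k \<in> {..<K}"
    then have "{i. i < n \<and> g i = k} \<noteq> {}" using size(3)[of k] unfolding comm_size_def card_gt_0_iff by auto
    then show "k \<in> g ` {..<n}" by auto
  qed
  then have "card {..<K} \<le> card (g ` {..<n})" by (rule card_mono[rotated]) simp
  also have "\<dots> \<le> n" using card_image_le[of "{..<n}" g] by simp
  finally show ?thesis by simp
qed

definition sg :: real where "sg = real L * (real n)\<^sup>2 * rp\<^sup>2 * c ^ 3 / (real K)\<^sup>2"

lemma sg0: "0 < sg" unfolding sg_def using L1 n1 K1 rp0 c0 by simp

lemma recovery:
  assumes nu: "0 \<le> nu" and noise: "\<And>x. x \<in> V n \<Longrightarrow> norm (mv n n (F1 (cut AA S)) x) + norm (mv n n (F2 (cut AA S)) x) \<le> nu * norm x"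
    and eta_def: "eta = (nu + 3 * real L * real n * be\<^sup>2) / sg" and eta: "eta \<le> 1 / 16"
    and tau: "0 < tau" and Fr: "0 \<le> Fr" and fro: "sqrt (\<Sum>k<K. (norm (mkv n (\<lambda>i. W (i,k))))\<^sup>2) \<le> Fr"
    and cond: "\<And>y. \<exists>x. (\<forall>j<K. (\<Sum>k<K. inner (evec n (Mbar L n p AA S) j) (mkv n (\<lambda>i. W (i,k))) * x k) = y j) \<and>
      tau * sqrt (\<Sum>k<K. (x k)\<^sup>2) \<le> sqrt (\<Sum>k<K. (y k)\<^sup>2)"
    and de_def: "de = 2 * eta + (2 * eta) ^ (2 * q + 1) * (Fr / tau)" and de: "de \<le> 1 / 4"
    and ep_def: "ep = 2 * (de * (b\<^sup>2 * (real K)\<^sup>2 / c ^ 3) + eta)"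
    and ep: "real K * ep\<^sup>2 \<le> 1 / 2" "16 * real K * C * ep\<^sup>2 < c / real K"
    and h: "h \<in> rsc_outputs L n K q p AA S W"
  shows "misclass_rate n K (membership g) (membership h) \<le> 16 * real K * C * ep\<^sup>2"
proof -
  \<comment> \<open>The normalisation of \<open>Mbar\<close> scales signal and noise alike and drops
    out of \<open>eta\<close> and of the ratio of upper and lower bound.\<close>
  define ka where "ka = 1 / (real L * real n * p\<^sup>2)"
  have ka0: "0 < ka" using L1 n1 p by (simp add: ka_def)
  let ?M = "Mbar L n p AA S" and ?t = "comm_vec n g" and ?Ms = "\<lambda>i j. ka * Ms i j"
  have mvs: "mv n n ?Ms x = ka *\<^sub>R mv n n Ms x" for x
    by (rule fvec_eqI) (auto simp: sum_distrib_left mult.assoc)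
  have eta0: "0 \<le> eta" unfolding eta_def using nu sg0 by (intro divide_nonneg_pos add_nonneg_nonneg) auto
  have ont: "orthonormal K ?t" by (rule orthonormal_comm_vec[OF size(3)])
  interpret lr: low_rank_perturbation n K ?M ?Ms ?t "ka * sg" "ka * (real L * (real n)\<^sup>2 * be\<^sup>2)" eta
  proof
    show "symm n ?M" by (rule symm_Mbar)
    show "orthonormal K ?t" by (rule ont)
    show "1 \<le> K" by (rule K1)
    show "K \<le> n" by (rule K_le_n)
    show "0 < ka * sg" using ka0 sg0 by simp
    show "0 \<le> ka * (real L * (real n)\<^sup>2 * be\<^sup>2)" using ka0 by simp
    show "0 \<le> eta" "eta \<le> 1 / 16" by (fact eta0 eta)+
    fix x assume x: "x \<in> V n"
    have "ka * (sg * (\<Sum>j<K. (inner x (?t j))\<^sup>2)) \<le> ka * inner x (mv n n Ms x)"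
      using Ms_lower[OF x] ka0 unfolding sg_def by (intro mult_left_mono) auto
    then show "ka * sg * (\<Sum>j<K. (inner x (?t j))\<^sup>2) \<le> inner x (mv n n ?Ms x)" by (simp add: mvs mult.assoc)
    have "ka * norm (mv n n Ms x) \<le> ka * (real L * (real n)\<^sup>2 * be\<^sup>2 * norm x)"
      using Ms_upper[OF x] ka0 by (intro mult_left_mono) auto
    then show "norm (mv n n ?Ms x) \<le> ka * (real L * (real n)\<^sup>2 * be\<^sup>2) * norm x" using ka0 by (simp add: mvs mult.assoc)
    show "mv n n ?Ms x = (\<Sum>j<K. inner (mv n n ?Ms x) (?t j) *\<^sub>R ?t j)"
    proof -
      have "ka *\<^sub>R mv n n Ms x = ka *\<^sub>R (\<Sum>j<K. inner (mv n n Ms x) (?t j) *\<^sub>R ?t j)"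
        using Ms_range[OF x] by (rule arg_cong)
      then show ?thesis unfolding mvs inner_scaleR_left scaleR_sum_right scaleR_scaleR .
    qed
    have "mv n n ?M x - mv n n ?Ms x = ka *\<^sub>R ((real L * real n * p\<^sup>2) *\<^sub>R mv n n ?M x - mv n n Ms x)"
      unfolding mvs scaleR_diff_right using L1 n1 p by (simp add: ka_def)
    then have "norm (mv n n ?M x - mv n n ?Ms x) = ka * norm ((real L * real n * p\<^sup>2) *\<^sub>R mv n n ?M x - mv n n Ms x)"
      using ka0 by simp
    also have "\<dots> \<le> ka * (eta * sg * norm x)"
    proof (rule mult_left_mono)
      have "eta * sg = nu + 3 * real L * real n * be\<^sup>2" using sg0 by (simp add: eta_def)
      then show "norm ((real L * real n * p\<^sup>2) *\<^sub>R mv n n ?M x - mv n n Ms x) \<le> eta * sg * norm x"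
        using noise_decomposition[OF x refl, of AA S] noise[OF x] by (simp add: distrib_right)
    qed (use ka0 in simp)
    finally show "norm (mv n n ?M x - mv n n ?Ms x) \<le> eta * (ka * sg) * norm x" by (simp add: mult_ac)
  qed simp
  obtain Q U where QR: "is_QR_factor n ((q + 1) * K) (krylov_G n K q ?M (\<lambda>i k. W (i, k))) Q"
    and top: "top_eigvecs ((q + 1) * K) K (mmult n (mtrans Q) (mmult n ?M Q)) U"
    and km: "kmeans_opt n K (mmult ((q + 1) * K) Q U) h"
    using h unfolding rsc_outputs_def by blast
  define m where "m = (q + 1) * K"
  obtain R where onQ: "orthonormal_cols n m Q"
    and R: "\<And>i t. i < n \<Longrightarrow> t < m \<Longrightarrow> krylov_G n K q ?M (\<lambda>i k. W (i, k)) i t = (\<Sum>a<m. Q i a * R a t)"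
    using QR unfolding is_QR_factor_def m_def[symmetric] by blast
  define om where "om k = mkv n (\<lambda>i. W (i,k))" for k
  define cQ where "cQ a = mkv n (\<lambda>i. Q i a)" for a
  have onc: "orthonormal m cQ"
    using onQ unfolding orthonormal_def orthonormal_cols_def cQ_def by (simp add: inner_V[OF mkv_in_V])
  define N where "N = 2 * q + 1"
  \<comment> \<open>The last Krylov block suffices: its columns are the highest powers applied to
    the test vectors, and they lie in the span of the columns of \<open>Q\<close>.\<close>
  have col: "(mv n n ?M ^^ N) (om k) = (\<Sum>a<m. R a (q * K + k) *\<^sub>R cQ a)" if k: "k < K" for k
  proof (rule V_eqI[of _ n])
    fix i assume i: "i < n"
    have t: "q * K + k < m" using k by (simp add: m_def)
    have dm: "(q * K + k) div K = q" "(q * K + k) mod K = k" using k by auto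
    have "crd ((mv n n ?M ^^ N) (om k)) i = crd (mv n n (mpow n ?M N) (om k)) i"
      by (subst mv_mpow) (auto simp: om_def)
    also have "\<dots> = krylov_G n K q ?M (\<lambda>i k. W (i, k)) i (q * K + k)"
      using i t unfolding krylov_G_def dm m_def[symmetric] N_def[symmetric] by (simp add: mmult_def om_def)
    also have "\<dots> = (\<Sum>a<m. Q i a * R a (q * K + k))" by (rule R[OF i t])
    finally show "crd ((mv n n ?M ^^ N) (om k)) i = crd (\<Sum>a<m. R a (q * K + k) *\<^sub>R cQ a) i"
      using i by (simp add: cQ_def mult.commute)
  qed (auto simp: N_def cQ_def)
  have near: "norm (x - (\<Sum>a<m. inner x (mkv n (\<lambda>i. Q i a)) *\<^sub>R mkv n (\<lambda>i. Q i a))) \<le> de * norm x" if x: "lr.PT x = x" for x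
  proof -
    obtain d where d: "norm (x - (\<Sum>k<K. d k *\<^sub>R (mv n n ?M ^^ N) (om k))) \<le> (2 * eta + (2 * eta) ^ N * (Fr / tau)) * norm x"
      using lr.power_range_near[of om tau Fr x N] tau Fr cond fro x unfolding om_def by auto
    have "(\<Sum>k<K. d k *\<^sub>R (mv n n ?M ^^ N) (om k)) = (\<Sum>k<K. \<Sum>a<m. (d k * R a (q * K + k)) *\<^sub>R cQ a)"
      by (rule sum.cong) (auto simp: col scaleR_sum_right)
    also have "\<dots> = (\<Sum>a<m. \<Sum>k<K. (d k * R a (q * K + k)) *\<^sub>R cQ a)" by (rule sum.swap)
    also have "\<dots> = (\<Sum>a<m. (\<Sum>k<K. d k * R a (q * K + k)) *\<^sub>R cQ a)" by (simp add: scaleR_sum_left)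
    finally have "norm (x - (\<Sum>a<m. inner x (cQ a) *\<^sub>R cQ a)) \<le> norm (x - (\<Sum>k<K. d k *\<^sub>R (mv n n ?M ^^ N) (om k)))"
      using best_approximation[OF onc, of x] by simp
    with d show ?thesis unfolding de_def cQ_def N_def by linarith
  qed
  have de0: "0 \<le> de" unfolding de_def using eta0 Fr tau by (intro add_nonneg_nonneg mult_nonneg_nonneg) auto
  define uh where "uh k = mkv n (\<lambda>i. mmult m Q U i k)" for k
  have ritz1: "orthonormal K uh"
    unfolding uh_def[abs_def] by (rule lr.ritz_vectors(1)[OF onQ top[folded m_def] _ de0 de]) (rule near)
  have ritz2: "norm (uh k - lr.PT (uh k)) \<le> 2 * (de * (ka * (real L * (real n)\<^sup>2 * be\<^sup>2)) / (ka * sg) + eta)" if "k < K" for k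
    unfolding uh_def[abs_def] by (rule lr.ritz_vectors(2)[OF onQ top[folded m_def] _ de0 de that]) (rule near)
  have ratio: "de * (ka * (real L * (real n)\<^sup>2 * be\<^sup>2)) / (ka * sg) = de * (b\<^sup>2 * (real K)\<^sup>2 / c ^ 3)"
    using ka0 L1 n1 K1 rp0 c0 unfolding sg_def be_def by (simp add: field_simps power_mult_distrib)
  have near2: "(norm (uh k - (\<Sum>j<K. inner (uh k) (?t j) *\<^sub>R ?t j)))\<^sup>2 \<le> ep\<^sup>2" if k: "k < K" for k
    using ritz2[OF k] unfolding ratio lr.PT_def ep_def by (intro power_mono) auto
  define Nm where "Nm = C * real n / real K"
  have "misclass_rate n K (membership g) (membership h) \<le> 16 * (real K)\<^sup>2 * Nm * ep\<^sup>2 / real n"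
  proof (rule kmeans_recovery[where uh = uh and U = "mmult m Q U"])
    show "kmeans_opt n K (mmult m Q U) h" using km by (simp add: m_def)
    show "16 * real K * Nm * ep\<^sup>2 < real (comm_size n g k)" if k: "k < K" for k
    proof -
      have "16 * real K * Nm * ep\<^sup>2 = real n * (16 * C * ep\<^sup>2)" using K1 by (simp add: Nm_def)
      also have "\<dots> \<le> real n * (16 * real K * C * ep\<^sup>2)"
      proof (rule mult_left_mono)
        have "1 * (16 * C * ep\<^sup>2) \<le> real K * (16 * C * ep\<^sup>2)" using K1 C0 by (intro mult_right_mono) auto
        then show "16 * C * ep\<^sup>2 \<le> 16 * real K * C * ep\<^sup>2" by (simp add: mult_ac)
      qed simp
      also have "\<dots> < real n * (c / real K)" using ep(2) n1 by (intro mult_strict_left_mono) auto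
      also have "\<dots> \<le> real (comm_size n g k)" using size(1)[OF k] by (simp add: mult.commute)
      finally show ?thesis .
    qed
  qed (use gK n1 size(2,3) ritz1 near2 ep(1) in \<open>auto simp: uh_def Nm_def\<close>)
  also have "\<dots> = 16 * real K * C * ep\<^sup>2" using n1 K1 by (simp add: Nm_def power2_eq_square)
  finally show ?thesis .
qed

end

section \<open>The sampling law\<close>

text \<open>Thinning: independent edge and sampling indicators combine, edge by edge, to a Bernoulli
  variable with the product of the two probabilities.\<close>

lemma bexp_conj:
  assumes "finite E" "\<And>e. e \<in> E \<Longrightarrow> 0 \<le> pa e \<and> pa e \<le> 1" "\<And>e. e \<in> E \<Longrightarrow> 0 \<le> ps e \<and> ps e \<le> 1"
  shows "bexp E pa (\<lambda>a. bexp E ps (\<lambda>s. f (\<lambda>e. a e \<and> s e))) = bexp E (\<lambda>e. pa e * ps e) f"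
  using assms
proof (induction E arbitrary: f rule: finite_induct)
  case empty then show ?case by (simp add: bexp_empty)
next
  case (insert e E)
  have pa: "0 \<le> pa e" "pa e \<le> 1" and ps: "0 \<le> ps e" "ps e \<le> 1" using insert.prems by auto
  have pp: "0 \<le> pa e * ps e" "pa e * ps e \<le> 1" using pa ps by (auto intro!: mult_le_one)
  have up: "(\<lambda>e'. (a(e := x)) e' \<and> (s(e := y)) e') = (\<lambda>e'. a e' \<and> s e')(e := x \<and> y)" for a s :: "'a \<Rightarrow> bool" and x y
    by auto
  have IH: "bexp E pa (\<lambda>a. bexp E ps (\<lambda>s. f ((\<lambda>e'. a e' \<and> s e')(e := z)))) = bexp E (\<lambda>e. pa e * ps e) (\<lambda>w. f (w(e := z)))" for z
    by (rule insert.IH[of "\<lambda>w. f (w(e := z))"]) (use insert.prems in auto)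
  show ?case
    unfolding bexp_insert[of E e pa, OF insert.hyps pa] bexp_insert[of E e ps, OF insert.hyps ps]
      bexp_insert[of E e "\<lambda>e. pa e * ps e", OF insert.hyps pp] up bexp_add[OF insert.hyps(1)] bexp_cmult IH
    by (simp add: IH algebra_simps)
qed

text \<open>The two encodings differ off the index set, \<open>False\<close> for \<open>bern\<close>
  and undefined for the product measure; the sum runs over the points of the latter.\<close>

lemma bexp_sum_PiE:
  assumes fin: "finite E" and pr: "\<And>e. e \<in> E \<Longrightarrow> 0 \<le> pr e \<and> pr e \<le> 1"
  shows "bexp E pr f = (\<Sum>a\<in>PiE E (\<lambda>_. UNIV). (\<Prod>e\<in>E. pmf (bernoulli_pmf (pr e)) (a e)) * f (\<lambda>e. e \<in> E \<and> a e))"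
proof -
  let ?D = "PiE_dflt E False (\<lambda>_. UNIV :: bool set)"
  have "bexp E pr f = (\<Sum>w\<in>?D. f w * pmf (bern E pr) w)"
    unfolding bexp_def
  proof (rule integral_measure_pmf_real)
    show "finite ?D" by (rule finite_PiE_dflt) (use fin in auto)
    show "w \<in> ?D" if "w \<in> set_pmf (bern E pr)" for w
      using that set_Pi_pmf_subset[OF fin, of False "\<lambda>e. bernoulli_pmf (pr e)"] unfolding bern_def by (auto simp: PiE_dflt_def)
  qed
  also have "\<dots> = (\<Sum>a\<in>PiE E (\<lambda>_. UNIV). (\<Prod>e\<in>E. pmf (bernoulli_pmf (pr e)) (a e)) * f (\<lambda>e. e \<in> E \<and> a e))"
  proof (rule sum.reindex_bij_witness[of _ "\<lambda>a e. e \<in> E \<and> a e" "\<lambda>w. restrict w E"])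
    fix w assume w: "w \<in> ?D"
    then show eq: "(\<lambda>e. e \<in> E \<and> restrict w E e) = w" by (auto simp: PiE_dflt_def fun_eq_iff)
    have "pmf (bern E pr) w = (\<Prod>e\<in>E. pmf (bernoulli_pmf (pr e)) (w e))"
      unfolding bern_def using w fin by (subst pmf_Pi') (auto simp: PiE_dflt_def)
    also have "\<dots> = (\<Prod>e\<in>E. pmf (bernoulli_pmf (pr e)) (restrict w E e))" by (rule prod.cong) auto
    finally show "(\<Prod>e\<in>E. pmf (bernoulli_pmf (pr e)) (restrict w E e)) * f (\<lambda>e. e \<in> E \<and> restrict w E e) = f w * pmf (bern E pr) w"
      unfolding eq by simp
  qed (auto simp: PiE_dflt_def fun_eq_iff)
  finally show ?thesis .
qed

lemma PiM_pmf_atom: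
  assumes fin: "finite E" and a: "a \<in> PiE E (\<lambda>_. UNIV)"
  shows "{a} \<in> sets (PiM E (\<lambda>e. measure_pmf (q e)))"
    "emeasure (PiM E (\<lambda>e. measure_pmf (q e))) {a} = ennreal (\<Prod>e\<in>E. pmf (q e) (a e))"
proof -
  interpret product_sigma_finite "\<lambda>e. measure_pmf (q e)" by standard
  have eq: "{a} = PiE E (\<lambda>e. {a e})" using a by (subst PiE_singleton) (auto simp: PiE_def)
  show "{a} \<in> sets (PiM E (\<lambda>e. measure_pmf (q e)))" unfolding eq by (rule sets_PiM_I_finite[OF fin]) simp
  have "emeasure (PiM E (\<lambda>e. measure_pmf (q e))) {a} = (\<Prod>e\<in>E. emeasure (measure_pmf (q e)) {a e})"
    unfolding eq by (rule emeasure_PiM[OF fin]) simp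
  also have "\<dots> = (\<Prod>e\<in>E. ennreal (pmf (q e) (a e)))" by (simp add: emeasure_pmf_single)
  also have "\<dots> = ennreal (\<Prod>e\<in>E. pmf (q e) (a e))" by (rule prod_ennreal) simp
  finally show "emeasure (PiM E (\<lambda>e. measure_pmf (q e))) {a} = ennreal (\<Prod>e\<in>E. pmf (q e) (a e))" .
qed

section \<open>Joint law of network, sampling and test matrix\<close>

context sbm
begin

abbreviation "PS \<equiv> pair_set L n"
abbreviation "BB \<equiv> (\<lambda>l k k'. rho * B0 l k k')"
definition pa :: "nat \<times> nat \<times> nat \<Rightarrow> real" where "pa = (\<lambda>(l,i,j). rho * B0 l (g i) (g j))"

abbreviation "NM \<equiv> network_measure L n g BB"
abbreviation "SM \<equiv> sampling_measure L n p"

definition Om :: "(nat \<times> nat \<times> nat \<Rightarrow> bool) set" where "Om = PiE PS (\<lambda>_. UNIV)"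

lemma NM_eq: "NM = PiM PS (\<lambda>e. measure_pmf (bernoulli_pmf (pa e)))"
  unfolding network_measure_def pa_def by (simp add: case_prod_unfold)

lemma SM_eq: "SM = PiM PS (\<lambda>e. measure_pmf (bernoulli_pmf p))"
  unfolding sampling_measure_def ..

lemma finite_Om: "finite Om" unfolding Om_def by (intro finite_PiE finite_pair_set) auto

lemma pa: "e \<in> PS \<Longrightarrow> 0 \<le> pa e \<and> pa e \<le> 1"
  using B0 gK rho0 by (auto simp: pair_set_def pa_def)

lemma pa_pr: "e \<in> PS \<Longrightarrow> pa e * p = pr e"
  by (cases e) (auto simp: pa_def pr_def rp_def)

sublocale NM: prob_space NM unfolding NM_eq by (rule prob_space_PiM) (rule prob_space_measure_pmf)
sublocale SM: prob_space SM unfolding SM_eq by (rule prob_space_PiM) (rule prob_space_measure_pmf)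
sublocale GM: prob_space "gaussian_measure n K" unfolding gaussian_measure_def by (rule prob_space_PiM_stdN)
sublocale NS: pair_prob_space NM SM ..
sublocale RS: pair_prob_space "NM \<Otimes>\<^sub>M SM" "gaussian_measure n K" ..

lemma atom:
  assumes "a \<in> Om" "s \<in> Om"
  shows "{(a, s)} \<in> sets (NM \<Otimes>\<^sub>M SM)"
    "measure (NM \<Otimes>\<^sub>M SM) {(a, s)} = (\<Prod>e\<in>PS. pmf (bernoulli_pmf (pa e)) (a e)) * (\<Prod>e\<in>PS. pmf (bernoulli_pmf p) (s e))"
proof -
  note a = PiM_pmf_atom[OF finite_pair_set assms(1)[unfolded Om_def], of "\<lambda>e. bernoulli_pmf (pa e)", folded NM_eq]
  note s = PiM_pmf_atom[OF finite_pair_set assms(2)[unfolded Om_def], of "\<lambda>e. bernoulli_pmf p", folded SM_eq]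
  have eq: "{(a, s)} = {a} \<times> {s}" by auto
  show "{(a, s)} \<in> sets (NM \<Otimes>\<^sub>M SM)" unfolding eq by (intro pair_measureI a s)
  have "emeasure (NM \<Otimes>\<^sub>M SM) {(a, s)} = ennreal ((\<Prod>e\<in>PS. pmf (bernoulli_pmf (pa e)) (a e)) * (\<Prod>e\<in>PS. pmf (bernoulli_pmf p) (s e)))"
    unfolding eq by (subst SM.emeasure_pair_measure_Times[OF a(1) s(1)]) (simp add: a(2) s(2) ennreal_mult prod_nonneg)
  then show "measure (NM \<Otimes>\<^sub>M SM) {(a, s)} = (\<Prod>e\<in>PS. pmf (bernoulli_pmf (pa e)) (a e)) * (\<Prod>e\<in>PS. pmf (bernoulli_pmf p) (s e))"
    by (simp add: measure_def prod_nonneg)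
qed

text \<open>Network and sampling act on \<open>Mbar\<close> only through \<open>cut\<close>, and
  this identifies the law of \<open>cut\<close> with \<open>bern PS pr\<close>.\<close>

lemma good_pairs_weight:
  "(\<Sum>(a,s)\<in>{(a,s). a \<in> Om \<and> s \<in> Om \<and> cut a s \<in> G}. measure (NM \<Otimes>\<^sub>M SM) {(a, s)}) = bprob PS pr G"
proof -
  define wa where "wa a = (\<Prod>e\<in>PS. pmf (bernoulli_pmf (pa e)) (a e))" for a
  define ws where "ws s = (\<Prod>e\<in>PS. pmf (bernoulli_pmf p) (s e))" for s
  have "(\<Sum>(a,s)\<in>{(a,s). a \<in> Om \<and> s \<in> Om \<and> cut a s \<in> G}. measure (NM \<Otimes>\<^sub>M SM) {(a, s)}) =
    (\<Sum>(a,s)\<in>Om \<times> Om. wa a * (ws s * indicator G (cut a s)))"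
    by (rule sum.mono_neutral_cong_left) (auto simp: finite_Om atom wa_def ws_def indicator_def)
  also have "\<dots> = (\<Sum>a\<in>Om. wa a * (\<Sum>s\<in>Om. ws s * indicator G (\<lambda>e. (e \<in> PS \<and> a e) \<and> (e \<in> PS \<and> s e))))"
  proof -
    have "cut a s = (\<lambda>e. (e \<in> PS \<and> a e) \<and> (e \<in> PS \<and> s e))" for a s by (auto simp: cut_def fun_eq_iff)
    then show ?thesis by (simp add: sum.cartesian_product[symmetric] sum_distrib_left)
  qed
  also have "\<dots> = (\<Sum>a\<in>Om. wa a * bexp PS (\<lambda>_. p) (\<lambda>s. indicator G (\<lambda>e. (e \<in> PS \<and> a e) \<and> s e)))"
    by (subst bexp_sum_PiE) (use p in \<open>auto simp: finite_pair_set Om_def ws_def\<close>)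
  also have "\<dots> = bexp PS pa (\<lambda>a. bexp PS (\<lambda>_. p) (\<lambda>s. indicator G (\<lambda>e. a e \<and> s e)))"
    by (subst (2) bexp_sum_PiE) (use pa in \<open>auto simp: finite_pair_set Om_def wa_def\<close>)
  also have "\<dots> = bexp PS (\<lambda>e. pa e * p) (indicator G)"
    using bexp_conj[of PS pa "\<lambda>_. p" "indicator G"] pa p finite_pair_set by simp
  also have "\<dots> = bexp PS pr (indicator G)"
    unfolding bexp_def bern_def
    by (rule arg_cong[where f = "\<lambda>q. measure_pmf.expectation q _"], rule Pi_pmf_cong) (auto simp: pa_pr)
  also have "\<dots> = bprob PS pr G" by (simp add: bexp_def bprob_def)
  finally show ?thesis .
qed

text \<open>The section \<open>H a s\<close> may depend on the outcome in any way: there are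
  finitely many pairs and each is an atom, so the event is a finite disjoint union of measurable
  rectangles. This is why eigenvectors and clusterings never have to be measurable functions of the
  data.\<close>

lemma product_event:
  assumes H: "\<And>a s. a \<in> Om \<Longrightarrow> s \<in> Om \<Longrightarrow> H a s \<in> sets (gaussian_measure n K) \<and> h \<le> measure (gaussian_measure n K) (H a s)" and h: "0 \<le> h"
  shows "\<exists>E\<in>sets (rsc_space L n K g BB p). h * bprob PS pr G \<le> measure (rsc_space L n K g BB p) E \<and>
    (\<forall>((a,s),W)\<in>E. cut a s \<in> G \<and> a \<in> Om \<and> s \<in> Om \<and> W \<in> H a s)"
proof -
  let ?R = "rsc_space L n K g BB p"
  define I where "I = {(a,s). a \<in> Om \<and> s \<in> Om \<and> cut a s \<in> G}"
  define F where "F = (\<lambda>(a,s). {(a,s)} \<times> H a s)"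
  have finI: "finite I" unfolding I_def by (rule finite_subset[of _ "Om \<times> Om"]) (auto simp: finite_Om)
  have R: "?R = (NM \<Otimes>\<^sub>M SM) \<Otimes>\<^sub>M gaussian_measure n K" by (simp add: rsc_space_def)
  have Fs: "F i \<in> sets ?R" if "i \<in> I" for i
    using that H unfolding F_def I_def R by (auto intro!: pair_measureI atom)
  have Fm: "measure ?R (F i) \<ge> h * measure (NM \<Otimes>\<^sub>M SM) {i}" if "i \<in> I" for i
  proof -
    obtain a s where i: "i = (a,s)" "a \<in> Om" "s \<in> Om" using \<open>i \<in> I\<close> by (auto simp: I_def)
    have "emeasure ?R (F i) = emeasure (NM \<Otimes>\<^sub>M SM) {i} * emeasure (gaussian_measure n K) (H a s)"
      unfolding R F_def i(1) prod.case using H[OF i(2,3)] atom(1)[OF i(2,3)] by (intro GM.emeasure_pair_measure_Times) auto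
    then have "measure ?R (F i) = measure (NM \<Otimes>\<^sub>M SM) {i} * measure (gaussian_measure n K) (H a s)"
      by (simp add: measure_def enn2real_mult)
    also have "\<dots> \<ge> measure (NM \<Otimes>\<^sub>M SM) {i} * h" using H[OF i(2,3)] by (intro mult_left_mono) auto
    finally show ?thesis by (simp add: mult.commute)
  qed
  have disj: "disjoint_family_on F I" by (auto simp: disjoint_family_on_def F_def)
  interpret R: prob_space ?R unfolding R by (rule RS.prob_space_axioms)
  have "h * bprob PS pr G = (\<Sum>i\<in>I. h * measure (NM \<Otimes>\<^sub>M SM) {i})"
    unfolding good_pairs_weight[symmetric] I_def[symmetric] sum_distrib_left by (rule sum.cong) auto
  also have "\<dots> \<le> (\<Sum>i\<in>I. measure ?R (F i))" by (intro sum_mono Fm)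
  also have "\<dots> = measure ?R (\<Union>i\<in>I. F i)"
    using Fs by (intro R.finite_measure_finite_Union[symmetric] finI disj) auto
  finally have m: "h * bprob PS pr G \<le> measure ?R (\<Union>i\<in>I. F i)" .
  have "(\<Union>i\<in>I. F i) \<in> sets ?R" using Fs finI by (intro sets.finite_UN) auto
  then show ?thesis using m by (intro bexI[of _ "\<Union>i\<in>I. F i"]) (auto simp: I_def F_def)
qed

lemma prob_space_rsc: "prob_space (rsc_space L n K g BB p)"
  unfolding rsc_space_def by (rule RS.prob_space_axioms)

end

section \<open>Rates\<close>

text \<open>The moment order: large enough for powers of \<open>L + n\<close> to become constants
  after the root.\<close>

definition mlog :: "nat \<Rightarrow> nat \<Rightarrow> nat" where "mlog L n = nat \<lceil>ln (real L + real n)\<rceil>"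

lemma mlog:
  assumes "1 \<le> n" "1 \<le> L"
  shows "1 \<le> mlog L n" "real L + real n \<le> exp (real (mlog L n))" "real (mlog L n) \<le> 3 * ln (real L + real n)"
    "0 < ln (real L + real n)"
proof -
  let ?l = "ln (real L + real n)"
  have "2 \<le> real L + real n" using assms by simp
  then have "ln 2 \<le> ?l" by simp
  then have l: "2 / 3 \<le> ?l" using ln2_ge_two_thirds by linarith
  show "0 < ?l" using l by linarith
  have "0 < \<lceil>?l\<rceil>" using l by (simp add: less_ceiling_iff)
  then have r: "real (mlog L n) = of_int \<lceil>?l\<rceil>" by (simp add: mlog_def)
  have ge: "?l \<le> real (mlog L n)" unfolding r by (rule le_of_int_ceiling)
  show "1 \<le> mlog L n" using \<open>0 < \<lceil>?l\<rceil>\<close> unfolding mlog_def by linarith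
  have "real L + real n = exp ?l" using assms by (simp add: exp_ln)
  also have "\<dots> \<le> exp (real (mlog L n))" using ge by simp
  finally show "real L + real n \<le> exp (real (mlog L n))" .
  \<comment> \<open>Rounding up adds at most 1, which is at most \<open>3 / 2\<close> times the
    logarithm.\<close>
  have "real (mlog L n) < ?l + 1" unfolding r by linarith
  then show "real (mlog L n) \<le> 3 * ?l" using l by linarith
qed

section \<open>The relative noise level\<close>

context sbm
begin

definition dl :: real where "dl = real n * be"
text \<open>As long as it is at most 1, this dominates up to constants the squared ratio of edge
  noise and signal; \<open>dl\<close> is a bound for the expected degree after sampling.\<close>

definition theta :: real where
  "theta = real (mlog L n) * (dl + real (mlog L n)) / (real L * dl\<^sup>2)"
definition nu :: real where
  "nu = 2 * sqrt (exp 3 * (2 * real (mlog L n) * (4096 * real L * (real n * be)\<^sup>2 * (16 * real n * be + 4 * real (mlog L n) + 2)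
     + 16 * (real (mlog L n) + 1) * (16 * real n * be + 4 * real (mlog L n) + 2)\<^sup>2)))"
definition et :: real where "et = (nu + 3 * real L * real n * be\<^sup>2) / sg"

lemma dl0: "0 < dl" unfolding dl_def using n1 be0 by simp

lemma theta0: "0 < theta"
  unfolding theta_def using mlog(1)[OF n1 L1] dl0 L1 by (intro divide_pos_pos mult_pos_pos add_pos_pos) auto

lemma nu0: "0 \<le> nu"
  unfolding nu_def using be0 by (intro mult_nonneg_nonneg real_sqrt_ge_zero add_nonneg_nonneg) auto

text \<open>Squared edge noise over squared signal is at most a constant times
  \<open>theta + theta^2\<close>, the second term coming from the part of \<open>Bw\<close> without
  the factor \<open>L\<close>; it is absorbed because \<open>theta\<close> is at most 1. The bias
  has relative size \<open>1 / n\<close>.\<close>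

lemma eta_square_bound:
  assumes th: "theta \<le> 1"
  shows "et\<^sup>2 \<le> (32 * exp 3 * 65536 + 18) * (b\<^sup>2 * (real K)\<^sup>2 / c ^ 3)\<^sup>2 * (theta + 1 / (real n)\<^sup>2)"
proof -
  define m where "m = real (mlog L n)"
  have m1: "1 \<le> m" using mlog(1)[OF n1 L1] by (simp add: m_def)
  define rr where "rr = b\<^sup>2 * (real K)\<^sup>2 / c ^ 3"
  have rr0: "0 < rr" unfolding rr_def using b1 K1 c0 by simp
  have n0: "0 < real n" using n1 by simp
  define Ld where "Ld = real L * dl\<^sup>2"
  have Ld0: "0 < Ld" unfolding Ld_def using L1 dl0 by simp
  have sgr: "sg = Ld / rr"
    unfolding sg_def Ld_def rr_def dl_def be_def using b1 K1 c0 by (simp add: power_mult_distrib)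
  define Bd where "Bd = 16 * dl + 4 * m + 2"
  define Bw where "Bw = 4096 * real L * dl\<^sup>2 * Bd + 16 * (m + 1) * Bd\<^sup>2"
  have Bd0: "0 \<le> Bd" unfolding Bd_def using dl0 m1 by simp
  have Bd: "Bd \<le> 16 * (dl + m)" unfolding Bd_def using m1 dl0 by simp
  have Bd2: "Bd\<^sup>2 \<le> 256 * (dl + m)\<^sup>2"
  proof -
    have "Bd\<^sup>2 \<le> (16 * (dl + m))\<^sup>2" using Bd Bd0 by (intro power_mono)
    then show ?thesis by (simp only: power_mult_distrib) simp
  qed
  have "Bw \<le> 4096 * real L * dl\<^sup>2 * (16 * (dl + m)) + 16 * (2 * m) * (256 * (dl + m)\<^sup>2)"
    unfolding Bw_def using Bd Bd0 Bd2 m1 dl0 by (intro add_mono mult_mono) auto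
  also have "\<dots> \<le> 65536 * (Ld * (dl + m) + m * (dl + m)\<^sup>2)"
  proof -
    have "0 \<le> m * (dl + m)\<^sup>2" using m1 by simp
    then show ?thesis by (simp add: Ld_def algebra_simps)
  qed
  finally have Bw: "Bw \<le> 65536 * (Ld * (dl + m) + m * (dl + m)\<^sup>2)" .
  have Bw0: "0 \<le> Bw" unfolding Bw_def using Bd0 m1 by simp
  have nu2: "nu\<^sup>2 = 8 * exp 3 * (m * Bw)"
  proof -
    have "nu = 2 * sqrt (exp 3 * (2 * m * Bw))"
      unfolding nu_def m_def Bw_def Bd_def dl_def by (simp add: mult.assoc)
    then show ?thesis using Bw0 m1 by (simp add: power_mult_distrib)
  qed
  have th': "theta = m * (dl + m) / Ld" by (simp add: theta_def m_def Ld_def)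
  have "m * Bw \<le> m * (65536 * (Ld * (dl + m) + m * (dl + m)\<^sup>2))" using Bw m1 by (intro mult_left_mono) auto
  also have "\<dots> = 65536 * (Ld\<^sup>2 * (theta + theta\<^sup>2))"
    unfolding th' using Ld0 by (simp add: power2_eq_square field_simps)
  also have "\<dots> \<le> 65536 * (Ld\<^sup>2 * (theta + theta))"
  proof (intro mult_left_mono add_mono)
    show "theta\<^sup>2 \<le> theta" using th theta0 by (simp add: power2_eq_square mult_le_cancel_right1)
  qed auto
  finally have mB: "m * Bw \<le> 131072 * (Ld\<^sup>2 * theta)" by simp
  have "8 * exp 3 * (m * Bw) \<le> 8 * exp 3 * (131072 * (Ld\<^sup>2 * theta))" using mB by (intro mult_left_mono) auto
  then have "nu\<^sup>2 \<le> 16 * exp 3 * 65536 * (Ld\<^sup>2 * theta)" unfolding nu2 by simp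
  then have "(nu / sg)\<^sup>2 \<le> 16 * exp 3 * 65536 * (Ld\<^sup>2 * theta) / sg\<^sup>2"
    unfolding power_divide by (intro divide_right_mono) auto
  also have "\<dots> = 16 * exp 3 * 65536 * rr\<^sup>2 * theta"
    unfolding sgr using Ld0 rr0 by (simp add: power_divide)
  finally have 1: "(nu / sg)\<^sup>2 \<le> 16 * exp 3 * 65536 * rr\<^sup>2 * theta" .
  have 2: "3 * real L * real n * be\<^sup>2 / sg = 3 * rr / real n"
    unfolding sgr Ld_def dl_def using n0 be0 L1 by (simp add: power_mult_distrib power2_eq_square)
  have "et = nu / sg + 3 * rr / real n" unfolding et_def add_divide_distrib 2 ..
  moreover have "(u + v)\<^sup>2 \<le> 2 * u\<^sup>2 + 2 * v\<^sup>2" for u v :: real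
    using zero_le_power2[of "u - v"] by (simp add: power2_eq_square algebra_simps)
  ultimately have "et\<^sup>2 \<le> 2 * (nu / sg)\<^sup>2 + 2 * (3 * rr / real n)\<^sup>2" by (simp only:)
  also have "\<dots> \<le> 2 * (16 * exp 3 * 65536 * rr\<^sup>2 * theta) + 18 * rr\<^sup>2 * (1 / (real n)\<^sup>2)"
    using 1 by (simp add: power_divide power_mult_distrib)
  also have "\<dots> \<le> (32 * exp 3 * 65536 + 18) * rr\<^sup>2 * (theta + 1 / (real n)\<^sup>2)"
  proof -
    have "0 \<le> rr\<^sup>2 * theta" "0 \<le> exp 3 * (rr\<^sup>2 * (1 / (real n)\<^sup>2))" using theta0 by auto
    then show ?thesis by (simp add: algebra_simps)
  qed
  finally show ?thesis by (simp add: rr_def)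
qed

lemma et0: "0 \<le> et" unfolding et_def using nu0 sg0 by (intro divide_nonneg_pos add_nonneg_nonneg) auto

text \<open>The conditioning ratio \<open>Fr / tau\<close> of the test matrix equals
  \<open>n * Gam\<close>, so its growth in \<open>n\<close> is linear.\<close>

definition Gam :: real where "Gam = sqrt (2 * exp (real K)) * real K * (2 * real K) * exp (real K)"

lemma small_noise_event:
  assumes q: "aq * ln (real n) \<le> real q" and aq: "0 < aq"
    and e0: "et \<le> 1 / 16" "2 * et \<le> exp (- 1 / (2 * aq))" "2 * et * (1 + Gam) \<le> 1 / 4"
    and k3: "k3 = 2 * (2 * (1 + Gam) * (b\<^sup>2 * (real K)\<^sup>2 / c ^ 3) + 1)"
    and e1: "real K * (k3 * et)\<^sup>2 \<le> 1 / 2" "16 * real K * C * (k3 * et)\<^sup>2 < c / real K"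
  shows "\<exists>E\<in>sets (rsc_space L n K g BB p). 1 - 3 / (real L + real n) - exp (- real K) \<le> measure (rsc_space L n K g BB p) E \<and>
    (\<forall>((a,s),W)\<in>E. \<forall>h\<in>rsc_outputs L n K q p a s W. misclass_rate n K (membership g) (membership h) \<le> 16 * real K * C * (k3 * et)\<^sup>2)"
proof -
  define G where "G = {w. \<forall>x\<in>V n. norm (mv n n (F1 w) x) + norm (mv n n (F2 w) x) \<le> nu * norm x}"
  have "bprob PS pr (- G) \<le> 3 / (real L + real n)"
    using noise_operator_bound[OF mlog(1,2)[OF n1 L1] be0] unfolding G_def nu_def Compl_eq mem_Collect_eq .
  moreover have "bprob PS pr G = 1 - bprob PS pr (- G)"
    unfolding bprob_def using measure_pmf.prob_compl[of "- G" "bern PS pr"] by (simp add: Compl_eq_Diff_UNIV[symmetric])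
  ultimately have PG: "1 - 3 / (real L + real n) \<le> bprob PS pr G" by linarith
  define tau where "tau = exp (- real K) / (2 * real K * sqrt (real n)) / sqrt (real K)"
  define Fr where "Fr = sqrt (2 * exp (real K) * (real n * real K))"
  have tau0: "0 < tau" unfolding tau_def using K1 n1 by simp
  have Fr0: "0 \<le> Fr" unfolding Fr_def by simp
  let ?ok = "\<lambda>a s H. H \<in> sets (gaussian_measure n K) \<and> 1 - exp (- real K) \<le> measure (gaussian_measure n K) H \<and>
    (\<forall>W\<in>H. sqrt (\<Sum>k<K. (norm (mkv n (\<lambda>i. W (i,k))))\<^sup>2) \<le> Fr \<and>
      (\<forall>y. \<exists>x. (\<forall>j<K. (\<Sum>k<K. inner (evec n (Mbar L n p a s) j) (mkv n (\<lambda>i. W (i,k))) * x k) = y j) \<and>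
        tau * sqrt (\<Sum>k<K. (x k)\<^sup>2) \<le> sqrt (\<Sum>k<K. (y k)\<^sup>2)))"
  have ex_ok: "\<exists>H. ?ok a s H" for a s
  proof -
    have on: "orthonormal K (evec n (Mbar L n p a s))" and V: "\<And>j. j < K \<Longrightarrow> evec n (Mbar L n p a s) j \<in> V n"
      using evec_facts(1,2)[OF symm_Mbar[of a s]] K_le_n by (auto simp: orthonormal_def)
    note ev = gaussian_good_event[OF on V K1 n1, folded tau_def Fr_def]
    show ?thesis using ev unfolding Bex_def .
  qed
  \<comment> \<open>One good Gaussian event for each network and sample, adapted to the eigenvectors
    of that realisation.\<close>
  define H where "H a s = (SOME H. ?ok a s H)" for a s
  have H: "?ok a s (H a s)" for a s unfolding H_def by (rule someI_ex) (rule ex_ok)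
  have HO: "H a s \<in> sets (gaussian_measure n K) \<and> 1 - exp (- real K) \<le> measure (gaussian_measure n K) (H a s)" for a s
    using H[of a s] by blast
  obtain E where E: "E \<in> sets (rsc_space L n K g BB p)" "(1 - exp (- real K)) * bprob PS pr G \<le> measure (rsc_space L n K g BB p) E"
    and E': "\<forall>((a,s),W)\<in>E. cut a s \<in> G \<and> a \<in> Om \<and> s \<in> Om \<and> W \<in> H a s"
    using product_event[of H "1 - exp (- real K)" G, OF HO] by auto
  have E3: "cut a s \<in> G \<and> W \<in> H a s" if "((a,s),W) \<in> E" for a s W using bspec[OF E' that] by simp
  have "1 - 3 / (real L + real n) - exp (- real K) \<le> (1 - exp (- real K)) * bprob PS pr G"
  proof -
    have "bprob PS pr G \<le> 1" unfolding bprob_def by simp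
    then have "exp (- real K) * bprob PS pr G \<le> exp (- real K)" by simp
    then show ?thesis using PG unfolding left_diff_distrib mult_1_left by linarith
  qed
  then have ME: "1 - 3 / (real L + real n) - exp (- real K) \<le> measure (rsc_space L n K g BB p) E" using E(2) by linarith
  have FrT: "Fr / tau = real n * Gam"
  proof -
    have K0: "0 < real K" and n0: "0 < real n" using K1 n1 by auto
    have "Fr / tau = (sqrt (2 * exp (real K)) * (sqrt (real n) * sqrt (real K))) * (2 * real K * sqrt (real n)) * sqrt (real K) * exp (real K)"
      unfolding Fr_def tau_def using K0 n0 by (simp add: real_sqrt_mult exp_minus field_simps)
    also have "\<dots> = sqrt (2 * exp (real K)) * (sqrt (real n) * sqrt (real n)) * (sqrt (real K) * sqrt (real K)) * (2 * real K) * exp (real K)"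
      by (simp only: mult_ac)
    finally show ?thesis by (simp add: Gam_def)
  qed
  have Gam0: "0 \<le> Gam" unfolding Gam_def by (intro mult_nonneg_nonneg) auto
  define de where "de = 2 * et + (2 * et) ^ (2 * q + 1) * (Fr / tau)"
  \<comment> \<open>This is where \<open>q\<close> of order \<open>ln n\<close> enters:
    \<open>2 * et\<close> is at most \<open>exp (- 1 / (2 * aq))\<close>, so its
    \<open>2 q\<close>-th power is at most \<open>1 / n\<close> and cancels the linear growth of
    \<open>Fr / tau\<close>.\<close>
  have pw: "(2 * et) ^ (2 * q) * real n \<le> 1"
  proof -
    have "(2 * et) ^ (2 * q) \<le> exp (- 1 / (2 * aq)) ^ (2 * q)" using e0 et0 by (intro power_mono) auto
    also have "\<dots> = exp (real (2 * q) * (- 1 / (2 * aq)))" by (rule exp_of_nat_mult[symmetric])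
    also have "\<dots> \<le> exp (- ln (real n))"
    proof -
      have "ln (real n) \<le> real q / aq" using q aq by (simp add: pos_le_divide_eq mult.commute)
      then show ?thesis by simp
    qed
    also have "\<dots> = 1 / real n" using n1 by (simp add: exp_minus inverse_eq_divide)
    finally show ?thesis using n1 by (simp add: field_simps)
  qed
  have de_le: "de \<le> 2 * et * (1 + Gam)"
  proof -
    have "(2 * et) ^ (2 * q + 1) * (Fr / tau) = (2 * et * Gam) * ((2 * et) ^ (2 * q) * real n)"
      unfolding FrT by (simp add: mult_ac)
    also have "\<dots> \<le> (2 * et * Gam) * 1" using pw et0 Gam0 by (intro mult_left_mono) auto
    finally show ?thesis by (simp add: de_def algebra_simps)
  qed
  have de0: "0 \<le> de" unfolding de_def using et0 tau0 Fr0 by (intro add_nonneg_nonneg mult_nonneg_nonneg) auto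
  define rr where "rr = b\<^sup>2 * (real K)\<^sup>2 / c ^ 3"
  have rr0: "0 \<le> rr" unfolding rr_def using c0 by simp
  define ep where "ep = 2 * (de * rr + et)"
  have ep0: "0 \<le> ep" unfolding ep_def using de0 rr0 et0 by (intro mult_nonneg_nonneg add_nonneg_nonneg) auto
  have "de * rr \<le> 2 * et * (1 + Gam) * rr" using de_le rr0 by (rule mult_right_mono)
  then have "ep \<le> k3 * et" unfolding ep_def k3 rr_def[symmetric] by (simp add: algebra_simps)
  then have ep2: "ep\<^sup>2 \<le> (k3 * et)\<^sup>2" using ep0 by (rule power_mono)
  have K2: "real K * ep\<^sup>2 \<le> real K * (k3 * et)\<^sup>2" using ep2 by (intro mult_left_mono) auto
  have C2: "16 * real K * C * ep\<^sup>2 \<le> 16 * real K * C * (k3 * et)\<^sup>2" using ep2 C0 by (intro mult_left_mono) auto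
  have "misclass_rate n K (membership g) (membership h) \<le> 16 * real K * C * (k3 * et)\<^sup>2"
    if "((a,s),W) \<in> E" and h: "h \<in> rsc_outputs L n K q p a s W" for a s W h
  proof -
    have "cut a s \<in> G" and W: "W \<in> H a s" using E3[OF that(1)] by auto
    then have noise: "norm (mv n n (F1 (cut a s)) x) + norm (mv n n (F2 (cut a s)) x) \<le> nu * norm x" if "x \<in> V n" for x
      using that by (simp add: G_def)
    have "misclass_rate n K (membership g) (membership h) \<le> 16 * real K * C * ep\<^sup>2"
    proof (rule recovery[OF nu0 noise et_def e0(1) tau0 Fr0 _ _ de_def _ ep_def[unfolded rr_def] _ _ h])
      show "sqrt (\<Sum>k<K. (norm (mkv n (\<lambda>i. W (i, k))))\<^sup>2) \<le> Fr" using H[of a s] W by blast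
      show "\<exists>x. (\<forall>j<K. (\<Sum>k<K. inner (evec n (Mbar L n p a s) j) (mkv n (\<lambda>i. W (i,k))) * x k) = y j) \<and>
        tau * sqrt (\<Sum>k<K. (x k)\<^sup>2) \<le> sqrt (\<Sum>k<K. (y k)\<^sup>2)" for y using H[of a s] W by blast
      show "de \<le> 1 / 4" using de_le e0(3) by linarith
      show "real K * ep\<^sup>2 \<le> 1 / 2" using K2 e1(1) by linarith
      show "16 * real K * C * ep\<^sup>2 < c / real K" using C2 e1(2) by linarith
    qed
    then show ?thesis using C2 by linarith
  qed
  then show ?thesis using E(1) ME by (intro bexI[of _ E]) auto
qed

end

section \<open>Uniform constants and the two density regimes\<close>

lemma rsc_outputs_labels: "h \<in> rsc_outputs L n K q p A S W \<Longrightarrow> i < n \<Longrightarrow> h i < K"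
  unfolding rsc_outputs_def kmeans_opt_def by auto

lemma rsc_recovery:
  assumes K1: "1 \<le> K" and c0: "0 < c" and C0: "0 < C" and b1: "1 \<le> b" and aq: "0 < aq"
  shows "\<exists>D>0. \<forall>n L p rho g B0 q. sbm K n L g B0 b rho c C p \<and> aq * ln (real n) \<le> real q \<longrightarrow>
    (\<exists>E\<in>sets (rsc_space L n K g (\<lambda>l k k'. rho * B0 l k k') p).
      1 - 3 / (real L + real n) - exp (- real K) \<le> measure (rsc_space L n K g (\<lambda>l k k'. rho * B0 l k k') p) E \<and>
      (\<forall>((a,s),W)\<in>E. \<forall>h\<in>rsc_outputs L n K q p a s W.
         misclass_rate n K (membership g) (membership h) \<le> D * (sbm.theta n L b rho p + 1 / (real n)\<^sup>2)))"
proof -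
  define G where "G = sqrt (2 * exp (real K)) * real K * (2 * real K) * exp (real K)"
  have G0: "0 \<le> G" unfolding G_def by (intro mult_nonneg_nonneg) auto
  define rr where "rr = b\<^sup>2 * (real K)\<^sup>2 / c ^ 3"
  have rr0: "0 < rr" unfolding rr_def using b1 K1 c0 by simp
  define k3 where "k3 = 2 * (2 * (1 + G) * rr + 1)"
  have k30: "0 < k3" unfolding k3_def using G0 rr0 by (intro mult_pos_pos add_nonneg_pos) auto
  define C2 where "C2 = (32 * exp 3 * 65536 + 18) * rr\<^sup>2"
  have C20: "0 < C2" unfolding C2_def using rr0 by (intro mult_pos_pos add_pos_pos) auto
  define y where "y = min (1 / (2 * real K)) (c / (32 * (real K)\<^sup>2 * C))"
  have y0: "0 < y" unfolding y_def using K1 c0 C0 by simp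
  \<comment> \<open>A noise level below which all conditions of \<open>small_noise_event\<close>
    hold: spectral perturbation, decay of the powers, approximation by the Krylov space, and
    k-means.\<close>
  define e0 where "e0 = min (min (1 / 16) (exp (- 1 / (2 * aq)) / 2)) (min (1 / (8 * (1 + G))) (sqrt y / k3))"
  have e00: "0 < e0" unfolding e0_def using G0 y0 k30 by simp
  define eps where "eps = min 1 (e0\<^sup>2 / C2)"
  have eps0: "0 < eps" unfolding eps_def using e00 C20 by simp
  \<comment> \<open>The first entry makes the bound at least \<open>K\<close>, hence trivially true,
    as soon as \<open>theta + 1 / n^2\<close> reaches \<open>eps\<close>; the second is the product
    of the constants of the small-noise case.\<close>
  define D where "D = max (real K / eps) (16 * real K * C * k3\<^sup>2 * C2)"
  have D0: "0 < D" unfolding D_def using K1 eps0 by (simp add: less_max_iff_disj)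
  have "\<exists>E\<in>sets (rsc_space L n K g (\<lambda>l k k'. rho * B0 l k k') p).
      1 - 3 / (real L + real n) - exp (- real K) \<le> measure (rsc_space L n K g (\<lambda>l k k'. rho * B0 l k k') p) E \<and>
      (\<forall>((a,s),W)\<in>E. \<forall>h\<in>rsc_outputs L n K q p a s W.
         misclass_rate n K (membership g) (membership h) \<le> D * (sbm.theta n L b rho p + 1 / (real n)\<^sup>2))"
    if sbm: "sbm K n L g B0 b rho c C p" and q: "aq * ln (real n) \<le> real q" for n L p rho g B0 q
  proof -
    interpret sbm K n L g B0 b rho c C p by (rule sbm)
    define x where "x = theta + 1 / (real n)\<^sup>2"
    have x0: "0 \<le> x" unfolding x_def using theta0 by simp
    show ?thesis
    proof (cases "eps \<le> x")
      case True
      have "real K = real K / eps * eps" using eps0 by simp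
      also have "\<dots> \<le> D * x" using True eps0 D0 by (intro mult_mono) (auto simp: D_def)
      finally have KD: "real K \<le> D * x" .
      interpret R: prob_space "rsc_space L n K g BB p" by (rule prob_space_rsc)
      have "misclass_rate n K (membership g) (membership h) \<le> D * x" if "h \<in> rsc_outputs L n K q p a s W" for a s W h
        using misclass_rate_trivial[OF n1 rsc_outputs_labels[OF that]] KD by (rule order_trans)
      moreover have "1 - 3 / (real L + real n) - exp (- real K) \<le> 1"
      proof -
        have "0 \<le> 3 / (real L + real n)" by simp
        moreover have "0 < exp (- real K)" by simp
        ultimately show ?thesis by linarith
      qed
      ultimately show ?thesis
        by (intro bexI[of _ "space (rsc_space L n K g BB p)"]) (auto simp: R.prob_space x_def)
    next
      case False
      have Gm: "Gam = G" by (simp add: Gam_def G_def)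
      have th1: "theta \<le> 1" using False theta0 unfolding x_def eps_def
        by (smt (verit) zero_le_divide_1_iff zero_le_power2 min.cobounded1)
      have et2: "et\<^sup>2 \<le> C2 * x" using eta_square_bound[OF th1] by (simp add: C2_def rr_def x_def)
      also have "\<dots> \<le> C2 * (e0\<^sup>2 / C2)" using False C20 by (intro mult_left_mono) (auto simp: eps_def)
      also have "\<dots> = e0\<^sup>2" using C20 by simp
      finally have ee: "et \<le> e0" using e00 by (intro power2_le_imp_le[of et e0]) auto
      have ke: "(k3 * et)\<^sup>2 \<le> y"
      proof -
        have "et \<le> sqrt y / k3" using ee by (simp add: e0_def)
        then have "k3 * et \<le> sqrt y" using k30 by (simp add: pos_le_divide_eq mult.commute)
        then have "(k3 * et)\<^sup>2 \<le> (sqrt y)\<^sup>2" using k30 et0 by (intro power_mono) auto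
        then show ?thesis using y0 by simp
      qed
      have K0: "0 < real K" using K1 by simp
      have half: "z / 2 < z" if "0 < z" for z :: real using that by simp
      have "\<exists>E\<in>sets (rsc_space L n K g BB p). 1 - 3 / (real L + real n) - exp (- real K) \<le> measure (rsc_space L n K g BB p) E \<and>
        (\<forall>((a,s),W)\<in>E. \<forall>h\<in>rsc_outputs L n K q p a s W. misclass_rate n K (membership g) (membership h) \<le> 16 * real K * C * (k3 * et)\<^sup>2)"
      proof (rule small_noise_event[OF q aq])
        show "et \<le> 1 / 16" "2 * et \<le> exp (- 1 / (2 * aq))" using ee by (auto simp: e0_def)
        have "et \<le> 1 / (8 * (1 + G))" using ee by (simp add: e0_def)
        then show "2 * et * (1 + Gam) \<le> 1 / 4" unfolding Gm using G0 by (simp add: field_simps)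
        show "k3 = 2 * (2 * (1 + Gam) * (b\<^sup>2 * (real K)\<^sup>2 / c ^ 3) + 1)" unfolding Gm k3_def rr_def ..
        have "real K * (k3 * et)\<^sup>2 \<le> real K * (1 / (2 * real K))" using ke by (intro mult_left_mono) (auto simp: y_def)
        then show "real K * (k3 * et)\<^sup>2 \<le> 1 / 2" using K0 by simp
        have "16 * real K * C * (k3 * et)\<^sup>2 \<le> 16 * real K * C * (c / (32 * (real K)\<^sup>2 * C))"
          using ke C0 by (intro mult_left_mono) (auto simp: y_def)
        also have "\<dots> = c / real K / 2" using K0 C0 by (simp add: power2_eq_square)
        also have "\<dots> < c / real K" using half[OF divide_pos_pos[OF c0 K0]] .
        finally show "16 * real K * C * (k3 * et)\<^sup>2 < c / real K" .
      qed
      moreover have "16 * real K * C * (k3 * et)\<^sup>2 \<le> D * x"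
      proof -
        have "16 * real K * C * (k3 * et)\<^sup>2 = 16 * real K * C * k3\<^sup>2 * et\<^sup>2" by (simp add: power_mult_distrib)
        also have "\<dots> \<le> 16 * real K * C * k3\<^sup>2 * (C2 * x)" using et2 C0 by (intro mult_left_mono) auto
        also have "\<dots> = 16 * real K * C * k3\<^sup>2 * C2 * x" by simp
        also have "\<dots> \<le> D * x" using x0 by (intro mult_right_mono) (auto simp: D_def)
        finally show ?thesis .
      qed
      ultimately show ?thesis unfolding x_def[symmetric] by (fastforce intro: order_trans)
    qed
  qed
  then show ?thesis using D0 by blast
qed

text \<open>Passing to \<open>max b 1\<close> covers small or vanishing \<open>b\<close> and makes
  \<open>be\<close> positive and at least \<open>rp\<close>.\<close>

lemma sbm_of_model:
  assumes "1 \<le> K" "0 < c" "0 < C" "sbm_model K n L g B0 b rho" "balanced K n g c C" "eigen_gap K L B0 c" "0 < p" "p \<le> 1"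
  shows "sbm K n L g B0 (max b 1) rho c C p"
  using assms unfolding sbm_def sbm_model_def by (auto simp: le_max_iff_disj)

text \<open>Bounded degrees: \<open>dl\<close> is at most a constant and so a multiple of the moment
  order, which makes \<open>dl + m\<close> of order \<open>m\<close>; both logarithms
  remain.\<close>

lemma theta_sparse:
  assumes "sbm K n L g B0 b rho c C p" and r2: "0 < r2" "rho \<le> r2 / (p * real n)"
  shows "sbm.theta n L b rho p \<le> 9 * (1 + b * r2) * ((ln (real L + real n))\<^sup>2 / (p ^ 3 * real L * (real n)\<^sup>2 * rho\<^sup>2))"
proof -
  interpret sbm K n L g B0 b rho c C p by fact
  define m where "m = real (mlog L n)"
  define l where "l = ln (real L + real n)"
  have m: "1 \<le> m" "m \<le> 3 * l" using mlog[OF n1 L1] by (auto simp: m_def l_def)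
  define d1 where "d1 = real n * rp"
  have d10: "0 < d1" using n1 rp0 by (simp add: d1_def)
  have d: "dl = b * d1" by (simp add: dl_def be_def d1_def)
  have "d1 \<le> r2" using r2 p n1 by (simp add: d1_def rp_def field_simps)
  then have dr: "dl \<le> b * r2" unfolding d using b1 by (intro mult_left_mono) auto
  have d1d: "d1 \<le> dl" unfolding d using b1 d10 by simp
  have br: "0 \<le> b * r2" using b1 r2 by simp
  have "m * (dl + m) \<le> m * ((1 + b * r2) * m)"
  proof (rule mult_left_mono)
    have "b * r2 * 1 \<le> b * r2 * m" using m br by (intro mult_left_mono) auto
    then show "dl + m \<le> (1 + b * r2) * m" using dr by (simp add: algebra_simps)
  qed (use m in simp)
  also have "\<dots> = (1 + b * r2) * m\<^sup>2" by (simp add: power2_eq_square)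
  also have "\<dots> \<le> (1 + b * r2) * (3 * l)\<^sup>2" using m br by (intro mult_left_mono power_mono) auto
  finally have num: "m * (dl + m) \<le> 9 * (1 + b * r2) * l\<^sup>2"
    by (simp only: power_mult_distrib) (simp add: algebra_simps)
  \<comment> \<open>As \<open>p\<close> is at most 1, the additional factor \<open>p\<close> in the
    denominator only enlarges the bound.\<close>
  have den: "p * (real L * d1\<^sup>2) \<le> real L * dl\<^sup>2"
  proof -
    have "d1\<^sup>2 \<le> dl\<^sup>2" using d1d d10 by (intro power_mono) auto
    then have "p * (real L * d1\<^sup>2) \<le> 1 * (real L * dl\<^sup>2)" using p by (intro mult_mono) auto
    then show ?thesis by simp
  qed
  have "theta \<le> 9 * (1 + b * r2) * l\<^sup>2 / (p * (real L * d1\<^sup>2))"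
    unfolding theta_def m_def[symmetric]
    using num den m dl0 br d10 p L1 by (intro frac_le) auto
  also have "p * (real L * d1\<^sup>2) = p ^ 3 * real L * (real n)\<^sup>2 * rho\<^sup>2"
    by (simp add: d1_def rp_def power2_eq_square power3_eq_cube)
  finally show ?thesis by (simp add: l_def)
qed

text \<open>Degrees at least of logarithmic order: here \<open>m\<close> is at most a multiple of
  \<open>dl\<close>, so one logarithm and one power of the degree cancel.\<close>

lemma theta_dense:
  assumes "sbm K n L g B0 b rho c C p" and r: "0 < r" "r * ln (real L + real n) / (p * real n) \<le> rho"
  shows "sbm.theta n L b rho p \<le> 3 * (1 + 3 / r) * (ln (real L + real n) / (p * real L * real n * rho))"
proof -
  interpret sbm K n L g B0 b rho c C p by fact
  define m where "m = real (mlog L n)"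
  define l where "l = ln (real L + real n)"
  have m: "1 \<le> m" "m \<le> 3 * l" using mlog[OF n1 L1] by (auto simp: m_def l_def)
  define d1 where "d1 = real n * rp"
  have d10: "0 < d1" using n1 rp0 by (simp add: d1_def)
  have d: "dl = b * d1" by (simp add: dl_def be_def d1_def)
  have d1d: "d1 \<le> dl" unfolding d using b1 d10 by simp
  have "r * l \<le> d1" using r p n1 by (simp add: d1_def rp_def l_def field_simps)
  then have "l \<le> dl / r" using r d1d by (simp add: field_simps)
  then have mr: "m \<le> 3 / r * dl" using m by simp
  have "m * (dl + m) \<le> (3 * l) * ((1 + 3 / r) * dl)"
    using m mr dl0 by (intro mult_mono) (auto simp: algebra_simps)
  then have "theta \<le> (3 * l) * ((1 + 3 / r) * dl) / (real L * dl\<^sup>2)"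
    unfolding theta_def m_def[symmetric] by (intro divide_right_mono) auto
  also have "\<dots> = 3 * (1 + 3 / r) * (l / (real L * dl))" using dl0 by (simp add: power2_eq_square)
  also have "\<dots> \<le> 3 * (1 + 3 / r) * (l / (real L * d1))"
    using d1d d10 dl0 L1 m r by (intro mult_left_mono divide_left_mono mult_pos_pos) auto
  also have "real L * d1 = p * real L * real n * rho" by (simp add: d1_def rp_def)
  finally show ?thesis by (simp add: l_def)
qed

lemma rate_max_bound:
  fixes th D x y :: real
  assumes "th \<le> k * x" "0 \<le> k" "0 < D"
  shows "D * (th + y) \<le> D * (k + 1) * max x y"
proof -
  have "k * x \<le> k * max x y" using assms by (intro mult_left_mono) auto
  then have "th + y \<le> (k + 1) * max x y" using assms(1) by (simp add: algebra_simps)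
  then show ?thesis using assms(3) by (simp add: mult.assoc)
qed

text \<open>The strict inequality comes from the second copy of \<open>exp (- K)\<close>, a positive
  slack.\<close>

lemma rate_event:
  fixes D th x y k :: real
  assumes ev: "E \<in> sets R" "1 - 3 / (real L + real n) - exp (- real K) \<le> measure R E"
    and L: "1 \<le> L"
    and mis: "\<forall>((a,s),W)\<in>E. \<forall>h\<in>rsc_outputs L n K q p a s W. f h \<le> D * (th + y)"
    and th: "th \<le> k * x" "0 \<le> k" "0 < D"
  shows "\<exists>E\<in>sets R. 1 - 3 * (real L + real n) powr (- 1) - 2 * exp (- 1 * real K) < measure R E \<and>
    (\<forall>((a,s),W)\<in>E. \<forall>h\<in>rsc_outputs L n K q p a s W. f h \<le> D * (k + 1) * max x y)"
proof (intro bexI[OF _ ev(1)] conjI)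
  have "(real L + real n) powr (- 1) = 1 / (real L + real n)" using L by (simp add: powr_minus_divide)
  moreover have "0 < exp (- real K)" by simp
  moreover have "exp (- 1 * real K) = exp (- real K)" by simp
  ultimately show "1 - 3 * (real L + real n) powr (- 1) - 2 * exp (- 1 * real K) < measure R E"
    using ev(2) by linarith
  show "\<forall>((a,s),W)\<in>E. \<forall>h\<in>rsc_outputs L n K q p a s W. f h \<le> D * (k + 1) * max x y"
    using mis rate_max_bound[OF th, of y] by (fastforce intro: order_trans)
qed

lemma sparse_rate:
  fixes b r2 :: real
  assumes K: "1 \<le> K" and pos: "0 < c" "0 < C" "0 < aq" "0 < r2"
  shows "\<exists>C1. \<forall>n L p \<rho> g B0 q.
    sbm_model K n L g B0 b \<rho> \<and> balanced K n g c C \<and> eigen_gap K L B0 c \<and>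
    0 < p \<and> p \<le> 1 \<and> aq * ln (real n) \<le> real q \<and> \<rho> \<le> r2 / (p * real n) \<longrightarrow>
    (\<exists>E\<in>sets (rsc_space L n K g (\<lambda>l k k'. \<rho> * B0 l k k') p).
      1 - 3 * (real L + real n) powr (- 1) - 2 * exp (- 1 * real K)
        < measure (rsc_space L n K g (\<lambda>l k k'. \<rho> * B0 l k k') p) E \<and>
      (\<forall>((A, S), W)\<in>E. \<forall>h\<in>rsc_outputs L n K q p A S W.
        misclass_rate n K (membership g) (membership h) \<le> C1 * max ((ln (real L + real n))\<^sup>2 / (p ^ 3 * real L * (real n)\<^sup>2 * \<rho>\<^sup>2)) (1 / (real n)\<^sup>2)))"
proof -
  obtain D where D: "0 < D" and ev: "\<forall>n L p rho g B0 q. sbm K n L g B0 (max b 1) rho c C p \<and> aq * ln (real n) \<le> real q \<longrightarrow>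
    (\<exists>E\<in>sets (rsc_space L n K g (\<lambda>l k k'. rho * B0 l k k') p).
      1 - 3 / (real L + real n) - exp (- real K) \<le> measure (rsc_space L n K g (\<lambda>l k k'. rho * B0 l k k') p) E \<and>
      (\<forall>((a,s),W)\<in>E. \<forall>h\<in>rsc_outputs L n K q p a s W.
         misclass_rate n K (membership g) (membership h) \<le> D * (sbm.theta n L (max b 1) rho p + 1 / (real n)\<^sup>2)))"
    using rsc_recovery[of K c C "max b 1" aq] K pos by auto
  show ?thesis
  proof (rule exI[of _ "D * (9 * (1 + max b 1 * r2) + 1)"], intro allI impI)
    fix n L :: nat and p \<rho> :: real and g B0 and q :: nat
    assume a: "sbm_model K n L g B0 b \<rho> \<and> balanced K n g c C \<and> eigen_gap K L B0 c \<and>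
      0 < p \<and> p \<le> 1 \<and> aq * ln (real n) \<le> real q \<and> \<rho> \<le> r2 / (p * real n)"
    have sbm: "sbm K n L g B0 (max b 1) \<rho> c C p" by (rule sbm_of_model) (use a K pos in auto)
    obtain E where E: "E \<in> sets (rsc_space L n K g (\<lambda>l k k'. \<rho> * B0 l k k') p)"
        "1 - 3 / (real L + real n) - exp (- real K) \<le> measure (rsc_space L n K g (\<lambda>l k k'. \<rho> * B0 l k k') p) E"
        "\<forall>((a,s),W)\<in>E. \<forall>h\<in>rsc_outputs L n K q p a s W.
         misclass_rate n K (membership g) (membership h) \<le> D * (sbm.theta n L (max b 1) \<rho> p + 1 / (real n)\<^sup>2)"
      using ev[rule_format, of n L g B0 \<rho> p q] sbm a by blast
    show "\<exists>E\<in>sets (rsc_space L n K g (\<lambda>l k k'. \<rho> * B0 l k k') p).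
      1 - 3 * (real L + real n) powr (- 1) - 2 * exp (- 1 * real K)
        < measure (rsc_space L n K g (\<lambda>l k k'. \<rho> * B0 l k k') p) E \<and>
      (\<forall>((A, S), W)\<in>E. \<forall>h\<in>rsc_outputs L n K q p A S W.
        misclass_rate n K (membership g) (membership h)
          \<le> D * (9 * (1 + max b 1 * r2) + 1) * max ((ln (real L + real n))\<^sup>2 / (p ^ 3 * real L * (real n)\<^sup>2 * \<rho>\<^sup>2)) (1 / (real n)\<^sup>2))"
      by (rule rate_event[OF E(1,2) _ E(3) theta_sparse[OF sbm] _ D]) (use a pos in \<open>auto simp: sbm_model_def\<close>)
  qed
qed

lemma dense_rate:
  fixes b r :: real
  assumes K: "1 \<le> K" and pos: "0 < c" "0 < C" "0 < aq" "0 < r"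
  shows "\<exists>C1. \<forall>n L p \<rho> g B0 q.
    sbm_model K n L g B0 b \<rho> \<and> balanced K n g c C \<and> eigen_gap K L B0 c \<and>
    0 < p \<and> p \<le> 1 \<and> aq * ln (real n) \<le> real q \<and> r * ln (real L + real n) / (p * real n) \<le> \<rho> \<longrightarrow>
    (\<exists>E\<in>sets (rsc_space L n K g (\<lambda>l k k'. \<rho> * B0 l k k') p).
      1 - 3 * (real L + real n) powr (- 1) - 2 * exp (- 1 * real K)
        < measure (rsc_space L n K g (\<lambda>l k k'. \<rho> * B0 l k k') p) E \<and>
      (\<forall>((A, S), W)\<in>E. \<forall>h\<in>rsc_outputs L n K q p A S W.
        misclass_rate n K (membership g) (membership h) \<le> C1 * max (ln (real L + real n) / (p * real L * real n * \<rho>)) (1 / (real n)\<^sup>2)))"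
proof -
  obtain D where D: "0 < D" and ev: "\<forall>n L p rho g B0 q. sbm K n L g B0 (max b 1) rho c C p \<and> aq * ln (real n) \<le> real q \<longrightarrow>
    (\<exists>E\<in>sets (rsc_space L n K g (\<lambda>l k k'. rho * B0 l k k') p).
      1 - 3 / (real L + real n) - exp (- real K) \<le> measure (rsc_space L n K g (\<lambda>l k k'. rho * B0 l k k') p) E \<and>
      (\<forall>((a,s),W)\<in>E. \<forall>h\<in>rsc_outputs L n K q p a s W.
         misclass_rate n K (membership g) (membership h) \<le> D * (sbm.theta n L (max b 1) rho p + 1 / (real n)\<^sup>2)))"
    using rsc_recovery[of K c C "max b 1" aq] K pos by auto
  show ?thesis
  proof (rule exI[of _ "D * (3 * (1 + 3 / r) + 1)"], intro allI impI)
    fix n L :: nat and p \<rho> :: real and g B0 and q :: nat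
    assume a: "sbm_model K n L g B0 b \<rho> \<and> balanced K n g c C \<and> eigen_gap K L B0 c \<and>
      0 < p \<and> p \<le> 1 \<and> aq * ln (real n) \<le> real q \<and> r * ln (real L + real n) / (p * real n) \<le> \<rho>"
    have sbm: "sbm K n L g B0 (max b 1) \<rho> c C p" by (rule sbm_of_model) (use a K pos in auto)
    obtain E where E: "E \<in> sets (rsc_space L n K g (\<lambda>l k k'. \<rho> * B0 l k k') p)"
        "1 - 3 / (real L + real n) - exp (- real K) \<le> measure (rsc_space L n K g (\<lambda>l k k'. \<rho> * B0 l k k') p) E"
        "\<forall>((a,s),W)\<in>E. \<forall>h\<in>rsc_outputs L n K q p a s W.
         misclass_rate n K (membership g) (membership h) \<le> D * (sbm.theta n L (max b 1) \<rho> p + 1 / (real n)\<^sup>2)"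
      using ev[rule_format, of n L g B0 \<rho> p q] sbm a by blast
    show "\<exists>E\<in>sets (rsc_space L n K g (\<lambda>l k k'. \<rho> * B0 l k k') p).
      1 - 3 * (real L + real n) powr (- 1) - 2 * exp (- 1 * real K)
        < measure (rsc_space L n K g (\<lambda>l k k'. \<rho> * B0 l k k') p) E \<and>
      (\<forall>((A, S), W)\<in>E. \<forall>h\<in>rsc_outputs L n K q p A S W.
        misclass_rate n K (membership g) (membership h)
          \<le> D * (3 * (1 + 3 / r) + 1) * max (ln (real L + real n) / (p * real L * real n * \<rho>)) (1 / (real n)\<^sup>2))"
      by (rule rate_event[OF E(1,2) _ E(3) theta_dense[OF sbm] _ D]) (use a pos in \<open>auto simp: sbm_model_def\<close>)
  qed
qed

theorem theorem1:
  shows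
  "(\<exists>c2>0. \<forall>(K::nat) (c::real) (C::real) (b::real) (aq::real) (bq::real) (r1::real) (r2::real).
      K \<ge> 1 \<and> c > 0 \<and> C > 0 \<and> b \<ge> 0 \<and> 0 < aq \<and> aq \<le> bq \<and> r1 > 0 \<and> r2 > 0 \<longrightarrow>
      (\<exists>c1>0. \<exists>C0 C1::real. \<forall>(n::nat) (L::nat) (p::real) (\<rho>::real) (g::nat \<Rightarrow> nat)
           (B0::nat \<Rightarrow> nat \<Rightarrow> nat \<Rightarrow> real) (q::nat).
         sbm_model K n L g B0 b \<rho> \<and> balanced K n g c C \<and> eigen_gap K L B0 c \<and>
         0 < p \<and> p \<le> 1 \<and> aq * ln (real n) \<le> real q \<and> real q \<le> bq * ln (real n) \<and>
         r1 * ln (real L + real n) / (p * real n * sqrt (real L)) \<le> \<rho> \<and> \<rho> \<le> r2 / (p * real n)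
         \<longrightarrow>
         (\<exists>E \<in> sets (rsc_space L n K g (\<lambda>l k k'. \<rho> * B0 l k k') p).
            measure (rsc_space L n K g (\<lambda>l k k'. \<rho> * B0 l k k') p) E
              > 1 - C0 * (real L + real n) powr (- c1) - 2 * exp (- c2 * real K) \<and>
            (\<forall>((A, S), W) \<in> E. \<forall>h \<in> rsc_outputs L n K q p A S W.
               misclass_rate n K (membership g) (membership h)
                 \<le> C1 * max ((ln (real L + real n)) ^ 2 / (p ^ 3 * real L * (real n) ^ 2 * \<rho> ^ 2))
                             (1 / (real n) ^ 2)))))
   \<and>
   (\<exists>c4>0. \<forall>(K::nat) (c::real) (C::real) (b::real) (aq::real) (bq::real) (r::real).
      K \<ge> 1 \<and> c > 0 \<and> C > 0 \<and> b \<ge> 0 \<and> 0 < aq \<and> aq \<le> bq \<and> r > 0 \<longrightarrow>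
      (\<exists>c3>0. \<exists>C0 C1::real. \<forall>(n::nat) (L::nat) (p::real) (\<rho>::real) (g::nat \<Rightarrow> nat)
           (B0::nat \<Rightarrow> nat \<Rightarrow> nat \<Rightarrow> real) (q::nat).
         sbm_model K n L g B0 b \<rho> \<and> balanced K n g c C \<and> eigen_gap K L B0 c \<and>
         0 < p \<and> p \<le> 1 \<and> aq * ln (real n) \<le> real q \<and> real q \<le> bq * ln (real n) \<and>
         r * ln (real L + real n) / (p * real n) \<le> \<rho>
         \<longrightarrow>
         (\<exists>E \<in> sets (rsc_space L n K g (\<lambda>l k k'. \<rho> * B0 l k k') p).
            measure (rsc_space L n K g (\<lambda>l k k'. \<rho> * B0 l k k') p) E
              > 1 - C0 * (real L + real n) powr (- c3) - 2 * exp (- c4 * real K) \<and>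
            (\<forall>((A, S), W) \<in> E. \<forall>h \<in> rsc_outputs L n K q p A S W.
               misclass_rate n K (membership g) (membership h)
                 \<le> C1 * max (ln (real L + real n) / (p * real L * real n * \<rho>))
                             (1 / (real n) ^ 2)))))"
proof (intro conjI, goal_cases)
  case 1
  show ?case
  proof (rule exI[of _ "1::real"], rule conjI[OF zero_less_one], intro allI impI, goal_cases)
    case (1 K c C b aq bq r1 r2)
    then have "1 \<le> K" "0 < c" "0 < C" "0 < aq" "0 < r2" by simp_all
    note rate = sparse_rate[OF this, of b]
    \<comment> \<open>The exponent 1 and the constant 3 are those of the failure probability
      \<open>3 / (L + n)\<close> and depend on no parameter; all dependence on the parameters sits
      in \<open>C1\<close>.\<close>
    show ?case
      by (rule exI[of _ "1::real"], rule conjI[OF zero_less_one], rule exI[of _ "3::real"],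
          rule ex_forward[OF rate]) blast
  qed
next
  case 2
  show ?case
  proof (rule exI[of _ "1::real"], rule conjI[OF zero_less_one], intro allI impI, goal_cases)
    case (1 K c C b aq bq r)
    then have "1 \<le> K" "0 < c" "0 < C" "0 < aq" "0 < r" by simp_all
    note rate = dense_rate[OF this, of b]
    show ?case
      by (rule exI[of _ "1::real"], rule conjI[OF zero_less_one], rule exI[of _ "3::real"],
          rule ex_forward[OF rate]) blast
  qed
qed

end
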